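(* Let $(G_n)_{n\ge1}$ be a strictly monotone sequence of 2-edge-connected graphs such that the maximum genera $\gamma_{\max}(G_n)$ of all the graphs $G_n$ are bounded by some uniform constant. Then the Euler-genus distributions of $G_n$ are asymptotically normal, i.e. the sequence of random variables $(\gamma^{E}_{G_n})_{n\ge1}$ is asymptotically normal.
   Context: Graphs are finite and connected, with loops and multiple edges allowed. Two graphs are homeomorphic if one can be obtained from the other by edge subdivisions and smoothings of degree-2 vertices. A sequence of graphs $(G_i)_{i\ge1}$ is strictly monotone if (1) for any $i,j$, the graphs $G_i$ and $G_j$ are homeomorphic if and only if $i=j$; and (2) each $G_i$ is homeomorphic to a subgraph of $G_{i+1}$. Orientable cellular embeddings of a graph $G$ are counted as rotation systems, i.e. a choice of cyclic order of the edge-ends around each vertex. General cellular embeddings of $G$ are described by signed rotation systems, i.e. a rotation system together with a choice, for each edge, of being twisted or untwisted, counted up to reversing the local orientation at vertices (a uniformly random signed rotation system gives the same Euler-genus distribution). If $f$ is the number of faces, the Euler-genus is $2-|V|+|E|-f$; for an orientable embedding the genus is half of the Euler-genus. $\gamma_{\max}(G)$ is the maximum genus over all orientable embeddings of $G$, and $\gamma^{E}_G$ is the Euler-genus of a uniformly random general embedding of $G$. A sequence of real random variables $(X_n)$ is asymptotically normal if $(X_n-\mathbb{E}X_n)/\sqrt{\mathrm{Var}\,X_n}$ converges in distribution to $\mathcal N(0,1)$. *)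

theory Defs
  imports
    "HOL-Probability.Probability"
    "HOL-Combinatorics.Orbits"
    "HOL-Library.Infinite_Typeclass"
    "Graph_Theory.Graph_Theory"
begin

text \<open>
  An undirected multigraph, with loops and multiple edges allowed, is a bidirected digraph: a
  digraph together with a fixed-point free involution on its arcs that reverses their direction.
  An undirected edge is a pair of mutually reverse arcs (for a loop too, so that a loop at a vertex
  consists of two distinct arcs), and the arc \<open>a\<close> stands for the edge-end at its tail.
\<close>

type_synonym ('v, 'e) multigraph = "('v, 'e) pre_digraph \<times> ('e \<Rightarrow> 'e)"

definition connected_multigraph :: "('v, 'e) multigraph \<Rightarrow> bool" where
  "connected_multigraph M \<longleftrightarrow> fin_digraph (fst M) \<and> bidirected_digraph (fst M) (snd M) \<and>
     Digraph_Component.connected (fst M)"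

definition undirected_edge :: "('v, 'e) multigraph \<Rightarrow> 'e \<Rightarrow> 'e set" where
  "undirected_edge M a = {a, snd M a}"

definition edges :: "('v, 'e) multigraph \<Rightarrow> 'e set set" where
  "edges M = undirected_edge M ` arcs (fst M)"

definition two_edge_connected :: "('v, 'e) multigraph \<Rightarrow> bool" where
  "two_edge_connected M \<longleftrightarrow> Digraph_Component.connected (fst M) \<and>
     (\<forall>e\<in>edges M. Digraph_Component.connected ((fst M)\<lparr>arcs := arcs (fst M) - e\<rparr>))"


subsection \<open>Homeomorphism and strictly monotone sequences\<close>

definition multigraph_iso :: "('v, 'e) multigraph \<Rightarrow> ('v, 'e) multigraph \<Rightarrow> bool" where
  "multigraph_iso M N \<longleftrightarrow>
     bidirected_digraph (fst M) (snd M) \<and> bidirected_digraph (fst N) (snd N) \<and>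
     (\<exists>f. pre_digraph.digraph_isomorphism (fst M) f \<and> fst N = app_iso f (fst M) \<and>
          (\<forall>a\<in>arcs (fst M). iso_arcs f (snd M a) = snd N (iso_arcs f a)))"

text \<open>
  Smoothing a vertex of degree 2 is the inverse of subdividing an edge. The library's
  \<^const>\<open>subdivision\<close> keeps the functions \<^const>\<open>tail\<close> and \<^const>\<open>head\<close> fixed on the whole arc type,
  so their values outside the graph have to be adjusted, by an isomorphism, before subdividing.
  All graphs of the chain live on the same types, which must be infinite for this to be
  the usual notion: otherwise there may be no fresh vertex or arc left to subdivide with.
\<close>

definition homeomorphic_graphs :: "('v, 'e) multigraph \<Rightarrow> ('v, 'e) multigraph \<Rightarrow> bool" where
  "homeomorphic_graphs = equivclp (\<lambda>M N. multigraph_iso M N \<or> subdivision M N)"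

definition submultigraph :: "('v, 'e) multigraph \<Rightarrow> ('v, 'e) multigraph \<Rightarrow> bool" where
  "submultigraph N M \<longleftrightarrow> subgraph (fst N) (fst M) \<and> bidirected_digraph (fst N) (snd N) \<and>
     (\<forall>a\<in>arcs (fst N). snd N a = snd M a)"

definition strictly_monotone :: "(nat \<Rightarrow> ('v, 'e) multigraph) \<Rightarrow> bool" where
  "strictly_monotone G \<longleftrightarrow>
     (\<forall>i j. homeomorphic_graphs (G i) (G j) \<longleftrightarrow> i = j) \<and>
     (\<forall>i. \<exists>H. submultigraph H (G (Suc i)) \<and> homeomorphic_graphs (G i) H)"


subsection \<open>Rotation systems, faces and genus\<close>

definition rotation_systems :: "('v, 'e) multigraph \<Rightarrow> ('e \<Rightarrow> 'e) set" where
  "rotation_systems M = {rot. rot permutes arcs (fst M) \<and>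
     (\<forall>v\<in>verts (fst M). out_arcs (fst M) v \<noteq> {} \<longrightarrow> cyclic_on rot (out_arcs (fst M) v))}"

text \<open>A signed rotation system is a rotation system with the set of twisted edges.\<close>

type_synonym 'e signed_rotation = "('e \<Rightarrow> 'e) \<times> 'e set set"

definition signed_rotation_systems :: "('v, 'e) multigraph \<Rightarrow> 'e signed_rotation set" where
  "signed_rotation_systems M = rotation_systems M \<times> Pow (edges M)"

text \<open>
  Faces are the boundary components of the ribbon graph (vertex discs joined by edge ribbons). Each
  edge-end \<open>a\<close> has two corner points, one per side of the ribbon: \<open>(a, True)\<close> on the side of
  its successor in the rotation, and \<open>(a, False)\<close> on the side of its predecessor. A boundary arc of a
  vertex disc joins \<open>(a, True)\<close> to \<open>(rot a, False)\<close>. A side of a ribbon joins opposite labels if the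
  edge is untwisted, since the rotation orders the sides oppositely when seen from the two ends,
  and equal labels if it is twisted.
\<close>

definition boundary_arcs ::
    "('v, 'e) multigraph \<Rightarrow> 'e signed_rotation \<Rightarrow> (('e \<times> bool) \<times> ('e \<times> bool)) set" where
  "boundary_arcs M = (\<lambda>(rot, T).
     {((a, True), (rot a, False)) | a. a \<in> arcs (fst M)} \<union>
     {((a, s), (snd M a, if undirected_edge M a \<in> T then s else \<not> s)) | a s. a \<in> arcs (fst M)})"

definition faces :: "('v, 'e) multigraph \<Rightarrow> 'e signed_rotation \<Rightarrow> ('e \<times> bool) set set" where
  "faces M \<sigma> = (arcs (fst M) \<times> UNIV) // (boundary_arcs M \<sigma> \<union> (boundary_arcs M \<sigma>)\<inverse>)\<^sup>*"

text \<open>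
  The disc of a vertex without edge-ends has no corner points, but contributes one
  boundary component; this only concerns the graph with a single vertex and no edges.
\<close>

definition num_faces :: "('v, 'e) multigraph \<Rightarrow> 'e signed_rotation \<Rightarrow> nat" where
  "num_faces M \<sigma> = card (faces M \<sigma>) + card {v\<in>verts (fst M). out_arcs (fst M) v = {}}"

definition euler_genus :: "('v, 'e) multigraph \<Rightarrow> 'e signed_rotation \<Rightarrow> int" where
  "euler_genus M \<sigma> =
     2 - int (card (verts (fst M))) + int (card (edges M)) - int (num_faces M \<sigma>)"

text \<open>The orientable embeddings are the signed rotation systems without twisted edges.\<close>

definition genus :: "('v, 'e) multigraph \<Rightarrow> ('e \<Rightarrow> 'e) \<Rightarrow> real" where
  "genus M rot = real_of_int (euler_genus M (rot, {})) / 2"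

definition max_genus :: "('v, 'e) multigraph \<Rightarrow> real" where
  "max_genus M = Max (genus M ` rotation_systems M)"


subsection \<open>General embeddings\<close>

text \<open>
  Reversing the local orientation at all vertices of \<open>S\<close> inverts the rotation there and changes the
  twist of exactly the edges with one end in \<open>S\<close> and the other end outside \<open>S\<close>
  (an edge with both ends in \<open>S\<close>, such as a loop, changes twice).
\<close>

definition cut_edges :: "('v, 'e) multigraph \<Rightarrow> 'v set \<Rightarrow> 'e set set" where
  "cut_edges M S =
     {undirected_edge M a | a. a \<in> arcs (fst M) \<and> tail (fst M) a \<in> S \<and> head (fst M) a \<notin> S}"

definition reverse_at ::
    "('v, 'e) multigraph \<Rightarrow> 'v set \<Rightarrow> 'e signed_rotation \<Rightarrow> 'e signed_rotation" where
  "reverse_at M S = (\<lambda>(rot, T).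
     (\<lambda>a. if a \<in> arcs (fst M) \<and> tail (fst M) a \<in> S then inv rot a else rot a,
      sym_diff T (cut_edges M S)))"

definition reversal_rel ::
    "('v, 'e) multigraph \<Rightarrow> ('e signed_rotation \<times> 'e signed_rotation) set" where
  "reversal_rel M =
     {(\<sigma>, reverse_at M S \<sigma>) | \<sigma> S. \<sigma> \<in> signed_rotation_systems M \<and> S \<subseteq> verts (fst M)}"

definition general_embeddings :: "('v, 'e) multigraph \<Rightarrow> 'e signed_rotation set set" where
  "general_embeddings M = signed_rotation_systems M // reversal_rel M"

definition embedding_euler_genus :: "('v, 'e) multigraph \<Rightarrow> 'e signed_rotation set \<Rightarrow> int" where
  "embedding_euler_genus M C = the_elem (euler_genus M ` C)"

text \<open>
  These notions are well defined: \<open>reversal_rel\<close> is an equivalence relation, and the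
  Euler-genus is constant on its classes.
\<close>

lemma rotation_system_arcs:
  assumes "bidirected_digraph (fst M) (snd M)" "rot \<in> rotation_systems M"
  shows "rot a \<in> arcs (fst M) \<longleftrightarrow> a \<in> arcs (fst M)"
    and "inv rot a \<in> arcs (fst M) \<longleftrightarrow> a \<in> arcs (fst M)"
    and "a \<in> arcs (fst M) \<Longrightarrow> tail (fst M) (rot a) = tail (fst M) a"
    and "a \<in> arcs (fst M) \<Longrightarrow> tail (fst M) (inv rot a) = tail (fst M) a"
    and "rot (inv rot a) = a" and "inv rot (rot a) = a"
proof -
  interpret bidirected_digraph "fst M" "snd M" by fact
  have perm: "rot permutes arcs (fst M)" using assms(2) by (simp add: rotation_systems_def)
  have *: "tail (fst M) (rot b) = tail (fst M) b" if b: "b \<in> arcs (fst M)" for b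
  proof -
    have "b \<in> out_arcs (fst M) (tail (fst M) b)" using b by simp
    moreover have "cyclic_on rot (out_arcs (fst M) (tail (fst M) b))"
      using assms(2) b calculation tail_in_verts[OF b] unfolding rotation_systems_def by blast
    ultimately have "rot b \<in> out_arcs (fst M) (tail (fst M) b)"
      by (metis cyclic_on_inI)
    then show ?thesis by simp
  qed
  show 1: "rot a \<in> arcs (fst M) \<longleftrightarrow> a \<in> arcs (fst M)" 
    and 2: "inv rot a \<in> arcs (fst M) \<longleftrightarrow> a \<in> arcs (fst M)"
    using perm by (auto simp: permutes_in_image permutes_inv)
  show 3: "rot (inv rot a) = a" and "inv rot (rot a) = a"
    using perm by (simp_all add: permutes_inverses)
  show "a \<in> arcs (fst M) \<Longrightarrow> tail (fst M) (rot a) = tail (fst M) a" using * .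
  show "a \<in> arcs (fst M) \<Longrightarrow> tail (fst M) (inv rot a) = tail (fst M) a"
    using *[of "inv rot a"] 2 3 by simp
qed

lemma undirected_edge_eq_iff:
  assumes "bidirected_digraph (fst M) (snd M)"
  shows "undirected_edge M a = undirected_edge M b \<longleftrightarrow> b = a \<or> b = snd M a"
proof -
  interpret bidirected_digraph "fst M" "snd M" by fact
  show ?thesis unfolding undirected_edge_def doubleton_eq_iff by auto
qed

lemma undirected_edge_in_cut_iff:
  assumes "bidirected_digraph (fst M) (snd M)" "a \<in> arcs (fst M)"
  shows "undirected_edge M a \<in> cut_edges M S \<longleftrightarrow>
           (tail (fst M) a \<in> S \<longleftrightarrow> head (fst M) a \<notin> S)"
proof -
  interpret bidirected_digraph "fst M" "snd M" by fact
  show ?thesis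
    using assms(2) arev_in_arcs[OF assms(2)] tail_arev[OF assms(2)] head_arev[OF assms(2)]
    unfolding cut_edges_def
    by (auto simp: undirected_edge_eq_iff[OF assms(1)])
qed

lemma cut_edges_sym_diff:
  assumes "bidirected_digraph (fst M) (snd M)"
  shows "sym_diff (cut_edges M S) (cut_edges M S') = cut_edges M (sym_diff S S')"
proof -
  have sub: "e \<in> cut_edges M R \<Longrightarrow> \<exists>a\<in>arcs (fst M). e = undirected_edge M a" for e R
    by (auto simp: cut_edges_def)
  show ?thesis
  proof (intro set_eqI iffI)
    fix e assume e: "e \<in> sym_diff (cut_edges M S) (cut_edges M S')"
    then obtain a where "a \<in> arcs (fst M)" "e = undirected_edge M a" using sub by blast
    with e show "e \<in> cut_edges M (sym_diff S S')"
      by (auto simp: undirected_edge_in_cut_iff[OF assms])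
  next
    fix e assume e: "e \<in> cut_edges M (sym_diff S S')"
    then obtain a where "a \<in> arcs (fst M)" "e = undirected_edge M a" using sub by blast
    with e show "e \<in> sym_diff (cut_edges M S) (cut_edges M S')"
      by (auto simp: undirected_edge_in_cut_iff[OF assms])
  qed
qed

lemma inv_reverse_at:
  assumes "bidirected_digraph (fst M) (snd M)" "rot \<in> rotation_systems M"
  shows "inv (fst (reverse_at M S (rot, T))) =
           (\<lambda>a. if a \<in> arcs (fst M) \<and> tail (fst M) a \<in> S then rot a else inv rot a)"
    and "bij (fst (reverse_at M S (rot, T)))"
proof -
  note r = rotation_system_arcs[OF assms]
  let ?f = "fst (reverse_at M S (rot, T))"
  let ?g = "\<lambda>a. if a \<in> arcs (fst M) \<and> tail (fst M) a \<in> S then rot a else inv rot a"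
  have "?f (?g a) = a" "?g (?f a) = a" for a
    using r[of a] by (auto simp: reverse_at_def)
  then have fg: "?f \<circ> ?g = id" "?g \<circ> ?f = id" by (simp_all add: fun_eq_iff)
  show "inv ?f = ?g" by (rule inv_unique_comp) (rule fg)+
  show "bij ?f" by (rule o_bij[of ?g]) (rule fg)+
qed

lemma orbit_inv_eq_of_permutes:
  assumes "rot permutes A" "finite A"
  shows "orbit (inv rot) a = orbit rot a"
  using assms by (intro orbit_inv_eq) (auto simp: permutation_permutes)

lemma reverse_at_in_signed_rotation_systems:
  assumes "fin_digraph (fst M)" "bidirected_digraph (fst M) (snd M)"
    and "\<sigma> \<in> signed_rotation_systems M"
  shows "reverse_at M S \<sigma> \<in> signed_rotation_systems M"
proof -
  interpret fin_digraph "fst M" by fact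
  obtain rot T where \<sigma>: "\<sigma> = (rot, T)" and rot: "rot \<in> rotation_systems M" and T: "T \<subseteq> edges M"
    using assms(3) by (auto simp: signed_rotation_systems_def)
  note r = rotation_system_arcs[OF assms(2) rot]
  let ?f = "fst (reverse_at M S (rot, T))"
  have perm: "rot permutes arcs (fst M)" using rot by (simp add: rotation_systems_def)
  have fix_out: "?f a = a" if "a \<notin> arcs (fst M)" for a
    using that perm by (simp add: reverse_at_def permutes_not_in)
  have "?f permutes arcs (fst M)"
    unfolding permutes_def
    using inv_reverse_at(2)[OF assms(2) rot, of S T, unfolded bij_iff] fix_out by blast
  moreover have "cyclic_on ?f (out_arcs (fst M) v)"
    if v: "v \<in> verts (fst M)" "out_arcs (fst M) v \<noteq> {}" for v
  proof -
    obtain s where s: "s \<in> out_arcs (fst M) v" "out_arcs (fst M) v = orbit rot s"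
      using rot v by (auto simp: rotation_systems_def cyclic_on_def)
    have "orbit ?f s = orbit rot s"
    proof (cases "v \<in> S")
      case True
      have "orbit ?f s = orbit (inv rot) s"
        by (rule orbit_cong0[where A = "out_arcs (fst M) v"])
           (use s(1) True r in \<open>auto simp: reverse_at_def\<close>)
      then show ?thesis using orbit_inv_eq_of_permutes[OF perm] by simp
    next
      case False
      show ?thesis
        by (rule orbit_cong0[where A = "out_arcs (fst M) v"])
           (use s(1) False r in \<open>auto simp: reverse_at_def\<close>)
    qed
    then show ?thesis using s unfolding cyclic_on_def by blast
  qed
  moreover have "snd (reverse_at M S (rot, T)) \<subseteq> edges M"
    using T by (auto simp: reverse_at_def cut_edges_def edges_def)
  ultimately show ?thesis
    unfolding \<sigma> signed_rotation_systems_def rotation_systems_def by (auto simp: mem_Times_iff)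
qed

lemma reverse_at_reverse_at:
  assumes "bidirected_digraph (fst M) (snd M)" "\<sigma> \<in> signed_rotation_systems M"
  shows "reverse_at M S' (reverse_at M S \<sigma>) = reverse_at M (sym_diff S S') \<sigma>"
proof -
  obtain rot T where \<sigma>: "\<sigma> = (rot, T)" and rot: "rot \<in> rotation_systems M"
    using assms(2) by (auto simp: signed_rotation_systems_def)
  have "sym_diff (sym_diff T (cut_edges M S)) (cut_edges M S') =
        sym_diff T (cut_edges M (sym_diff S S'))"
    unfolding cut_edges_sym_diff[OF assms(1), symmetric] by blast
  then show ?thesis
    using inv_reverse_at(1)[OF assms(1) rot, of S T]
    by (auto simp: reverse_at_def \<sigma> fun_eq_iff)
qed

lemma equiv_reversal_rel:
  assumes "fin_digraph (fst M)" "bidirected_digraph (fst M) (snd M)"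
  shows "equiv (signed_rotation_systems M) (reversal_rel M)"
proof (rule equivI)
  note closed = reverse_at_in_signed_rotation_systems[OF assms]
  note comp = reverse_at_reverse_at[OF assms(2)]
  have id: "reverse_at M {} \<sigma> = \<sigma>" for \<sigma>
    by (auto simp: reverse_at_def cut_edges_def split: prod.split)
  show "reversal_rel M \<subseteq> signed_rotation_systems M \<times> signed_rotation_systems M"
    using closed by (auto simp: reversal_rel_def)
  show "refl_on (signed_rotation_systems M) (reversal_rel M)"
    unfolding refl_on_def reversal_rel_def
    by (auto intro!: exI[of _ "{}"] simp: id)
  show "sym (reversal_rel M)"
  proof (rule symI)
    fix \<sigma> \<tau> assume "(\<sigma>, \<tau>) \<in> reversal_rel M"
    then obtain S where S: "\<sigma> \<in> signed_rotation_systems M" "S \<subseteq> verts (fst M)"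
      "\<tau> = reverse_at M S \<sigma>" by (auto simp: reversal_rel_def)
    then have "\<sigma> = reverse_at M S \<tau>" using comp[OF S(1), of S S] id by simp
    moreover have "\<tau> \<in> signed_rotation_systems M" using S closed[OF S(1)] by simp
    ultimately show "(\<tau>, \<sigma>) \<in> reversal_rel M" using S(2) unfolding reversal_rel_def by blast
  qed
  show "trans (reversal_rel M)"
  proof (rule transI)
    fix \<sigma> \<tau> \<rho> assume "(\<sigma>, \<tau>) \<in> reversal_rel M" "(\<tau>, \<rho>) \<in> reversal_rel M"
    then obtain S S' where S: "\<sigma> \<in> signed_rotation_systems M" "S \<subseteq> verts (fst M)"
      "S' \<subseteq> verts (fst M)" "\<rho> = reverse_at M S' (reverse_at M S \<sigma>)"
      by (auto simp: reversal_rel_def)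
    then have "\<rho> = reverse_at M (sym_diff S S') \<sigma>" "sym_diff S S' \<subseteq> verts (fst M)"
      using comp[OF S(1)] by auto
    then show "(\<sigma>, \<rho>) \<in> reversal_rel M" using S(1) unfolding reversal_rel_def by blast
  qed
qed

definition swap_sides :: "('v, 'e) multigraph \<Rightarrow> 'v set \<Rightarrow> 'e \<times> bool \<Rightarrow> 'e \<times> bool" where
  "swap_sides M S = (\<lambda>(a, s). (a, if tail (fst M) a \<in> S then \<not> s else s))"

lemma swap_sides_boundary:
  assumes "bidirected_digraph (fst M) (snd M)" "\<sigma> \<in> signed_rotation_systems M"
    and "(x, y) \<in> (boundary_arcs M \<sigma> \<union> (boundary_arcs M \<sigma>)\<inverse>)\<^sup>*"
  shows "(swap_sides M S x, swap_sides M S y) \<in>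
    (boundary_arcs M (reverse_at M S \<sigma>) \<union> (boundary_arcs M (reverse_at M S \<sigma>))\<inverse>)\<^sup>*"
proof -
  interpret bidirected_digraph "fst M" "snd M" by fact
  obtain rot T where \<sigma>: "\<sigma> = (rot, T)" and rot: "rot \<in> rotation_systems M"
    using assms(2) by (auto simp: signed_rotation_systems_def)
  note r = rotation_system_arcs[OF assms(1) rot]
  let ?h = "swap_sides M S"
  let ?B = "boundary_arcs M \<sigma> \<union> (boundary_arcs M \<sigma>)\<inverse>"
  let ?B' = "boundary_arcs M (reverse_at M S \<sigma>) \<union> (boundary_arcs M (reverse_at M S \<sigma>))\<inverse>"
  have step1: "(?h x, ?h y) \<in> ?B'" if "(x, y) \<in> boundary_arcs M \<sigma>" for x y
  proof -
    from that consider
        (corner) a where "a \<in> arcs (fst M)" "x = (a, True)" "y = (rot a, False)"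
      | (side) a s where "a \<in> arcs (fst M)" "x = (a, s)"
          "y = (snd M a, if undirected_edge M a \<in> T then s else \<not> s)"
      by (auto simp: boundary_arcs_def \<sigma>)
    then show ?thesis
    proof cases
      case corner
      then show ?thesis
        using r[of a] r[of "rot a"] unfolding swap_sides_def boundary_arcs_def reverse_at_def \<sigma>
        by (cases "tail (fst M) a \<in> S") force+
    next
      case side
      have "undirected_edge M a \<in> sym_diff T (cut_edges M S) \<longleftrightarrow>
          ((undirected_edge M a \<in> T) \<noteq> (tail (fst M) a \<in> S \<longleftrightarrow> head (fst M) a \<notin> S))"
        using undirected_edge_in_cut_iff[OF assms(1) side(1), of S] by blast
      then have "snd (?h y) = (if undirected_edge M a \<in> sym_diff T (cut_edges M S)
          then snd (?h x) else \<not> snd (?h x))"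
        using side(1) unfolding side(2,3) swap_sides_def by auto
      moreover have "fst (?h y) = snd M a" "fst (?h x) = a" by (auto simp: swap_sides_def side(2,3))
      ultimately have "(?h x, ?h y) \<in> boundary_arcs M (reverse_at M S \<sigma>)"
        using side(1) unfolding boundary_arcs_def reverse_at_def \<sigma>
        by (cases "?h x"; cases "?h y") (simp; blast)
      then show ?thesis by blast
    qed
  qed
  then have edge: "(?h x, ?h y) \<in> ?B'" if "(x, y) \<in> ?B" for x y using that by blast
  show ?thesis
    using assms(3)
  proof induction
    case (step y z)
    then show ?case using edge[of y z] by (meson rtrancl.rtrancl_into_rtrancl)
  qed simp
qed

lemma faces_reverse_at:
  assumes "fin_digraph (fst M)" "bidirected_digraph (fst M) (snd M)"
    and "\<sigma> \<in> signed_rotation_systems M"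
  shows "faces M (reverse_at M S \<sigma>) = image (swap_sides M S) ` faces M \<sigma>"
proof -
  let ?h = "swap_sides M S" and ?F = "arcs (fst M) \<times> (UNIV :: bool set)"
  let ?E = "\<lambda>\<tau>. (boundary_arcs M \<tau> \<union> (boundary_arcs M \<tau>)\<inverse>)\<^sup>*"
  have hh: "?h (?h x) = x" for x by (auto simp: swap_sides_def split: prod.split)
  have "reverse_at M S (reverse_at M S \<sigma>) = \<sigma>"
    using reverse_at_reverse_at[OF assms(2,3), of S S]
    by (auto simp: reverse_at_def cut_edges_def split: prod.split)
  then have 1: "(?h x, ?h y) \<in> ?E (reverse_at M S \<sigma>) \<longleftrightarrow> (x, y) \<in> ?E \<sigma>" for x y
    using swap_sides_boundary[OF assms(2,3), of x y S] hh
      swap_sides_boundary[OF assms(2) reverse_at_in_signed_rotation_systems[OF assms],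
        of "?h x" "?h y" S S]
    by auto
  have 2: "?E (reverse_at M S \<sigma>) `` {?h x} = ?h ` (?E \<sigma> `` {x})" for x
  proof (intro set_eqI iffI)
    fix y assume "y \<in> ?E (reverse_at M S \<sigma>) `` {?h x}"
    then have "(x, ?h y) \<in> ?E \<sigma>" using 1[of x "?h y"] hh by simp
    then show "y \<in> ?h ` (?E \<sigma> `` {x})" using hh by (metis Image_singleton_iff image_eqI)
  next
    fix y assume "y \<in> ?h ` (?E \<sigma> `` {x})"
    then show "y \<in> ?E (reverse_at M S \<sigma>) `` {?h x}" using 1 by auto
  qed
  have hF: "?h x \<in> ?F \<longleftrightarrow> x \<in> ?F" for x
    by (cases x) (auto simp: swap_sides_def)
  have 3: "?F = ?h ` ?F"
  proof (intro set_eqI iffI)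
    fix x assume "x \<in> ?F"
    then show "x \<in> ?h ` ?F" using hF hh by (metis image_eqI)
  next
    fix x assume "x \<in> ?h ` ?F"
    then show "x \<in> ?F" using hF by blast
  qed
  show ?thesis
    unfolding faces_def quotient_def
    by (subst 3) (auto simp: 2 simp del: Image_singleton_iff)
qed

lemma euler_genus_reverse_at:
  assumes "fin_digraph (fst M)" "bidirected_digraph (fst M) (snd M)"
    and "\<sigma> \<in> signed_rotation_systems M"
  shows "euler_genus M (reverse_at M S \<sigma>) = euler_genus M \<sigma>"
proof -
  have "swap_sides M S (swap_sides M S x) = x" for x
    by (auto simp: swap_sides_def split: prod.split)
  then have "inj (swap_sides M S)" by (metis injI)
  then have "inj_on (image (swap_sides M S)) (faces M \<sigma>)"
    by (meson inj_on_image inj_on_subset subset_UNIV)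
  then show ?thesis
    unfolding euler_genus_def num_faces_def faces_reverse_at[OF assms] by (simp add: card_image)
qed

lemma embedding_euler_genus_eq:
  assumes "fin_digraph (fst M)" "bidirected_digraph (fst M) (snd M)"
    and "C \<in> general_embeddings M" "\<sigma> \<in> C"
  shows "embedding_euler_genus M C = euler_genus M \<sigma>"
proof -
  note eq = equiv_reversal_rel[OF assms(1,2)]
  have C: "C = reversal_rel M `` {\<sigma>}" and \<sigma>: "\<sigma> \<in> signed_rotation_systems M"
  proof -
    obtain \<tau> where \<tau>: "\<tau> \<in> signed_rotation_systems M" "C = reversal_rel M `` {\<tau>}"
      using assms(3) unfolding general_embeddings_def by (rule quotientE)
    then have "(\<tau>, \<sigma>) \<in> reversal_rel M" using assms(4) by simp
    then show "C = reversal_rel M `` {\<sigma>}" "\<sigma> \<in> signed_rotation_systems M"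
      using equiv_class_eq[OF eq] \<tau>(2) equiv_class_eq_iff[OF eq] by blast+
  qed
  have "euler_genus M \<tau> = euler_genus M \<sigma>" if "\<tau> \<in> C" for \<tau>
    using that euler_genus_reverse_at[OF assms(1,2) \<sigma>] unfolding C reversal_rel_def by auto
  then have "euler_genus M ` C = {euler_genus M \<sigma>}" using assms(4) by blast
  then show ?thesis by (simp add: embedding_euler_genus_def)
qed

subsection \<open>Asymptotic normality\<close>

definition asymptotically_normal :: "(nat \<Rightarrow> 'a measure) \<Rightarrow> (nat \<Rightarrow> 'a \<Rightarrow> real) \<Rightarrow> bool" where
  "asymptotically_normal M X \<longleftrightarrow> weak_conv_m
     (\<lambda>n. distr (M n) borel (\<lambda>\<omega>. (X n \<omega> - prob_space.expectation (M n) (X n)) /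
                                   sqrt (prob_space.variance (M n) (X n))))
     std_normal_distribution"

end

theory Submission
  imports Defs "HOL-Real_Asymp.Real_Asymp"
begin

text \<open>
  Over the field with two elements, the Euler-genus of a signed rotation system is the rank of the
  intersection form on the cycle space. Twisting the edges of \<open>T\<close> adds the form
  \<open>D\<^sub>T(c, d) = card (T \<inter> c \<inter> d) mod 2\<close>, while the form of the untwisted rotation system has rank at
  most \<open>2 \<gamma>\<^sub>m\<^sub>a\<^sub>x\<close>; hence the Euler-genus is the rank of \<open>D\<^sub>T\<close> up to a bounded error, and the
  rotation plays no role.

  To evaluate the rank of \<open>D\<^sub>T\<close>, take a rotation system of maximum genus. No three of its faces meet
  at a vertex, for otherwise they could be merged. Therefore the edges between two given faces form a
  cycle modulo 2, and the cycles of different pairs of faces are disjoint. Together they generate a subspace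
  of the cycle space of codimension at most \<open>2 \<gamma>\<^sub>m\<^sub>a\<^sub>x\<close> on which \<open>D\<^sub>T\<close> is diagonal, so up to a
  bounded error its rank is the number of cycles containing an odd number of twisted edges.
  For random \<open>T\<close> this is a binomial random variable with parameter \<open>1/2\<close>, and the number of
  cycles tends to infinity because the Betti number is strictly increasing along the sequence. The bounded
  error disappears in the limit.

  Ranks are measured through cardinalities: a subspace is a family of sets closed under
  symmetric difference, and \<open>face_space\<close> is the radical of the intersection form.
\<close>


subsection \<open>Families closed under symmetric difference\<close>

text \<open>The form itself is never built; all comparison of ranks goes through one criterion: an
  element \<open>c\<close> of the untwisted radical lies in the twisted one exactly if
  \<open>T \<inter> c\<close> is a cut, that is, orthogonal to all cycles. The genus bound enters
  twice: it limits the codimension of the untwisted radical for every rotation, and that of the span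
  of the disjoint cycles, which come from a single rotation. A merger takes three faces because the
  number of faces of an orientable embedding has a fixed parity. 2-edge-connectedness forces the
  Betti number to grow; growing trees, for instance, keep it at 0. The coins live on signed rotation
  systems, whereas embeddings are classes of these. The uniform distribution passes to the classes
  because local reversals act freely; this needs a vertex of degree at least 3, which exists from
  Betti number 2 on.\<close>

definition sym_diff_closed :: "'a set set \<Rightarrow> bool" where
  "sym_diff_closed A \<longleftrightarrow> {} \<in> A \<and> (\<forall>x\<in>A. \<forall>y\<in>A. sym_diff x y \<in> A)"

definition sym_diff_additive :: "('a set \<Rightarrow> 'b set) \<Rightarrow> 'a set set \<Rightarrow> bool" where
  "sym_diff_additive \<phi> A \<longleftrightarrow> (\<forall>x\<in>A. \<forall>y\<in>A. \<phi> (sym_diff x y) = sym_diff (\<phi> x) (\<phi> y))"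

lemma sym_diff_closedD:
  assumes "sym_diff_closed A"
  shows "{} \<in> A" and "x \<in> A \<Longrightarrow> y \<in> A \<Longrightarrow> sym_diff x y \<in> A"
  using assms by (auto simp: sym_diff_closed_def)

lemma sym_diff_additiveD:
  "sym_diff_additive \<phi> A \<Longrightarrow> x \<in> A \<Longrightarrow> y \<in> A \<Longrightarrow> \<phi> (sym_diff x y) = sym_diff (\<phi> x) (\<phi> y)"
  by (simp add: sym_diff_additive_def)

lemma in_sym_diff_iff: "x \<in> sym_diff A B \<longleftrightarrow> (x \<in> A) \<noteq> (x \<in> B)"
  by blast

lemma sym_diff_closed_Pow: "sym_diff_closed (Pow X)"
  by (auto simp: sym_diff_closed_def)

lemma sym_diff_closed_Int: "sym_diff_closed A \<Longrightarrow> sym_diff_closed B \<Longrightarrow> sym_diff_closed (A \<inter> B)"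
  by (auto simp: sym_diff_closed_def)

lemma sym_diff_closed_image:
  assumes "sym_diff_closed A" "sym_diff_additive \<phi> A"
  shows "sym_diff_closed (\<phi> ` A)"
  unfolding sym_diff_closed_def
proof (intro conjI ballI)
  have "\<phi> (sym_diff {} {}) = sym_diff (\<phi> {}) (\<phi> {})"
    using assms sym_diff_additiveD sym_diff_closedD(1) by blast
  then have "\<phi> {} = {}" by simp
  then show "{} \<in> \<phi> ` A" using sym_diff_closedD(1)[OF assms(1)] by (metis image_eqI)
  fix x y assume "x \<in> \<phi> ` A" "y \<in> \<phi> ` A"
  then obtain x' y' where "x' \<in> A" "y' \<in> A" "x = \<phi> x'" "y = \<phi> y'" by blast
  then show "sym_diff x y \<in> \<phi> ` A"
    using sym_diff_additiveD[OF assms(2), of x' y'] sym_diff_closedD(2)[OF assms(1), of x' y']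
    by (metis image_eqI)
qed

lemma sym_diff_left_cancel: "sym_diff x y = sym_diff x z \<longleftrightarrow> y = z"
proof
  assume h: "sym_diff x y = sym_diff x z"
  have *: "sym_diff x (sym_diff x w) = w" for w by blast
  show "y = z" using arg_cong[OF h, of "sym_diff x"] unfolding * .
qed simp

text \<open>Translation by \<open>a0\<close> is an involution that exchanges the fibre of
  \<open>a0\<close> with the kernel.\<close>

lemma card_fiber_sym_diff:
  assumes A: "sym_diff_closed A" and \<phi>: "sym_diff_additive \<phi> A" and a0: "a0 \<in> A"
  shows "card {a \<in> A. \<phi> a = \<phi> a0} = card {a \<in> A. \<phi> a = {}}"
proof -
  note d = sym_diff_additiveD[OF \<phi> a0] sym_diff_closedD(2)[OF A a0]
  have "bij_betw (sym_diff a0) {a \<in> A. \<phi> a = \<phi> a0} {a \<in> A. \<phi> a = {}}"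
  proof (rule bij_betwI)
    show "sym_diff a0 \<in> {a \<in> A. \<phi> a = \<phi> a0} \<rightarrow> {a \<in> A. \<phi> a = {}}"
      using d by auto
    show "sym_diff a0 \<in> {a \<in> A. \<phi> a = {}} \<rightarrow> {a \<in> A. \<phi> a = \<phi> a0}"
      using d by auto
    show "sym_diff a0 (sym_diff a0 x) = x" for x by blast
    show "sym_diff a0 (sym_diff a0 x) = x" for x by blast
  qed
  then show ?thesis by (rule bij_betw_same_card)
qed

text \<open>Rank-nullity over the field with two elements, with \<open>2 ^ d\<close> in place of a
  dimension \<open>d\<close>.\<close>

lemma card_eq_card_kernel_times_card_image:
  assumes "finite A" "sym_diff_closed A" "sym_diff_additive \<phi> A"
  shows "card A = card {a \<in> A. \<phi> a = {}} * card (\<phi> ` A)"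
proof -
  have "card A = (\<Sum>y\<in>\<phi> ` A. card {a \<in> A. \<phi> a = y})"
    unfolding card_eq_sum by (rule sum.image_gen[OF assms(1)])
  also have "\<dots> = (\<Sum>y\<in>\<phi> ` A. card {a \<in> A. \<phi> a = {}})"
    using card_fiber_sym_diff[OF assms(2,3)] by (intro sum.cong) auto
  finally show ?thesis by simp
qed

text \<open>In dimensions: dim A + dim B is at most dim Z plus the dimension of the preimage of B.
  The map sending \<open>(a, b)\<close> to the sum of \<open>\<phi> a\<close> and \<open>b\<close>
  has at most \<open>card Z\<close> values, and each of its fibres embeds into the preimage by a
  translation of the first coordinate.\<close>

lemma card_times_card_le_card_preimage_times_card:
  assumes "finite Z" and A: "finite A" "sym_diff_closed A" "sym_diff_additive \<phi> A" "\<phi> ` A \<subseteq> Z"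
    and B: "sym_diff_closed B" "B \<subseteq> Z" and Z: "sym_diff_closed Z"
  shows "card A * card B \<le> card {a \<in> A. \<phi> a \<in> B} * card Z"
proof -
  have "finite B" by (rule finite_subset[OF B(2) assms(1)])
  let ?f = "\<lambda>(a, b). sym_diff (\<phi> a) b"
  have fiber: "card {p \<in> A \<times> B. ?f p = z} \<le> card {a \<in> A. \<phi> a \<in> B}" for z
  proof (cases "{p \<in> A \<times> B. ?f p = z} = {}")
    case False
    then obtain a0 b0 where 0: "a0 \<in> A" "b0 \<in> B" "sym_diff (\<phi> a0) b0 = z" by blast
    have "inj_on (\<lambda>p. sym_diff a0 (fst p)) {p \<in> A \<times> B. ?f p = z}"
    proof (rule inj_onI, clarsimp)
      fix a b a' b'
      assume h: "sym_diff a0 a = sym_diff a0 a'" "sym_diff (\<phi> a') b' = sym_diff (\<phi> a) b"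
      have "a = a'" using h(1) by (simp only: sym_diff_left_cancel)
      then have "b' = b" using h(2) by (simp only: sym_diff_left_cancel)
      with \<open>a = a'\<close> show "a = a' \<and> b = b'" by simp
    qed
    moreover have "(\<lambda>p. sym_diff a0 (fst p)) ` {p \<in> A \<times> B. ?f p = z} \<subseteq> {a \<in> A. \<phi> a \<in> B}"
    proof (rule image_subsetI, unfold split_beta)
      fix p assume "p \<in> {p \<in> A \<times> B. sym_diff (\<phi> (fst p)) (snd p) = z}"
      then obtain a b where p: "p = (a, b)" and h: "a \<in> A" "b \<in> B" "sym_diff (\<phi> a) b = z"
        by (cases p) auto
      have "\<phi> (sym_diff a0 a) = sym_diff (\<phi> a0) (\<phi> a)"
        using sym_diff_additiveD[OF A(3) 0(1) h(1)] .
      also have "\<dots> = sym_diff b0 b" using 0(3) h(3) by blast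
      finally have "\<phi> (sym_diff a0 a) = sym_diff b0 b" .
      then show "sym_diff a0 (fst p) \<in> {a \<in> A. \<phi> a \<in> B}"
        using sym_diff_closedD(2)[OF B(1) 0(2) h(2)] sym_diff_closedD(2)[OF A(2) 0(1) h(1)]
        by (simp add: p)
    qed
    ultimately show ?thesis using A(1) by (intro card_inj_on_le) auto
  next
    case True
    show ?thesis unfolding True by simp
  qed
  have sub: "?f ` (A \<times> B) \<subseteq> Z"
  proof (rule image_subsetI, unfold split_beta)
    fix p assume "p \<in> A \<times> B"
    then have "\<phi> (fst p) \<in> Z" "snd p \<in> Z" using A(4) B(2) by auto
    then show "sym_diff (\<phi> (fst p)) (snd p) \<in> Z" by (rule sym_diff_closedD(2)[OF Z])
  qed
  have "card A * card B = card (A \<times> B)" by (simp add: card_cartesian_product)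
  also have "\<dots> = (\<Sum>z\<in>?f ` (A \<times> B). card {p \<in> A \<times> B. ?f p = z})"
    unfolding card_eq_sum using A(1) \<open>finite B\<close> by (intro sum.image_gen) simp
  also have "\<dots> \<le> (\<Sum>z\<in>?f ` (A \<times> B). card {a \<in> A. \<phi> a \<in> B})" by (intro sum_mono fiber)
  also have "\<dots> = card (?f ` (A \<times> B)) * card {a \<in> A. \<phi> a \<in> B}" by simp
  also have "\<dots> \<le> card Z * card {a \<in> A. \<phi> a \<in> B}"
    using card_mono[OF assms(1) sub] by (rule mult_le_mono1)
  finally show ?thesis by (simp add: mult.commute)
qed

lemma card_times_card_le_card_Int_times_card:
  assumes Z: "finite Z" "sym_diff_closed Z" and A: "sym_diff_closed A" "A \<subseteq> Z"
    and B: "sym_diff_closed B" "B \<subseteq> Z"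
  shows "card A * card B \<le> card (A \<inter> B) * card Z"
proof -
  have "sym_diff_additive id A" by (simp add: sym_diff_additive_def)
  moreover have "id ` A \<subseteq> Z" using A(2) by simp
  ultimately have "card A * card B \<le> card {a \<in> A. id a \<in> B} * card Z"
    using finite_subset[OF A(2) Z(1)]
    by (intro card_times_card_le_card_preimage_times_card[OF Z(1) _ A(1) _ _ B Z(2)])
  moreover have "{a \<in> A. id a \<in> B} = A \<inter> B" by auto
  ultimately show ?thesis by simp
qed

section \<open>Unions of subfamilies of a disjoint family\<close>

lemma inj_on_Union_Pow_disjoint:
  assumes "disjoint C" "{} \<notin> C"
  shows "inj_on Union (Pow C)"
proof (rule inj_onI)
  have *: "J \<subseteq> J'" if "J \<in> Pow C" "J' \<in> Pow C" "\<Union>J = \<Union>J'" for J J'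
  proof
    fix c assume c: "c \<in> J"
    have "c \<noteq> {}" using assms(2) c that(1) by auto
    then obtain x where x: "x \<in> c" by blast
    then have "x \<in> \<Union>J'" using c that(3) by blast
    then obtain c' where c': "c' \<in> J'" "x \<in> c'" by blast
    have "c' \<inter> c \<noteq> {}" using x c'(2) by blast
    then have "c' = c" using disjointD[OF assms(1), of c' c] c c'(1) that(1,2) by auto
    then show "c \<in> J'" using c'(1) by simp
  qed
  show "J = J'" if "J \<in> Pow C" "J' \<in> Pow C" "\<Union>J = \<Union>J'" for J J'
    using *[of J J'] *[of J' J] that by auto
qed

lemma card_Union_Pow_disjoint:
  assumes "disjoint C" "{} \<notin> C" "finite C"
  shows "card (Union ` Pow C) = 2 ^ card C"
  by (simp add: card_image[OF inj_on_Union_Pow_disjoint[OF assms(1,2)]] card_Pow assms(3))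

lemma Union_sym_diff_disjoint:
  assumes "disjoint C" "J \<subseteq> C" "J' \<subseteq> C"
  shows "\<Union>(sym_diff J J') = sym_diff (\<Union>J) (\<Union>J')"
proof -
  have "c = c'" if "c \<in> C" "c' \<in> C" "x \<in> c" "x \<in> c'" for c c' x
    using disjointD[OF assms(1) that(1,2)] that(3,4) by blast
  then have eq: "c = c'" if "c \<in> J \<union> J'" "c' \<in> J \<union> J'" "x \<in> c" "x \<in> c'" for c c' x
    using that assms(2,3) by blast
  show ?thesis
  proof (intro set_eqI iffI)
    fix x assume "x \<in> \<Union>(sym_diff J J')"
    then obtain c where "c \<in> sym_diff J J'" "x \<in> c" by blast
    then show "x \<in> sym_diff (\<Union>J) (\<Union>J')" using eq[of c _ x] by blast
  qed blast
qed

lemma sym_diff_closed_Union_Pow: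
  assumes "disjoint C"
  shows "sym_diff_closed (Union ` Pow C)"
  using sym_diff_closed_image[OF sym_diff_closed_Pow, of Union C] Union_sym_diff_disjoint[OF assms]
  by (simp add: sym_diff_additive_def)

lemma even_card_sym_diff:
  assumes "finite A" "finite B"
  shows "even (card (sym_diff A B)) \<longleftrightarrow> (even (card A) \<longleftrightarrow> even (card B))"
proof -
  have "card (sym_diff A B) = card (A - B) + card (B - A)"
    using assms by (intro card_Un_disjoint) auto
  moreover have "card A = card (A - B) + card (A \<inter> B)" "card B = card (B - A) + card (A \<inter> B)"
    using assms card_Int_Diff[of A B] card_Int_Diff[of B A] by (simp_all add: Int_commute)
  ultimately have "card (sym_diff A B) + 2 * card (A \<inter> B) = card A + card B" by simp
  then show ?thesis by presburger
qed

lemma even_card_sym_diff_collect: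
  assumes "finite X"
  shows "odd (card {x \<in> X. P x \<noteq> Q x}) \<longleftrightarrow> (odd (card {x \<in> X. P x}) \<noteq> odd (card {x \<in> X. Q x}))"
proof -
  have "{x \<in> X. P x \<noteq> Q x} = sym_diff {x \<in> X. P x} {x \<in> X. Q x}" by blast
  then have "even (card {x \<in> X. P x \<noteq> Q x}) \<longleftrightarrow> (even (card {x \<in> X. P x}) \<longleftrightarrow> even (card {x \<in> X. Q x}))"
    using even_card_sym_diff[of "{x \<in> X. P x}" "{x \<in> X. Q x}"] assms by simp
  then show ?thesis by blast
qed

subsection \<open>Cycle space and cut space\<close>

text \<open>The boundary map modulo 2. Counting arcs instead of edges makes a loop count twice at
  its vertex, so that loops are cycles.\<close>

definition edge_boundary :: "('v, 'e) multigraph \<Rightarrow> 'e set set \<Rightarrow> 'v set" where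
  "edge_boundary M c =
     {v \<in> verts (fst M). odd (card {a \<in> out_arcs (fst M) v. undirected_edge M a \<in> c})}"

definition cycle_space :: "('v, 'e) multigraph \<Rightarrow> 'e set set set" where
  "cycle_space M = {c \<in> Pow (edges M). edge_boundary M c = {}}"

definition cut_space :: "('v, 'e) multigraph \<Rightarrow> 'e set set set" where
  "cut_space M = cut_edges M ` Pow (verts (fst M))"

lemma connected_nonempty: "Digraph_Component.connected D \<Longrightarrow> verts D \<noteq> {}"
  by (auto simp: Digraph_Component.connected_def strongly_connected_def)

lemma connected_rtrancl:
  assumes "Digraph_Component.connected D" "u \<in> verts D" "w \<in> verts D"
  shows "(u, w) \<in> (\<Union>a\<in>arcs D. {(tail D a, head D a), (head D a, tail D a)})\<^sup>*"
proof -
  have "(u, w) \<in> rtrancl_on (verts D) (parcs (mk_symmetric D))"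
    using assms by (auto simp: Digraph_Component.connected_def strongly_connected_def reachable_def)
  then show ?thesis
    using rtrancl_on_rtranclI[of u w "verts D" "parcs (mk_symmetric D)"]
    by (simp add: parcs_mk_symmetric)
qed

locale finite_multigraph =
  fixes M :: "('v, 'e) multigraph"
  assumes fin: "fin_digraph (fst M)" and bidir: "bidirected_digraph (fst M) (snd M)"

sublocale finite_multigraph \<subseteq> fin_digraph "fst M" by (rule fin)
sublocale finite_multigraph \<subseteq> bidirected_digraph "fst M" "snd M" by (rule bidir)

context finite_multigraph
begin

abbreviation "V \<equiv> verts (fst M)"
abbreviation "A \<equiv> arcs (fst M)"
abbreviation "rv \<equiv> snd M"
abbreviation "E \<equiv> edges M"
abbreviation "ue \<equiv> undirected_edge M"
abbreviation "out \<equiv> out_arcs (fst M)"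
abbreviation "ta \<equiv> tail (fst M)"
abbreviation "he \<equiv> head (fst M)"

lemma finite_E: "finite E"
  by (simp add: edges_def)

lemma ue_eq_iff: "ue a = ue b \<longleftrightarrow> b = a \<or> b = rv a"
  by (rule undirected_edge_eq_iff[OF bidir])

lemma ue_rv [simp]: "ue (rv a) = ue a"
  by (auto simp: undirected_edge_def)

lemma ue_in_E [simp]: "a \<in> A \<Longrightarrow> ue a \<in> E"
  by (simp add: edges_def)

lemma E_cases: "e \<in> E \<Longrightarrow> (\<And>a. a \<in> A \<Longrightarrow> e = ue a \<Longrightarrow> thesis) \<Longrightarrow> thesis"
  by (auto simp: edges_def)

lemma card_reversal_closed:
  assumes "B \<subseteq> A" "\<And>a. a \<in> B \<Longrightarrow> rv a \<in> B"
  shows "card B = 2 * card (ue ` B)"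
proof -
  have "finite B" using assms(1) by (rule finite_subset) simp
  then have "card B = (\<Sum>e\<in>ue ` B. card {a \<in> B. ue a = e})"
    unfolding card_eq_sum by (rule sum.image_gen)
  also have "\<dots> = (\<Sum>e\<in>ue ` B. 2)"
  proof (rule sum.cong[OF refl])
    fix e assume "e \<in> ue ` B"
    then obtain a where a: "a \<in> B" "e = ue a" by blast
    have "{b \<in> B. ue b = e} = {a, rv a}"
      using assms(2)[OF a(1)] a(1) by (auto simp: a(2) ue_eq_iff)
    moreover have "rv a \<noteq> a" using arev_neq a(1) assms(1) by blast
    ultimately show "card {b \<in> B. ue b = e} = 2" by simp
  qed
  finally show ?thesis by simp
qed

lemma ue_image_arcs: "c \<subseteq> E \<Longrightarrow> ue ` {a \<in> A. ue a \<in> c} = c"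
  by (auto simp: edges_def)

lemma card_edge_arcs: "c \<subseteq> E \<Longrightarrow> card {a \<in> A. ue a \<in> c} = 2 * card c"
  using card_reversal_closed[of "{a \<in> A. ue a \<in> c}"] ue_image_arcs[of c] by auto

lemma card_arcs: "card A = 2 * card E"
  using card_reversal_closed[of A] by (simp add: edges_def)

lemma sum_card_out:
  assumes "U \<subseteq> V"
  shows "card {a \<in> A. ta a \<in> U \<and> P a} = (\<Sum>v\<in>U. card {a \<in> out v. P a})"
proof -
  have "finite U" by (rule finite_subset[OF assms]) simp
  have "{a \<in> A. ta a \<in> U \<and> P a} = (\<Union>v\<in>U. {a \<in> out v. P a})" by auto
  moreover have "card (\<Union>v\<in>U. {a \<in> out v. P a}) = (\<Sum>v\<in>U. card {a \<in> out v. P a})"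
    using \<open>finite U\<close> by (intro card_UN_disjoint) auto
  ultimately show ?thesis by simp
qed

lemma even_card_edge_boundary:
  assumes "c \<subseteq> E"
  shows "even (card (edge_boundary M c))"
proof -
  have "{a \<in> A. ta a \<in> V \<and> ue a \<in> c} = {a \<in> A. ue a \<in> c}" by auto
  then have "(\<Sum>v\<in>V. card {a \<in> out v. ue a \<in> c}) = 2 * card c"
    using sum_card_out[OF order_refl, of "\<lambda>a. ue a \<in> c"] card_edge_arcs[OF assms] by simp
  then have "even (\<Sum>v\<in>V. card {a \<in> out v. ue a \<in> c})" by simp
  then show ?thesis by (simp add: even_sum_iff edge_boundary_def)
qed

lemma edge_boundary_sym_diff:
  "edge_boundary M (sym_diff c d) = sym_diff (edge_boundary M c) (edge_boundary M d)"
proof -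
  have "{a \<in> out v. ue a \<in> sym_diff c d} = {a \<in> out v. (ue a \<in> c) \<noteq> (ue a \<in> d)}" for v
    by auto
  then have "odd (card {a \<in> out v. ue a \<in> sym_diff c d}) \<longleftrightarrow>
      odd (card {a \<in> out v. ue a \<in> c}) \<noteq> odd (card {a \<in> out v. ue a \<in> d})" for v
    using even_card_sym_diff_collect[OF finite_out_arcs, of v "\<lambda>a. ue a \<in> c" "\<lambda>a. ue a \<in> d"]
    by simp
  then show ?thesis unfolding edge_boundary_def by auto
qed

lemma edge_boundary_empty [simp]: "edge_boundary M {} = {}"
  by (simp add: edge_boundary_def)

lemma edge_boundary_single:
  assumes "a \<in> A"
  shows "edge_boundary M {ue a} = sym_diff {ta a} {he a}"
proof -
  have "{b \<in> out v. ue b \<in> {ue a}} = {b \<in> {a, rv a}. ta b = v}" for v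
    using assms by (auto simp: ue_eq_iff)
  also have "\<dots> v = (if ta a = v then {a} else {}) \<union> (if he a = v then {rv a} else {})" for v
    using assms by auto
  finally have "card {b \<in> out v. ue b \<in> {ue a}} = of_bool (ta a = v) + of_bool (he a = v)" for v
    using arev_neq[OF assms] by auto
  then show ?thesis using assms unfolding edge_boundary_def by auto
qed

lemma sym_diff_closed_cycle_space: "sym_diff_closed (cycle_space M)"
  unfolding sym_diff_closed_def
proof (intro conjI ballI)
  fix c d assume "c \<in> cycle_space M" "d \<in> cycle_space M"
  then show "sym_diff c d \<in> cycle_space M"
    unfolding cycle_space_def using edge_boundary_sym_diff[of c d] by auto
qed (simp add: cycle_space_def)

lemma finite_cycle_space: "finite (cycle_space M)"
  unfolding cycle_space_def using finite_E by simp

text \<open>A walk suffices, since an edge used twice cancels in the symmetric difference. The arc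
  set \<open>B\<close> is a parameter so that a path can also be found after deleting an
  edge.\<close>

lemma path_edge_set:
  assumes conn: "Digraph_Component.connected ((fst M)\<lparr>arcs := B\<rparr>)" and B: "B \<subseteq> A"
    and "u \<in> V" "w \<in> V"
  shows "\<exists>c \<subseteq> ue ` B. edge_boundary M c = sym_diff {u} {w}"
proof -
  have "(u, w) \<in> (\<Union>a\<in>B. {(ta a, he a), (he a, ta a)})\<^sup>*"
    using connected_rtrancl[OF conn] assms(3,4) by simp
  then show ?thesis
  proof (induction)
    case base
    then show ?case by (intro exI[of _ "{}"]) simp
  next
    case (step y z)
    then obtain c where c: "c \<subseteq> ue ` B" "edge_boundary M c = sym_diff {u} {y}" by blast
    obtain a where a: "a \<in> B" "{ta a, he a} = {y, z}" using step(2) by auto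
    then have "ta a = y \<and> he a = z \<or> ta a = z \<and> he a = y" by (simp add: doubleton_eq_iff)
    then have "sym_diff {ta a} {he a} = sym_diff {y} {z}" by (elim disjE) (simp_all add: Un_commute)
    then have "edge_boundary M (sym_diff c {ue a}) = sym_diff (sym_diff {u} {y}) (sym_diff {y} {z})"
      by (simp only: edge_boundary_sym_diff edge_boundary_single[OF subsetD[OF B a(1)]] c(2))
    also have "\<dots> = sym_diff {u} {z}" by auto
    finally have "edge_boundary M (sym_diff c {ue a}) = sym_diff {u} {z}" .
    moreover have "sym_diff c {ue a} \<subseteq> ue ` B" using c(1) a(1) by auto
    ultimately show ?case by blast
  qed
qed

text \<open>A boundary has even size, so it is determined by its part away from the root
  \<open>r\<close>. Dropping \<open>r\<close> preserves the kernel and leaves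
  \<open>2 ^ (card V - 1)\<close> candidates for the image.\<close>

lemma card_Pow_E_eq:
  assumes "r \<in> V"
  shows "2 ^ card E = card (cycle_space M) * card ((\<lambda>c. edge_boundary M c - {r}) ` Pow E)"
proof -
  let ?\<phi> = "\<lambda>c. edge_boundary M c - {r}"
  have add: "sym_diff_additive ?\<phi> (Pow E)"
    unfolding sym_diff_additive_def edge_boundary_sym_diff by auto
  have "?\<phi> c = {} \<longleftrightarrow> edge_boundary M c = {}" if "c \<in> Pow E" for c
  proof
    assume "?\<phi> c = {}"
    then have "edge_boundary M c \<subseteq> {r}" by blast
    moreover have "edge_boundary M c \<noteq> {r}" using even_card_edge_boundary[of c] that by auto
    ultimately show "edge_boundary M c = {}" by blast
  qed auto
  then have "{c \<in> Pow E. ?\<phi> c = {}} = cycle_space M"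
    unfolding cycle_space_def by blast
  then show ?thesis
    using card_eq_card_kernel_times_card_image[OF _ sym_diff_closed_Pow add] finite_E
    by (simp add: card_Pow)
qed

lemma card_Pow_V_minus: "r \<in> V \<Longrightarrow> card (Pow (V - {r})) = 2 ^ (card V - 1)"
  by (simp add: card_Pow)

text \<open>This form serves for a possibly disconnected subgraph: the boundary map has at most
  \<open>2 ^ (card V - 1)\<close> values in any case.\<close>

lemma card_cycle_space_ge:
  assumes "V \<noteq> {}"
  shows "2 ^ card E \<le> card (cycle_space M) * 2 ^ (card V - 1)"
proof -
  obtain r where r: "r \<in> V" using assms by blast
  have "(\<lambda>c. edge_boundary M c - {r}) ` Pow E \<subseteq> Pow (V - {r})"
    by (auto simp: edge_boundary_def)
  from card_mono[OF _ this] show ?thesis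
    unfolding card_Pow_E_eq[OF r] card_Pow_V_minus[OF r] by simp
qed

text \<open>A path from \<open>u\<close> to the root has boundary \<open>{u}\<close> away from the
  root, and sums of such paths realise every subset of \<open>V - {r}\<close>.\<close>

lemma card_cycle_space:
  assumes conn: "Digraph_Component.connected (fst M)"
  shows "2 ^ card E = card (cycle_space M) * 2 ^ (card V - 1)"
proof -
  obtain r where r: "r \<in> V" using connected_nonempty[OF conn] by blast
  have conn': "Digraph_Component.connected ((fst M)\<lparr>arcs := A\<rparr>)" using conn by simp
  have "\<exists>c\<in>Pow E. edge_boundary M c - {r} = U" if "U \<subseteq> V - {r}" for U
  proof -
    have "finite U" by (rule finite_subset[OF that]) simp
    then show ?thesis using that
    proof induction
      case empty
      then show ?case by (intro bexI[of _ "{}"]) auto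
    next
      case (insert u U)
      then obtain c where c: "c \<in> Pow E" "edge_boundary M c - {r} = U" by auto
      obtain d where d: "d \<subseteq> E" "edge_boundary M d = sym_diff {u} {r}"
        using path_edge_set[OF conn', of u r] insert.prems r by (auto simp: edges_def)
      have "edge_boundary M (sym_diff c d) - {r} =
          sym_diff (edge_boundary M c - {r}) (edge_boundary M d - {r})"
        unfolding edge_boundary_sym_diff by auto
      also have "\<dots> = insert u U" using c(2) d(2) insert.hyps(2) insert.prems by auto
      finally have "edge_boundary M (sym_diff c d) - {r} = insert u U" .
      moreover have "sym_diff c d \<in> Pow E" using c(1) d(1) by auto
      ultimately show ?case by (rule bexI)
    qed
  qed
  then have "Pow (V - {r}) \<subseteq> (\<lambda>c. edge_boundary M c - {r}) ` Pow E"
    by (metis (mono_tags, lifting) PowD image_eqI subsetI)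
  moreover have "(\<lambda>c. edge_boundary M c - {r}) ` Pow E \<subseteq> Pow (V - {r})"
    by (auto simp: edge_boundary_def)
  ultimately have "(\<lambda>c. edge_boundary M c - {r}) ` Pow E = Pow (V - {r})" by (rule equalityI[rotated])
  then show ?thesis
    unfolding card_Pow_E_eq[OF r] using card_Pow_V_minus[OF r] by simp
qed

section \<open>Cuts and their orthogonality to cycles\<close>

lemma sym_diff_additive_cut_edges: "sym_diff_additive (cut_edges M) X"
  by (simp add: sym_diff_additive_def cut_edges_sym_diff[OF bidir])

lemma sym_diff_closed_cut_space: "sym_diff_closed (cut_space M)"
  unfolding cut_space_def
  by (rule sym_diff_closed_image[OF sym_diff_closed_Pow sym_diff_additive_cut_edges])

lemma cut_edges_subset: "cut_edges M S \<subseteq> E"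
  by (auto simp: cut_edges_def)

lemma connected_closed:
  assumes "Digraph_Component.connected (fst M)" "u \<in> V" "w \<in> V"
    and "\<And>a. a \<in> A \<Longrightarrow> P (ta a) \<longleftrightarrow> P (he a)"
  shows "P u \<longleftrightarrow> P w"
  using connected_rtrancl[OF assms(1-3)]
  by induction (use assms(4) in auto)

lemma cut_edges_eq_empty:
  assumes "Digraph_Component.connected (fst M)" "S \<subseteq> V" "cut_edges M S = {}"
  shows "S = {} \<or> S = V"
proof -
  have "u \<in> S \<longleftrightarrow> w \<in> S" if "u \<in> V" "w \<in> V" for u w
  proof (rule connected_closed[OF assms(1) that])
    fix a assume "a \<in> A"
    then show "ta a \<in> S \<longleftrightarrow> he a \<in> S"
      using undirected_edge_in_cut_iff[OF bidir, of a S] assms(3) by auto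
  qed
  then show ?thesis using assms(2) by blast
qed

text \<open>In a connected graph only the empty set and the whole vertex set have an empty cut, so
  each cut arises from at most two vertex sets.\<close>

lemma card_cut_space_ge:
  assumes "Digraph_Component.connected (fst M)"
  shows "2 ^ card V \<le> 2 * card (cut_space M)"
proof -
  have "{S \<in> Pow V. cut_edges M S = {}} \<subseteq> {{}, V}"
    using cut_edges_eq_empty[OF assms] by blast
  then have "card {S \<in> Pow V. cut_edges M S = {}} \<le> card {{}, V}" by (intro card_mono) auto
  also have "\<dots> \<le> 2" by (simp add: card_insert_if)
  finally have "card {S \<in> Pow V. cut_edges M S = {}} * card (cut_space M) \<le> 2 * card (cut_space M)"
    by (rule mult_le_mono1)
  then show ?thesis
    using card_eq_card_kernel_times_card_image[OF _ sym_diff_closed_Pow sym_diff_additive_cut_edges, of V]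
    by (simp add: cut_space_def card_Pow)
qed

text \<open>A cycle has an even number of arcs starting in \<open>S\<close>. Those that stay inside
  \<open>S\<close> come in reverse pairs, and those that leave \<open>S\<close> correspond to the
  edges of the cut.\<close>

lemma even_card_cut_Int_cycle:
  assumes "S \<subseteq> V" "c \<in> cycle_space M"
  shows "even (card (cut_edges M S \<inter> c))"
proof -
  let ?B = "{a \<in> A. ta a \<in> S \<and> ue a \<in> c}"
  let ?I = "{a \<in> A. ta a \<in> S \<and> he a \<in> S \<and> ue a \<in> c}"
  let ?O = "{a \<in> A. ta a \<in> S \<and> he a \<notin> S \<and> ue a \<in> c}"
  have "even (card {a \<in> out v. ue a \<in> c})" if "v \<in> S" for v
    using assms that by (auto simp: cycle_space_def edge_boundary_def)
  then have "even (card ?B)"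
    unfolding sum_card_out[OF assms(1)] by (intro dvd_sum) auto
  moreover have "card ?I = 2 * card (ue ` ?I)"
    by (rule card_reversal_closed) auto
  moreover have "card ?B = card ?I + card ?O"
  proof -
    have "?B = ?I \<union> ?O" by blast
    then show ?thesis by (simp add: card_Un_disjoint[symmetric] disjoint_iff)
  qed
  moreover have "card ?O = card (cut_edges M S \<inter> c)"
  proof -
    have "inj_on ue ?O" by (auto simp: inj_on_def ue_eq_iff)
    moreover have "ue ` ?O = cut_edges M S \<inter> c" by (auto simp: cut_edges_def)
    ultimately show ?thesis using card_image by force
  qed
  ultimately show ?thesis by presburger
qed

end

subsection \<open>The face space\<close>

text \<open>Unlike the faces themselves, the sets of corner points that no boundary arc enters or
  leaves form a vector space over the field with two elements, with the faces as a basis.\<close>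

definition face_unions :: "('v, 'e) multigraph \<Rightarrow> 'e signed_rotation \<Rightarrow> ('e \<times> bool) set set" where
  "face_unions M \<sigma> =
     {g \<in> Pow (arcs (fst M) \<times> UNIV). \<forall>(x, y) \<in> boundary_arcs M \<sigma>. x \<in> g \<longleftrightarrow> y \<in> g}"

text \<open>The points \<open>(a, True)\<close> and \<open>(a, False)\<close> lie on the two sides
  of a ribbon, so for a union \<open>g\<close> of faces this is the boundary modulo 2 of the discs
  glued into these faces.\<close>

definition face_boundary :: "('v, 'e) multigraph \<Rightarrow> ('e \<times> bool) set \<Rightarrow> 'e set set" where
  "face_boundary M g =
     {undirected_edge M a | a. a \<in> arcs (fst M) \<and> ((a, True) \<in> g \<longleftrightarrow> (a, False) \<notin> g)}"

definition face_space :: "('v, 'e) multigraph \<Rightarrow> 'e signed_rotation \<Rightarrow> 'e set set set" where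
  "face_space M \<sigma> = face_boundary M ` face_unions M \<sigma>"

text \<open>Closed sets are the unions of classes of the generated equivalence, and distinct
  subfamilies of these disjoint classes have distinct unions.\<close>

lemma card_closed_sets:
  assumes "finite P" "R \<subseteq> P \<times> P"
  shows "card {g \<in> Pow P. \<forall>(x, y) \<in> R. x \<in> g \<longleftrightarrow> y \<in> g} = 2 ^ card (P // (R \<union> R\<inverse>)\<^sup>*)"
proof -
  let ?Q = "(R \<union> R\<inverse>)\<^sup>*"
  have "sym ?Q" by (intro sym_rtrancl) (auto simp: sym_def)
  then have class_eq: "?Q `` {x} = ?Q `` {y}" if "(x, y) \<in> ?Q" for x y
    using that by (auto dest: symD intro: rtrancl_trans)
  have disj: "disjoint (P // ?Q)"
  proof (rule disjointI)
    fix a b assume "a \<in> P // ?Q" "b \<in> P // ?Q" "a \<noteq> b"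
    then obtain x y where xy: "a = ?Q `` {x}" "b = ?Q `` {y}" by (auto simp: quotient_def)
    show "a \<inter> b = {}"
    proof (rule ccontr)
      assume "a \<inter> b \<noteq> {}"
      then obtain z where "(x, z) \<in> ?Q" "(y, z) \<in> ?Q" using xy by auto
      then show False using class_eq[of x z] class_eq[of y z] xy \<open>a \<noteq> b\<close> by simp
    qed
  qed
  have ne: "{} \<notin> P // ?Q" by (auto simp: quotient_def)
  have in_P: "y \<in> P" if "(x, y) \<in> ?Q" "x \<in> P" for x y
    using that by induction (use assms(2) in auto)
  have closed: "x \<in> g \<longleftrightarrow> y \<in> g" if "\<forall>(x, y) \<in> R. x \<in> g \<longleftrightarrow> y \<in> g" "(x, y) \<in> ?Q" for g x y
    using that(2) by induction (use that(1) in auto)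
  have eq: "{g \<in> Pow P. \<forall>(x, y) \<in> R. x \<in> g \<longleftrightarrow> y \<in> g} = Union ` Pow (P // ?Q)"
  proof (intro set_eqI iffI)
    fix g assume g: "g \<in> {g \<in> Pow P. \<forall>(x, y) \<in> R. x \<in> g \<longleftrightarrow> y \<in> g}"
    have "\<Union>((\<lambda>x. ?Q `` {x}) ` g) = g"
    proof
      show "\<Union>((\<lambda>x. ?Q `` {x}) ` g) \<subseteq> g" using closed[of g] g by blast
      show "g \<subseteq> \<Union>((\<lambda>x. ?Q `` {x}) ` g)" by blast
    qed
    moreover have "(\<lambda>x. ?Q `` {x}) ` g \<in> Pow (P // ?Q)"
      using g by (auto intro: quotientI)
    ultimately show "g \<in> Union ` Pow (P // ?Q)" by (metis image_eqI)
  next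
    fix g assume "g \<in> Union ` Pow (P // ?Q)"
    then obtain J where J: "J \<subseteq> P // ?Q" "g = \<Union>J" by blast
    have 1: "g \<subseteq> P"
    proof
      fix y assume "y \<in> g"
      then obtain c where "c \<in> P // ?Q" "y \<in> c" using J by blast
      then obtain x where "x \<in> P" "(x, y) \<in> ?Q" by (auto simp: quotient_def)
      then show "y \<in> P" using in_P by blast
    qed
    have 2: "y \<in> g" if xy: "(x, y) \<in> ?Q" "x \<in> g" for x y
    proof -
      obtain c where c: "c \<in> J" "x \<in> c" using xy(2) J(2) by blast
      then obtain z where z: "c = ?Q `` {z}" using J(1) by (auto simp: quotient_def)
      then have "y \<in> c" using c(2) rtrancl_trans[OF _ xy(1), of z] by simp
      then show ?thesis using c(1) J(2) by blast
    qed
    have "x \<in> g \<longleftrightarrow> y \<in> g" if "(x, y) \<in> R" for x y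
    proof -
      have "(x, y) \<in> ?Q" "(y, x) \<in> ?Q" using that by auto
      then show ?thesis using 2 by blast
    qed
    then show "g \<in> {g \<in> Pow P. \<forall>(x, y) \<in> R. x \<in> g \<longleftrightarrow> y \<in> g}" using 1 by auto
  qed
  have "P // ?Q \<subseteq> Pow P"
    using in_P by (auto simp: quotient_def)
  then have "finite (P // ?Q)" by (rule finite_subset) (simp add: assms(1))
  then show "card {g \<in> Pow P. \<forall>(x, y) \<in> R. x \<in> g \<longleftrightarrow> y \<in> g} = 2 ^ card (P // ?Q)"
    unfolding eq by (rule card_Union_Pow_disjoint[OF disj ne])
qed

context finite_multigraph
begin

abbreviation "RS \<equiv> rotation_systems M"

lemma rotation_permutes: "rot \<in> RS \<Longrightarrow> rot permutes A"
  by (simp add: rotation_systems_def)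

lemma rotation_in_out: "rot \<in> RS \<Longrightarrow> a \<in> out v \<Longrightarrow> rot a \<in> out v"
  using rotation_system_arcs[OF bidir, of rot a] by auto

lemma rotation_image_out:
  assumes "rot \<in> RS"
  shows "rot ` {a \<in> out v. P (rot a)} = {a \<in> out v. P a}"
proof -
  have "a \<in> rot ` {a \<in> out v. P (rot a)}" if "a \<in> out v" "P a" for a
    using rotation_system_arcs[OF bidir assms, of a] that by (intro image_eqI[of _ _ "inv rot a"]) auto
  moreover have "rot a \<in> {a \<in> out v. P a}" if "a \<in> {a \<in> out v. P (rot a)}" for a
    using rotation_in_out[OF assms, of a v] that by simp
  ultimately show ?thesis by (intro equalityI subsetI) auto
qed

lemma rotation_const:
  assumes "rot \<in> RS" "a \<in> out v" "b \<in> out v"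
    and "\<And>a. a \<in> out v \<Longrightarrow> Q (rot a) = Q a"
  shows "Q b = Q a"
proof -
  have "v \<in> V" using assms(2) by auto
  then have "cyclic_on rot (out v)"
    using assms(1,2) unfolding rotation_systems_def by blast
  then have orb: "b \<in> orbit rot a" using assms(2,3) by (simp add: cyclic_on_alldef)
  have "b \<in> out v \<and> Q b = Q a"
    using orb by induction (use assms(2,4) rotation_in_out[OF assms(1)] in auto)
  then show ?thesis by simp
qed

lemma boundary_arcs_subset:
  "rot \<in> RS \<Longrightarrow> boundary_arcs M (rot, T) \<subseteq> (A \<times> UNIV) \<times> (A \<times> UNIV)"
  using rotation_system_arcs(1)[OF bidir] by (auto simp: boundary_arcs_def)

lemma card_face_unions:
  "rot \<in> RS \<Longrightarrow> card (face_unions M (rot, T)) = 2 ^ card (faces M (rot, T))"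
  unfolding face_unions_def faces_def
  by (rule card_closed_sets[OF _ boundary_arcs_subset]) simp_all

lemma face_unions_iff:
  "g \<in> face_unions M (rot, T) \<longleftrightarrow> g \<subseteq> A \<times> UNIV \<and>
     (\<forall>a\<in>A. (a, True) \<in> g \<longleftrightarrow> (rot a, False) \<in> g) \<and>
     (\<forall>a\<in>A. \<forall>s. (a, s) \<in> g \<longleftrightarrow> (rv a, if ue a \<in> T then s else \<not> s) \<in> g)"
proof -
  have "boundary_arcs M (rot, T) = (\<lambda>a. ((a, True), (rot a, False))) ` A \<union>
      (\<Union>a\<in>A. range (\<lambda>s. ((a, s), (rv a, if ue a \<in> T then s else \<not> s))))"
    unfolding boundary_arcs_def prod.case by (rule arg_cong2[where f = "(\<union>)"]) (blast, blast)
  then show ?thesis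
    unfolding face_unions_def by (simp add: ball_Un)
qed

lemma finite_face_unions: "finite (face_unions M \<sigma>)"
  by (rule finite_subset[of _ "Pow (A \<times> UNIV)"]) (auto simp: face_unions_def)

lemma face_unionsD:
  assumes "g \<in> face_unions M (rot, T)" "a \<in> A"
  shows "(rot a, False) \<in> g \<longleftrightarrow> (a, True) \<in> g"
    and "ue a \<in> T \<Longrightarrow> (rv a, s) \<in> g \<longleftrightarrow> (a, s) \<in> g"
    and "ue a \<notin> T \<Longrightarrow> (rv a, s) \<in> g \<longleftrightarrow> (a, \<not> s) \<in> g"
proof -
  have "(a, True) \<in> g \<longleftrightarrow> (rot a, False) \<in> g"
    and side: "(a, s) \<in> g \<longleftrightarrow> (rv a, if ue a \<in> T then s else \<not> s) \<in> g" for s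
    using assms unfolding face_unions_iff by blast+
  then show "(rot a, False) \<in> g \<longleftrightarrow> (a, True) \<in> g" by blast
  show "(rv a, s) \<in> g \<longleftrightarrow> (a, s) \<in> g" if "ue a \<in> T"
    using side[of s] that by simp
  show "(rv a, s) \<in> g \<longleftrightarrow> (a, \<not> s) \<in> g" if "ue a \<notin> T"
    using side[of "\<not> s"] that by simp
qed

text \<open>Either arc of an edge may witness membership; both give the same answer because each
  side of the ribbon links the corner points of the two ends.\<close>

lemma face_boundary_iff:
  assumes "g \<in> face_unions M (rot, T)" "a \<in> A"
  shows "ue a \<in> face_boundary M g \<longleftrightarrow> ((a, True) \<in> g \<longleftrightarrow> (a, False) \<notin> g)"
proof -
  have "((rv a, True) \<in> g \<longleftrightarrow> (rv a, False) \<notin> g) \<longleftrightarrow> ((a, True) \<in> g \<longleftrightarrow> (a, False) \<notin> g)"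
    using face_unionsD(2,3)[OF assms] by (cases "ue a \<in> T") auto
  moreover have "ue a \<in> face_boundary M g \<longleftrightarrow>
      ((a, True) \<in> g \<longleftrightarrow> (a, False) \<notin> g) \<or> ((rv a, True) \<in> g \<longleftrightarrow> (rv a, False) \<notin> g)"
    unfolding face_boundary_def using assms(2) by (auto simp: ue_eq_iff)
  ultimately show ?thesis by blast
qed

lemma face_boundary_subset: "face_boundary M g \<subseteq> E"
  by (auto simp: face_boundary_def)

lemma edge_set_eqI:
  assumes "c \<subseteq> E" "d \<subseteq> E" "\<And>a. a \<in> A \<Longrightarrow> ue a \<in> c \<longleftrightarrow> ue a \<in> d"
  shows "c = d"
proof -
  have "e \<in> c \<longleftrightarrow> e \<in> d" if e: "e \<in> E" for e
  proof -
    obtain a where "a \<in> A" "e = ue a" using e by (rule E_cases)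
    then show ?thesis using assms(3) by simp
  qed
  then show ?thesis using assms(1,2) by blast
qed

lemma sym_diff_closed_face_unions: "sym_diff_closed (face_unions M (rot, T))"
  unfolding sym_diff_closed_def
proof (intro conjI ballI)
  show "{} \<in> face_unions M (rot, T)" by (simp add: face_unions_iff)
  fix g h assume g: "g \<in> face_unions M (rot, T)" and h: "h \<in> face_unions M (rot, T)"
  have "g \<subseteq> A \<times> UNIV" "h \<subseteq> A \<times> UNIV" using g h by (simp_all add: face_unions_iff)
  then have "sym_diff g h \<subseteq> A \<times> UNIV" by (rule Un_least[OF subset_trans[OF Diff_subset] subset_trans[OF Diff_subset]])
  then show "sym_diff g h \<in> face_unions M (rot, T)"
    unfolding face_unions_iff in_sym_diff_iff
  proof (intro conjI ballI allI)
    fix a s assume a: "a \<in> A"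
    note gD = face_unionsD[OF g a] and hD = face_unionsD[OF h a]
    show "((a, True) \<in> g) \<noteq> ((a, True) \<in> h) \<longleftrightarrow> ((rot a, False) \<in> g) \<noteq> ((rot a, False) \<in> h)"
      by (simp only: gD(1) hD(1))
    show "((a, s) \<in> g) \<noteq> ((a, s) \<in> h) \<longleftrightarrow> ((rv a, if ue a \<in> T then s else \<not> s) \<in> g) \<noteq>
        ((rv a, if ue a \<in> T then s else \<not> s) \<in> h)"
      by (cases "ue a \<in> T") (simp_all add: gD(2,3) hD(2,3))
  qed
qed

lemma sym_diff_additive_face_boundary:
  "sym_diff_additive (face_boundary M) (face_unions M (rot, T))"
  unfolding sym_diff_additive_def
proof (intro ballI)
  fix g h assume g: "g \<in> face_unions M (rot, T)" and h: "h \<in> face_unions M (rot, T)"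
  have gh: "sym_diff g h \<in> face_unions M (rot, T)"
    by (rule sym_diff_closedD(2)[OF sym_diff_closed_face_unions g h])
  show "face_boundary M (sym_diff g h) = sym_diff (face_boundary M g) (face_boundary M h)"
  proof (rule edge_set_eqI)
    show "sym_diff (face_boundary M g) (face_boundary M h) \<subseteq> E"
      using face_boundary_subset[of g] face_boundary_subset[of h] by blast
    fix a assume a: "a \<in> A"
    show "ue a \<in> face_boundary M (sym_diff g h) \<longleftrightarrow>
        ue a \<in> sym_diff (face_boundary M g) (face_boundary M h)"
      unfolding in_sym_diff_iff face_boundary_iff[OF g a] face_boundary_iff[OF h a]
        face_boundary_iff[OF gh a] by blast
  qed (rule face_boundary_subset)
qed

lemma sym_diff_closed_face_space: "sym_diff_closed (face_space M (rot, T))"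
  unfolding face_space_def
  by (rule sym_diff_closed_image[OF sym_diff_closed_face_unions sym_diff_additive_face_boundary])

lemma card_out_sides:
  assumes "rot \<in> RS" "g \<in> face_unions M (rot, T)"
  shows "card {a \<in> out v. (a, False) \<in> g} = card {a \<in> out v. (a, True) \<in> g}"
proof -
  have "{a \<in> out v. (a, True) \<in> g} = {a \<in> out v. (rot a, False) \<in> g}"
    using face_unionsD(1)[OF assms(2)] by auto
  then have "{a \<in> out v. (a, False) \<in> g} = rot ` {a \<in> out v. (a, True) \<in> g}"
    using rotation_image_out[OF assms(1), of v "\<lambda>a. (a, False) \<in> g"] by simp
  moreover have "inj_on rot X" for X
    using permutes_inj[OF rotation_permutes[OF assms(1)]] by (rule inj_on_subset) simp
  ultimately show ?thesis by (simp add: card_image)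
qed

text \<open>The rotation at a vertex matches the points of \<open>g\<close> labelled
  \<open>True\<close> with those labelled \<open>False\<close>. Hence the number of edge-ends with
  exactly one of the two points in \<open>g\<close> is even.\<close>

lemma face_space_subset_cycle_space:
  assumes "rot \<in> RS"
  shows "face_space M (rot, T) \<subseteq> cycle_space M"
proof
  fix c assume "c \<in> face_space M (rot, T)"
  then obtain g where g: "g \<in> face_unions M (rot, T)" "c = face_boundary M g"
    by (auto simp: face_space_def)
  have "even (card {a \<in> out v. ue a \<in> c})" for v
  proof -
    have "{a \<in> out v. ue a \<in> c} = {a \<in> out v. ((a, True) \<in> g) \<noteq> ((a, False) \<in> g)}"
      unfolding g(2) using face_boundary_iff[OF g(1)] by auto
    then show ?thesis
      using even_card_sym_diff_collect[OF finite_out_arcs, of v "\<lambda>a. (a, True) \<in> g" "\<lambda>a. (a, False) \<in> g"]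
        card_out_sides[OF assms g(1), of v]
      by simp
  qed
  then show "c \<in> cycle_space M"
    using face_boundary_subset by (auto simp: cycle_space_def edge_boundary_def g(2))
qed

text \<open>If no edge separates \<open>g\<close> from its complement, membership in
  \<open>g\<close> is constant across each ribbon, hence around each vertex and along each edge, and
  connectedness spreads it over the whole graph.\<close>

lemma face_boundary_eq_empty:
  assumes conn: "Digraph_Component.connected (fst M)"
    and rot: "rot \<in> RS" and g: "g \<in> face_unions M (rot, T)" "face_boundary M g = {}"
  shows "g = {} \<or> g = A \<times> UNIV"
proof -
  have side: "(a, False) \<in> g \<longleftrightarrow> (a, True) \<in> g" if "a \<in> A" for a
    using face_boundary_iff[OF g(1) that] g(2) by simp
  have rot_const: "(rot a, True) \<in> g \<longleftrightarrow> (a, True) \<in> g" if "a \<in> A" for a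
    using face_unionsD(1)[OF g(1) that] side[of "rot a"] that
      rotation_system_arcs(1)[OF bidir rot] by simp
  have vert: "(b, True) \<in> g \<longleftrightarrow> (a, True) \<in> g" if "a \<in> out v" "b \<in> out v" for a b v
    using that by (rule rotation_const[OF rot, where Q = "\<lambda>a. (a, True) \<in> g"]) (simp add: rot_const)
  let ?P = "\<lambda>v. \<exists>a\<in>out v. (a, True) \<in> g"
  have P: "?P (ta a) \<longleftrightarrow> (a, True) \<in> g" if "a \<in> A" for a
  proof -
    have a: "a \<in> out (ta a)" using that by simp
    show ?thesis using vert[OF a] a by blast
  qed
  have step: "?P (ta a) \<longleftrightarrow> ?P (he a)" if a: "a \<in> A" for a
  proof -
    have "(rv a, True) \<in> g \<longleftrightarrow> (a, True) \<in> g"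
      using face_unionsD(2,3)[OF g(1) a, of True] side[OF a] by (cases "ue a \<in> T") auto
    then show ?thesis using P[OF a] P[OF arev_in_arcs[OF a]] a by simp
  qed
  have base: "(a, True) \<in> g \<longleftrightarrow> (b, True) \<in> g" if "a \<in> A" "b \<in> A" for a b
    using connected_closed[OF conn tail_in_verts[OF that(1)] tail_in_verts[OF that(2)], of ?P, OF step]
    unfolding P[OF that(1)] P[OF that(2)] .
  have True_side: "p \<in> g \<longleftrightarrow> (fst p, True) \<in> g" if "fst p \<in> A" for p
    using side[OF that] by (cases p; cases "snd p") simp_all
  have const: "p \<in> g \<longleftrightarrow> q \<in> g" if "fst p \<in> A" "fst q \<in> A" for p q
    using base[OF that] unfolding True_side[OF that(1)] True_side[OF that(2)] .
  have sub: "g \<subseteq> A \<times> UNIV" using g(1) by (simp add: face_unions_iff)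
  show ?thesis
  proof (cases "g = {}")
    case False
    then obtain p where p: "p \<in> g" by blast
    then have "q \<in> g" if "q \<in> A \<times> UNIV" for q
      using const[of p q] sub that by auto
    then show ?thesis using sub by blast
  qed simp
qed

text \<open>The only relation between the boundaries of the faces is that their total sum vanishes,
  whence the factor 2.\<close>

lemma card_face_space:
  assumes conn: "Digraph_Component.connected (fst M)" and rot: "rot \<in> RS" and "A \<noteq> {}"
  shows "2 ^ card (faces M (rot, T)) = 2 * card (face_space M (rot, T))"
proof -
  have "A \<times> UNIV \<in> face_unions M (rot, T)"
    using rotation_system_arcs(1)[OF bidir rot] by (auto simp: face_unions_iff)
  moreover have "face_boundary M (A \<times> UNIV) = {}" "face_boundary M {} = {}"
    by (auto simp: face_boundary_def)
  moreover have "{} \<in> face_unions M (rot, T)"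
    by (rule sym_diff_closedD(1)[OF sym_diff_closed_face_unions])
  ultimately have "{g \<in> face_unions M (rot, T). face_boundary M g = {}} = {{}, A \<times> UNIV}"
    using face_boundary_eq_empty[OF conn rot, where T = T] by blast
  moreover have "A \<times> (UNIV :: bool set) \<noteq> {}" using assms(3) by simp
  then have "card {{}, A \<times> (UNIV :: bool set)} = 2" by (metis card_2_iff)
  ultimately show ?thesis
    using card_eq_card_kernel_times_card_image[OF finite_face_unions sym_diff_closed_face_unions
        sym_diff_additive_face_boundary, of rot T]
    by (simp add: card_face_unions[OF rot] face_space_def)
qed

section \<open>Comparing the radicals with and without twists\<close>

text \<open>Two unions of faces with the same boundary \<open>c\<close>, one with and one without
  twists, are compared by \<open>k\<close>. Both change membership across exactly the edges of
  \<open>c\<close>, so \<open>k\<close> is constant around each vertex and defines a vertex set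
  \<open>S\<close>. From one end of an edge to the other \<open>k\<close> changes exactly if the
  edge is twisted and belongs to \<open>c\<close>.\<close>

lemma twisted_part_in_cut_space:
  assumes rot: "rot \<in> RS"
    and "c \<in> face_space M (rot, T)" "c \<in> face_space M (rot, {})"
  shows "T \<inter> c \<in> cut_space M"
proof -
  obtain g g0 where g: "g \<in> face_unions M (rot, T)" "c = face_boundary M g"
    and g0: "g0 \<in> face_unions M (rot, {})" "c = face_boundary M g0"
    using assms(2,3) by (auto simp: face_space_def)
  define k where "k a \<longleftrightarrow> ((a, True) \<in> g) \<noteq> ((a, True) \<in> g0)" for a
  have c: "ue a \<in> c \<longleftrightarrow> ((a, True) \<in> g \<longleftrightarrow> (a, False) \<notin> g)"
    "ue a \<in> c \<longleftrightarrow> ((a, True) \<in> g0 \<longleftrightarrow> (a, False) \<notin> g0)" if "a \<in> A" for a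
    using face_boundary_iff[OF g(1) that] face_boundary_iff[OF g0(1) that] g(2) g0(2) by simp_all
  have k_rot: "k (rot a) = k a" if "a \<in> A" for a
    using that c[of "rot a"] face_unionsD(1)[OF g(1) that] face_unionsD(1)[OF g0(1) that]
      rotation_system_arcs(1)[OF bidir rot, of a]
    unfolding k_def by auto
  have k_const: "k b = k a" if "a \<in> out v" "b \<in> out v" for a b v
    using that by (rule rotation_const[OF rot]) (simp add: k_rot)
  define S where "S = {v \<in> V. \<exists>a\<in>out v. k a}"
  have S: "ta a \<in> S \<longleftrightarrow> k a" if "a \<in> A" for a
  proof -
    have a: "a \<in> out (ta a)" using that by simp
    have "(\<exists>b\<in>out (ta a). k b) \<longleftrightarrow> k a" using k_const[OF a] a by blast
    then show ?thesis using that by (simp add: S_def)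
  qed
  have "T \<inter> c = cut_edges M S"
  proof (rule edge_set_eqI)
    show "T \<inter> c \<subseteq> E" using face_boundary_subset g(2) by blast
    fix a assume a: "a \<in> A"
    have "ue a \<in> cut_edges M S \<longleftrightarrow> k a \<noteq> k (rv a)"
      using undirected_edge_in_cut_iff[OF bidir a] S[OF a] S[OF arev_in_arcs[OF a]] a by simp
    also have "\<dots> \<longleftrightarrow> ue a \<in> T \<inter> c"
      using face_unionsD(2,3)[OF g(1) a, of True] face_unionsD(3)[OF g0(1) a, of True] c[OF a]
      unfolding k_def by (cases "ue a \<in> T") auto
    finally show "ue a \<in> T \<inter> c \<longleftrightarrow> ue a \<in> cut_edges M S" by blast
  qed (rule cut_edges_subset)
  moreover have "S \<subseteq> V" by (auto simp: S_def)
  ultimately show ?thesis by (auto simp: cut_space_def)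
qed

text \<open>Complementing \<open>g0\<close> at all corner points of the vertices in \<open>S\<close>
  keeps its boundary, and alters the matching along an edge only if the edge is in the cut of
  \<open>S\<close>. These are the twisted edges of \<open>c\<close>, where the twist asks for this
  change; at a twisted edge outside \<open>c\<close> both sides agree anyway.\<close>

lemma in_face_space_if_twisted_part_in_cut_space:
  assumes rot: "rot \<in> RS" and "c \<in> face_space M (rot, {})" "T \<inter> c \<in> cut_space M"
  shows "c \<in> face_space M (rot, T)"
proof -
  obtain g0 where g0: "g0 \<in> face_unions M (rot, {})" "c = face_boundary M g0"
    using assms(2) by (auto simp: face_space_def)
  obtain S where S: "T \<inter> c = cut_edges M S" using assms(3) by (auto simp: cut_space_def)
  define g where "g = {(a, s). a \<in> A \<and> (((a, s) \<in> g0) \<noteq> (ta a \<in> S))}"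
  have g_iff: "(a, s) \<in> g \<longleftrightarrow> (((a, s) \<in> g0) \<noteq> (ta a \<in> S))" if "a \<in> A" for a s
    using that by (simp add: g_def)
  have g: "g \<in> face_unions M (rot, T)"
    unfolding face_unions_iff
  proof (intro conjI ballI allI)
    show "g \<subseteq> A \<times> UNIV" by (auto simp: g_def)
  next
    fix a assume a: "a \<in> A"
    then show "(a, True) \<in> g \<longleftrightarrow> (rot a, False) \<in> g"
      using face_unionsD(1)[OF g0(1) a] g_iff[OF a] g_iff[of "rot a"]
        rotation_system_arcs(1,3)[OF bidir rot, of a] by simp
  next
    fix a s assume a: "a \<in> A"
    have cut: "(ta a \<in> S \<longleftrightarrow> he a \<notin> S) \<longleftrightarrow> ue a \<in> T \<and> ue a \<in> c"
      using undirected_edge_in_cut_iff[OF bidir a, of S] S by blast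
    have "ue a \<in> c \<longleftrightarrow> ((a, True) \<in> g0 \<longleftrightarrow> (a, False) \<notin> g0)"
      using face_boundary_iff[OF g0(1) a] g0(2) by simp
    then show "(a, s) \<in> g \<longleftrightarrow> (rv a, if ue a \<in> T then s else \<not> s) \<in> g"
      using cut face_unionsD(3)[OF g0(1) a] g_iff[OF a] g_iff[OF arev_in_arcs[OF a]] a
      by (cases "ue a \<in> T"; cases s) auto
  qed
  have "face_boundary M g = c"
  proof (rule edge_set_eqI)
    show "c \<subseteq> E" using face_boundary_subset g0(2) by blast
    fix a assume a: "a \<in> A"
    show "ue a \<in> face_boundary M g \<longleftrightarrow> ue a \<in> c"
      using face_boundary_iff[OF g a] face_boundary_iff[OF g0(1) a] g0(2) g_iff[OF a] by auto
  qed (rule face_boundary_subset)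
  then show ?thesis using g by (auto simp: face_space_def)
qed

end

subsection \<open>Merging three faces at a vertex\<close>

text \<open>The walk from \<open>f x\<close> along the orbit reaches \<open>x\<close> without the
  step that starts at \<open>x\<close>, the only one about which nothing is assumed.\<close>

lemma orbit_return:
  assumes x: "x \<in> orbit f x" and refl: "r (f x) (f x)"
    and trans: "\<And>y z w. r y z \<Longrightarrow> r z w \<Longrightarrow> r y w"
    and step: "\<And>y. y \<in> orbit f x \<Longrightarrow> y \<noteq> x \<Longrightarrow> r y (f y)"
  shows "r (f x) x"
proof -
  have "r (f x) x \<or> r (f x) y" if "y \<in> orbit f x" for y
    using that
  proof induction
    case base
    then show ?case using refl by blast
  next
    case (step y)
    then show ?case using assms(4)[OF step.hyps] trans[of "f x" y "f y"] by (cases "y = x") auto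
  qed
  then show ?thesis using x by blast
qed

text \<open>The three segments of the cycle are traversed in a new order: from \<open>a\<close> to
  the segment after \<open>b\<close>, which ends in \<open>c\<close>, then to the one after
  \<open>a\<close>, which ends in \<open>b\<close>, then to the one after \<open>c\<close>, which
  ends in \<open>a\<close>. The opposite orientation would cut the orbit into three cycles.\<close>

lemma cyclic_on_reroute:
  fixes f :: "'a \<Rightarrow> 'a"
  assumes a: "a \<in> orbit f a" and b: "b = (f ^^ i) a" and c: "c = (f ^^ j) a"
    and ij: "0 < i" "i < j" "j < funpow_dist1 f a a"
    and h: "h a = f b" "h b = f c" "h c = f a" "\<And>x. x \<notin> {a, b, c} \<Longrightarrow> h x = f x"
  shows "cyclic_on h (orbit f a)"
proof -
  let ?n = "funpow_dist1 f a a"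
  have inj: "inj_on (\<lambda>k. (f ^^ k) a) {0..<?n}" by (rule inj_on_funpow_dist1[OF a])
  have n: "(f ^^ ?n) a = a" by (rule funpow_dist1_prop[OF a])
  have h_step: "h ((f ^^ k) a) = (f ^^ Suc k) a" if k: "0 < k" "k < ?n" "k \<noteq> i" "k \<noteq> j" for k
  proof -
    have "(f ^^ k) a \<noteq> (f ^^ l) a" if "l < ?n" "k \<noteq> l" for l
      using inj_onD[OF inj, of k l] k(2) that by auto
    from this[of 0] this[of i] this[of j] have "(f ^^ k) a \<notin> {a, b, c}"
      using k ij b c by auto
    then show ?thesis using h(4) by simp
  qed
  \<comment> \<open>Inside a segment \<open>h\<close> agrees with \<open>f\<close>, so it is enough
    to reach its first point \<open>(f ^^ Suc l) a\<close>.\<close>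
  have walk: "(f ^^ (l + k)) a \<in> orbit h a"
    if "(f ^^ Suc l) a \<in> orbit h a" "0 < k" "\<And>m. l < m \<Longrightarrow> m < l + k \<Longrightarrow> m < ?n \<and> m \<noteq> i \<and> m \<noteq> j"
    for l k
    using that(2,3)
  proof (induction k)
    case (Suc k)
    show ?case
    proof (cases "k = 0")
      case True
      then show ?thesis using that(1) by simp
    next
      case False
      then have "(f ^^ (l + k)) a \<in> orbit h a" using Suc.IH Suc.prems by simp
      then have "h ((f ^^ (l + k)) a) \<in> orbit h a" by (rule orbit.step)
      then show ?thesis using h_step[of "l + k"] Suc.prems(2)[of "l + k"] False by simp
    qed
  qed simp
  have "(f ^^ Suc i) a \<in> orbit h a" using orbit.base[of h a] h(1) b by simp
  then have 1: "(f ^^ k) a \<in> orbit h a" if "i < k" "k \<le> j" for k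
    using walk[of i "k - i"] that ij by simp
  have "h c \<in> orbit h a" using 1[of j] ij c by (auto intro: orbit.step)
  then have 2: "(f ^^ k) a \<in> orbit h a" if "0 < k" "k \<le> i" for k
    using walk[of 0 k] that ij h(3) by simp
  have "h b \<in> orbit h a" using 2[of i] ij b by (auto intro: orbit.step)
  then have 3: "(f ^^ k) a \<in> orbit h a" if "j < k" "k \<le> ?n" for k
    using walk[of j "k - j"] that ij h(2) c by simp
  have a_in: "a \<in> orbit h a" using 3[of ?n] n ij by simp
  have sub: "orbit f a \<subseteq> orbit h a"
  proof
    fix x assume "x \<in> orbit f a"
    then obtain k where k: "x = (f ^^ k) a" "k < ?n"
      unfolding orbit_conv_funpow_dist1[OF a] by auto
    then show "x \<in> orbit h a"
      using 1[of k] 2[of k] 3[of k] a_in by (cases "k = 0"; cases "k \<le> i"; cases "k \<le> j") auto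
  qed
  have bc: "b \<in> orbit f a" "c \<in> orbit f a"
    using b c ij by (auto intro: funpow_in_orbit[OF a])
  have h_in: "h x \<in> orbit f a" if "x \<in> orbit f a" for x
    using h orbit.step[OF that] orbit.step[OF bc(1)] orbit.step[OF bc(2)] orbit.step[OF a]
    by (cases "x \<in> {a, b, c}") auto
  have "x \<in> orbit f a" if "x \<in> orbit h a" for x
    using that by induction (use h_in a in auto)
  then show ?thesis unfolding cyclic_on_def using sub a by blast
qed

text \<open>The fixed point \<open>x\<close> is spliced into the cycle immediately after
  \<open>a\<close>.\<close>

lemma cyclic_on_insert:
  assumes f: "cyclic_on f S" and a: "a \<in> S" and x: "x \<notin> S" "f x = x"
  shows "cyclic_on (f \<circ> Transposition.transpose a x) (insert x S)"
proof -
  define h where "h = f \<circ> Transposition.transpose a x"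
  have h: "h a = x" "h x = f a" "\<And>y. y \<noteq> a \<Longrightarrow> y \<noteq> x \<Longrightarrow> h y = f y"
    using x(2) by (auto simp: h_def)
  have S: "S = orbit f a" using f a by (simp add: cyclic_on_alldef)
  have "y \<in> S \<and> y \<in> orbit h x" if "y \<in> orbit f a" for y
    using that
  proof induction
    case base
    then show ?case using orbit.base[of h x] orbit.base[of f a] h(2) S by simp
  next
    case (step y)
    then have fy: "f y \<in> S" using S orbit.step by metis
    show ?case
    proof (cases "y = a")
      case True
      then show ?thesis using fy orbit.base[of h x] h(2) by simp
    next
      case False
      then have "h y = f y" using h(3) step x(1) by blast
      then show ?thesis using fy step orbit.step[of y h x] by simp
    qed
  qed
  then have sub: "S \<subseteq> orbit h x" using S by blast
  then have "h a \<in> orbit h x" using a by (auto simp only: intro: orbit.step)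
  then have x_in: "x \<in> orbit h x" using h(1) by simp
  have f_in: "f y \<in> S" if "y \<in> S" for y using cyclic_on_inI[OF f that] .
  have "y \<in> insert x S" if "y \<in> orbit h x" for y
    using that
  proof induction
    case base
    then show ?case using h(2) f_in[OF a] by simp
  next
    case (step y)
    then show ?case using h f_in[of y] f_in[OF a] by (cases "y = a"; cases "y = x") auto
  qed
  then have "insert x S = orbit h x" using sub x_in by blast
  then show ?thesis unfolding cyclic_on_def h_def by blast
qed

lemma exists_cyclic_permutation:
  assumes "finite S" "S \<noteq> {}"
  shows "\<exists>f. f permutes S \<and> cyclic_on f S"
  using assms
proof (induction rule: finite_ne_induct)
  case (singleton x)
  have "orbit id x = {x}" by (simp add: orbit_eq_singleton_iff)
  then have "cyclic_on id {x}" by (simp add: cyclic_on_def)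
  then show ?case using permutes_id by blast
next
  case (insert x S)
  then obtain f a where f: "f permutes S" "cyclic_on f S" and a: "a \<in> S" by blast
  have "f permutes insert x S" by (rule permutes_subset[OF f(1)]) blast
  then have "f \<circ> Transposition.transpose a x permutes insert x S"
    using a by (intro permutes_compose permutes_swap_id) auto
  moreover have "f x = x" using f(1) insert.hyps(3) by (simp add: permutes_not_in)
  then have "cyclic_on (f \<circ> Transposition.transpose a x) (insert x S)"
    using cyclic_on_insert[OF f(2) a] insert.hyps(3) by blast
  ultimately show ?case by blast
qed

context finite_multigraph
begin

lemma finite_RS: "finite RS"
  by (rule finite_subset[OF _ finite_permutations[OF finite_arcs]]) (auto simp: rotation_systems_def)

lemma RS_nonempty: "RS \<noteq> {}"
proof -
  have "\<forall>v. \<exists>f. out v \<noteq> {} \<longrightarrow> f permutes out v \<and> cyclic_on f (out v)"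
    using exists_cyclic_permutation[OF finite_out_arcs] by blast
  then obtain f where f: "\<And>v. out v \<noteq> {} \<Longrightarrow> f v permutes out v"
    "\<And>v. out v \<noteq> {} \<Longrightarrow> cyclic_on (f v) (out v)" by metis
  define rot where "rot a = (if a \<in> A then f (ta a) a else a)" for a
  have out: "rot a \<in> out (ta a)" if "a \<in> A" for a
  proof -
    have a: "a \<in> out (ta a)" using that by simp
    then have "f (ta a) permutes out (ta a)" using f(1) by blast
    then show ?thesis using permutes_in_image[of "f (ta a)" "out (ta a)" a] a that
      by (simp add: rot_def)
  qed
  have "inj_on rot A"
  proof (rule inj_onI)
    fix a b assume ab: "a \<in> A" "b \<in> A" "rot a = rot b"
    then have t: "ta a = ta b" using out[OF ab(1)] out[OF ab(2)] by simp
    have "a \<in> out (ta a)" using ab(1) by simp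
    then have "f (ta a) permutes out (ta a)" using f(1) by blast
    then have "inj (f (ta a))" by (rule permutes_inj)
    then show "a = b" using ab t by (simp add: rot_def inj_eq)
  qed
  moreover have "rot ` A \<subseteq> A" using out by auto
  ultimately have "bij_betw rot A A"
    using endo_inj_surj[OF finite_arcs] by (simp add: bij_betw_def)
  then have "rot permutes A" by (rule bij_imp_permutes) (simp add: rot_def)
  moreover have "cyclic_on rot (out v)" if "out v \<noteq> {}" for v
  proof -
    have "cyclic_on rot (out v) = cyclic_on (f v) (out v)"
      by (rule cyclic_cong) (auto simp: rot_def)
    then show ?thesis using f(2)[OF that] by simp
  qed
  ultimately show ?thesis by (auto simp: rotation_systems_def)
qed

section \<open>Faces of untwisted rotation systems under rerouting\<close>

definition same_face :: "('e \<Rightarrow> 'e) \<Rightarrow> ('e \<times> bool) \<Rightarrow> ('e \<times> bool) \<Rightarrow> bool" where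
  "same_face rot x y \<longleftrightarrow> (x, y) \<in> (boundary_arcs M (rot, {}) \<union> (boundary_arcs M (rot, {}))\<inverse>)\<^sup>*"

lemma same_face_refl [simp]: "same_face rot x x"
  by (simp add: same_face_def)

lemma same_face_trans: "same_face rot x y \<Longrightarrow> same_face rot y z \<Longrightarrow> same_face rot x z"
  unfolding same_face_def by (rule rtrancl_trans)

lemma same_face_sym: "same_face rot x y \<Longrightarrow> same_face rot y x"
  unfolding same_face_def by (rule symD[OF sym_rtrancl]) (auto simp: sym_def)

lemma same_face_corner: "a \<in> A \<Longrightarrow> same_face rot (a, True) (rot a, False)"
  unfolding same_face_def boundary_arcs_def by (rule r_into_rtrancl) auto

lemma same_face_side: "a \<in> A \<Longrightarrow> same_face rot (a, s) (rv a, \<not> s)"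
  unfolding same_face_def boundary_arcs_def by (rule r_into_rtrancl) auto

lemma same_face_next:
  assumes "a \<in> A" "rot a \<in> A"
  shows "same_face rot (a, True) (rv (rot a), True)"
  using same_face_trans[OF same_face_corner[OF assms(1)], of rot "(rv (rot a), True)"]
    same_face_side[OF assms(2), of rot False] by simp

text \<open>Lying on the same face is the least equivalence relation containing the boundary arcs;
  this is the corresponding induction principle.\<close>

lemma same_face_imp:
  assumes "same_face rot x y"
    and refl: "\<And>x. Q x x" and sym: "\<And>x y. Q x y \<Longrightarrow> Q y x"
    and trans: "\<And>x y z. Q x y \<Longrightarrow> Q y z \<Longrightarrow> Q x z"
    and corner: "\<And>a. a \<in> A \<Longrightarrow> Q (a, True) (rot a, False)"
    and side: "\<And>a s. a \<in> A \<Longrightarrow> Q (a, s) (rv a, \<not> s)"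
  shows "Q x y"
proof -
  have arc: "Q x y" if "(x, y) \<in> boundary_arcs M (rot, {})" for x y
    using that corner side by (auto simp: boundary_arcs_def)
  have "(x, y) \<in> (boundary_arcs M (rot, {}) \<union> (boundary_arcs M (rot, {}))\<inverse>)\<^sup>*"
    using assms(1) by (simp add: same_face_def)
  then show ?thesis
  proof induction
    case base
    show ?case by (rule refl)
  next
    case (step y z)
    then have "Q y z" using arc[of y z] sym[OF arc[of z y]] by blast
    then show ?case by (rule trans[OF step.IH])
  qed
qed

lemma face_unions_same_face:
  assumes "g \<in> face_unions M (rot, {})" "same_face rot x y"
  shows "x \<in> g \<longleftrightarrow> y \<in> g"
  using assms(2)
proof (rule same_face_imp)
  fix a s assume a: "a \<in> A"
  show "(a, True) \<in> g \<longleftrightarrow> (rot a, False) \<in> g" using face_unionsD(1)[OF assms(1) a] by blast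
  show "(a, s) \<in> g \<longleftrightarrow> (rv a, \<not> s) \<in> g" using face_unionsD(3)[OF assms(1) a, of "\<not> s"] by simp
qed blast+

lemma face_unionsI:
  assumes "g \<subseteq> A \<times> UNIV" "\<And>x y. same_face rot x y \<Longrightarrow> x \<in> g \<longleftrightarrow> y \<in> g"
  shows "g \<in> face_unions M (rot, {})"
  unfolding face_unions_iff
proof (intro conjI ballI allI)
  fix a s assume a: "a \<in> A"
  show "(a, True) \<in> g \<longleftrightarrow> (rot a, False) \<in> g" by (rule assms(2)[OF same_face_corner[OF a]])
  show "(a, s) \<in> g \<longleftrightarrow> (rv a, if ue a \<in> {} then s else \<not> s) \<in> g"
    using assms(2)[OF same_face_side[OF a, where s = s]] by simp
qed (rule assms(1))

text \<open>The faces of an untwisted rotation system are traced by the permutation \<^term>\<open>rv \<circ> rot\<close>.\<close>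

lemma reroute_same_face:
  assumes rot: "rot \<in> RS" and D: "D \<subseteq> A"
    and distinct: "\<And>d d'. d \<in> D \<Longrightarrow> d' \<in> D \<Longrightarrow> same_face rot (d, True) (d', True) \<Longrightarrow> d = d'"
    and rot': "\<And>x. x \<notin> D \<Longrightarrow> rot' x = rot x" and d: "d \<in> D"
  shows "same_face rot' (rot d, False) (d, True)"
proof -
  let ?\<phi> = "rv \<circ> rot"
  have rot_A: "rot x \<in> A" if "x \<in> A" for x using rotation_system_arcs(1)[OF bidir rot] that by simp
  have dA: "d \<in> A" using d D by blast
  have "?\<phi> permutes A"
    by (rule permutes_compose[OF rotation_permutes[OF rot] arev_permutes_arcs])
  then have self: "d \<in> orbit ?\<phi> d"
    by (intro permutation_self_in_orbit) (use permutation_permutes finite_arcs in blast)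
  have face: "y \<in> A \<and> same_face rot (d, True) (y, True)" if "y \<in> orbit ?\<phi> d" for y
    using that
  proof induction
    case base
    show ?case
      using dA rot_A[OF dA] same_face_next[OF dA] by simp
  next
    case (step y)
    then have y: "y \<in> A" "same_face rot (d, True) (y, True)" by auto
    show ?case
      using rot_A[OF y(1)] same_face_trans[OF y(2) same_face_next[OF y(1)]] by simp
  qed
  \<comment> \<open>The face of \<open>d\<close> contains no other element of \<open>D\<close>, so
    tracing it from the successor of \<open>d\<close> back to \<open>d\<close> uses only corners
    that \<open>rot'\<close> leaves unchanged.\<close>
  have "same_face rot' (?\<phi> d, True) (d, True)"
  proof (rule orbit_return[OF self])
    fix y assume y: "y \<in> orbit ?\<phi> d" "y \<noteq> d"
    have yA: "y \<in> A" and "same_face rot (d, True) (y, True)" using face[OF y(1)] by blast+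
    then have "y \<notin> D" using distinct[OF d, of y] y(2) by blast
    then have "rot' y = rot y" by (rule rot')
    then show "same_face rot' (y, True) (?\<phi> y, True)"
      using same_face_next[OF yA, of rot'] rot_A[OF yA] by simp
  qed (rule same_face_refl, rule same_face_trans)
  moreover have "same_face rot' (rot d, False) (?\<phi> d, True)"
    using same_face_side[OF rot_A[OF dA], of rot' False] by simp
  ultimately show ?thesis using same_face_trans by blast
qed

text \<open>Each of the faces at \<open>a\<close>, \<open>b\<close>, \<open>c\<close>, opened at its
  corner, survives as an unbroken path, so no old face is torn apart. The new corner at
  \<open>a\<close> leads into the path of \<open>b\<close>, so at least two faces are
  joined.\<close>

lemma reroute_num_faces_less:
  assumes rot: "rot \<in> RS" and rot': "rot' \<in> RS" and abc: "{a, b, c} \<subseteq> A"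
    and distinct: "\<And>d d'. d \<in> {a, b, c} \<Longrightarrow> d' \<in> {a, b, c} \<Longrightarrow>
      same_face rot (d, True) (d', True) \<Longrightarrow> d = d'"
    and "a \<noteq> b"
    and h: "rot' a = rot b" "\<And>x. x \<notin> {a, b, c} \<Longrightarrow> rot' x = rot x"
  shows "card (faces M (rot', {})) < card (faces M (rot, {}))"
proof -
  have corner_back: "same_face rot' (rot d, False) (d, True)" if "d \<in> {a, b, c}" for d
    by (rule reroute_same_face[OF rot abc distinct h(2) that])
  have coarser: "same_face rot' x y" if "same_face rot x y" for x y
    using that
  proof (rule same_face_imp)
    fix d s assume d: "d \<in> A"
    show "same_face rot' (d, s) (rv d, \<not> s)" by (rule same_face_side[OF d])
    show "same_face rot' (d, True) (rot d, False)"
    proof (cases "d \<in> {a, b, c}")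
      case True
      then show ?thesis by (rule same_face_sym[OF corner_back])
    next
      case False
      then show ?thesis using same_face_corner[OF d, of rot'] h(2)[of d] by simp
    qed
  qed (rule same_face_refl, erule same_face_sym, erule (1) same_face_trans)
  have ab: "same_face rot' (a, True) (b, True)"
    using same_face_trans[OF same_face_corner[of a rot'] corner_back[of b, folded h(1)]] abc by simp
  have sub: "face_unions M (rot', {}) \<subseteq> face_unions M (rot, {})"
  proof
    fix g assume g: "g \<in> face_unions M (rot', {})"
    show "g \<in> face_unions M (rot, {})"
    proof (rule face_unionsI)
      show "g \<subseteq> A \<times> UNIV" using g by (simp add: face_unions_iff)
      show "x \<in> g \<longleftrightarrow> y \<in> g" if "same_face rot x y" for x y
        by (rule face_unions_same_face[OF g coarser[OF that]])
    qed
  qed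
  \<comment> \<open>The old face of \<open>a\<close> shows strictness: it is no longer closed once
    it is joined to the face of \<open>b\<close>.\<close>
  let ?g = "{x \<in> A \<times> UNIV. same_face rot (a, True) x}"
  have g: "?g \<in> face_unions M (rot, {})"
    unfolding face_unions_iff
  proof (intro conjI ballI allI)
    fix d s assume d: "d \<in> A"
    have iff: "same_face rot (a, True) x \<longleftrightarrow> same_face rot (a, True) y" if "same_face rot x y" for x y
      using same_face_trans[OF _ that] same_face_trans[OF _ same_face_sym[OF that]] by blast
    show "(d, True) \<in> ?g \<longleftrightarrow> (rot d, False) \<in> ?g"
      using iff[OF same_face_corner[OF d]] d rotation_system_arcs(1)[OF bidir rot] by simp
    show "(d, s) \<in> ?g \<longleftrightarrow> (rv d, if ue d \<in> {} then s else \<not> s) \<in> ?g"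
      using iff[OF same_face_side[OF d, where s = s]] d by simp
  qed blast
  have "(a, True) \<in> ?g" "(b, True) \<notin> ?g"
    using abc distinct[of a b] \<open>a \<noteq> b\<close> by auto
  then have "?g \<notin> face_unions M (rot', {})"
    using face_unions_same_face[OF _ ab] by blast
  then have "face_unions M (rot', {}) \<subset> face_unions M (rot, {})" using g sub by blast
  then have "card (face_unions M (rot', {})) < card (face_unions M (rot, {}))"
    by (rule psubset_card_mono[OF finite_face_unions])
  then show ?thesis by (simp add: card_face_unions[OF rot] card_face_unions[OF rot'])
qed

lemma reroute_in_RS:
  assumes rot: "rot \<in> RS" and abc: "{a, b, c} \<subseteq> out v" and distinct: "distinct [a, b, c]"
    and b: "b = (rot ^^ i) a" and c: "c = (rot ^^ j) a"
    and ij: "0 < i" "i < j" "j < funpow_dist1 rot a a"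
  shows "rot \<circ> (Transposition.transpose a b \<circ> Transposition.transpose b c) \<in> RS"
proof -
  let ?h = "rot \<circ> (Transposition.transpose a b \<circ> Transposition.transpose b c)"
  have h: "?h a = rot b" "?h b = rot c" "?h c = rot a" "\<And>x. x \<notin> {a, b, c} \<Longrightarrow> ?h x = rot x"
    using distinct by (auto simp: Transposition.transpose_def)
  have "?h permutes A"
    using abc by (intro permutes_compose permutes_swap_id rotation_permutes[OF rot]) auto
  moreover have "cyclic_on ?h (out w)" if w: "w \<in> V" "out w \<noteq> {}" for w
  proof (cases "w = v")
    case True
    have "cyclic_on rot (out v)" using rot w True unfolding rotation_systems_def by blast
    then have orb: "out v = orbit rot a" using abc by (simp add: cyclic_on_alldef)
    then have self: "a \<in> orbit rot a" using abc by blast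
    show ?thesis unfolding True orb by (rule cyclic_on_reroute[OF self b c ij h])
  next
    case False
    have "cyclic_on ?h (out w) = cyclic_on rot (out w)"
    proof (rule cyclic_cong)
      fix x assume "x \<in> out w"
      then have "x \<notin> {a, b, c}" using abc False by auto
      then show "?h x = rot x" by (rule h(4))
    qed
    then show ?thesis using rot w unfolding rotation_systems_def by blast
  qed
  ultimately show ?thesis unfolding rotation_systems_def by blast
qed

text \<open>
  Composing the rotation at a vertex with a 3-cycle of corners in three different faces merges
  these faces, and one of the two orientations of the 3-cycle yields a rotation again.
\<close>

lemma three_faces_not_minimal:
  assumes rot: "rot \<in> RS" and abc: "{a, b, c} \<subseteq> out v" and ne: "distinct [a, b, c]"
    and distinct: "\<And>d d'. d \<in> {a, b, c} \<Longrightarrow> d' \<in> {a, b, c} \<Longrightarrow>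
      same_face rot (d, True) (d', True) \<Longrightarrow> d = d'"
  shows "\<exists>rot'\<in>RS. card (faces M (rot', {})) < card (faces M (rot, {}))"
proof -
  have A: "{a, b, c} \<subseteq> A" "v \<in> V" "out v \<noteq> {}" using abc by auto
  have "cyclic_on rot (out v)" using rot A unfolding rotation_systems_def by blast
  then have orb: "out v = orbit rot a" using abc by (simp add: cyclic_on_alldef)
  then have self: "a \<in> orbit rot a" using abc by blast
  have "\<exists>i. x = (rot ^^ i) a \<and> 0 < i \<and> i < funpow_dist1 rot a a" if x: "x \<in> out v" "x \<noteq> a" for x
  proof -
    obtain i where "x = (rot ^^ i) a" "i < funpow_dist1 rot a a"
      using x(1) unfolding orb orbit_conv_funpow_dist1[OF self] by auto
    then show ?thesis using x(2) by (cases "i = 0") auto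
  qed
  from this[of b] this[of c] obtain i j where i: "b = (rot ^^ i) a" "0 < i" "i < funpow_dist1 rot a a"
    and j: "c = (rot ^^ j) a" "0 < j" "j < funpow_dist1 rot a a"
    using abc ne by auto
  have "i \<noteq> j" using i j ne by auto
  then consider "i < j" | "j < i" by linarith
  then show ?thesis
  proof cases
    case 1
    let ?h = "rot \<circ> (Transposition.transpose a b \<circ> Transposition.transpose b c)"
    have h: "?h \<in> RS" by (rule reroute_in_RS[OF rot abc ne i(1) j(1) i(2) 1 j(3)])
    have "card (faces M (?h, {})) < card (faces M (rot, {}))"
    proof (rule reroute_num_faces_less[OF rot h A(1) distinct])
      show "?h x = rot x" if "x \<notin> {a, b, c}" for x using that by (auto simp: Transposition.transpose_def)
    qed (use ne in \<open>auto simp: Transposition.transpose_def\<close>)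
    then show ?thesis using h by blast
  next
    case 2
    let ?h = "rot \<circ> (Transposition.transpose a c \<circ> Transposition.transpose c b)"
    have abc': "{a, c, b} = {a, b, c}" by blast
    have h: "?h \<in> RS"
      using reroute_in_RS[OF rot, of a c b v j i] abc ne i j 2 by auto
    have "card (faces M (?h, {})) < card (faces M (rot, {}))"
    proof (rule reroute_num_faces_less[OF rot h, of a c b])
      show "{a, c, b} \<subseteq> A" using A(1) abc' by simp
      show "d = d'" if "d \<in> {a, c, b}" "d' \<in> {a, c, b}" "same_face rot (d, True) (d', True)" for d d'
        using distinct[OF _ _ that(3)] that(1,2) abc' by simp
      show "?h x = rot x" if "x \<notin> {a, c, b}" for x using that by (auto simp: Transposition.transpose_def)
    qed (use ne in \<open>auto simp: Transposition.transpose_def\<close>)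
    then show ?thesis using h by blast
  qed
qed

end

subsection \<open>Estimating the number of faces\<close>

text \<open>For the set \<open>h\<close> of twisted edges these are the cycles on which the diagonal
  form is nonzero, in other words the coins that show heads.\<close>

definition odd_part :: "'a set set \<Rightarrow> 'a set \<Rightarrow> 'a set set" where
  "odd_part C h = {c \<in> C. odd (card (h \<inter> c))}"

lemma sym_diff_Int: "sym_diff g h \<inter> c = sym_diff (g \<inter> c) (h \<inter> c)"
  by blast

lemma sym_diff_additive_odd_part:
  assumes "finite X"
  shows "sym_diff_additive (odd_part C) (Pow X)"
  unfolding sym_diff_additive_def
proof (intro ballI set_eqI)
  fix g h c assume "g \<in> Pow X" "h \<in> Pow X"
  then have "finite g" "finite h" using assms by (simp_all add: finite_subset[OF _ assms])
  then have "even (card (sym_diff g h \<inter> c)) \<longleftrightarrow> (even (card (g \<inter> c)) \<longleftrightarrow> even (card (h \<inter> c)))"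
    unfolding sym_diff_Int by (intro even_card_sym_diff) auto
  then show "c \<in> odd_part C (sym_diff g h) \<longleftrightarrow> c \<in> sym_diff (odd_part C g) (odd_part C h)"
    unfolding in_sym_diff_iff odd_part_def mem_Collect_eq by blast
qed

text \<open>One representative from each member of \<open>J\<close> meets every member of
  \<open>J\<close> once and, by disjointness, no other member of \<open>C\<close>.\<close>

lemma odd_part_image_Pow:
  assumes C: "disjoint C" "{} \<notin> C" "C \<subseteq> Pow X"
  shows "odd_part C ` Pow X = Pow C"
proof (intro equalityI subsetI)
  fix J assume J: "J \<in> Pow C"
  have "\<forall>c\<in>C. \<exists>e. e \<in> c" using C(2) by (metis ex_in_conv)
  then obtain f where f: "\<And>c. c \<in> C \<Longrightarrow> f c \<in> c" by metis
  have Int: "f ` J \<inter> c = (if c \<in> J then {f c} else {})" if c: "c \<in> C" for c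
  proof -
    have eq: "d = c" if "d \<in> J" "f d \<in> c" for d
    proof (rule ccontr)
      assume "d \<noteq> c"
      then have "d \<inter> c = {}" using disjointD[OF C(1)] that(1) J c by blast
      then show False using f[of d] that J by blast
    qed
    show ?thesis
    proof (cases "c \<in> J")
      case True
      then have "f ` J \<inter> c = {f c}" using eq f[OF c] by blast
      then show ?thesis using True by simp
    next
      case False
      then have "f ` J \<inter> c = {}" using eq by blast
      then show ?thesis using False by simp
    qed
  qed
  have "odd_part C (f ` J) = J"
  proof (intro set_eqI iffI)
    fix c assume "c \<in> odd_part C (f ` J)"
    then have "c \<in> C" "odd (card (f ` J \<inter> c))" by (simp_all add: odd_part_def)
    then show "c \<in> J" using Int[of c] by (cases "c \<in> J") simp_all
  next
    fix c assume c: "c \<in> J"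
    then have "c \<in> C" using J by blast
    then show "c \<in> odd_part C (f ` J)" using Int[of c] c by (simp add: odd_part_def)
  qed
  moreover have "f ` J \<in> Pow X"
  proof -
    have "f c \<in> X" if "c \<in> J" for c
      using f[of c] that J C(3) by blast
    then show ?thesis by blast
  qed
  ultimately show "J \<in> odd_part C ` Pow X" by (metis image_eqI)
qed (auto simp: odd_part_def)

text \<open>All fibres are translates of the kernel. The count is used both for the distribution of
  the coins and, with \<open>J\<close> empty, for the dimension of the orthogonal complement of
  \<open>C\<close>.\<close>

lemma card_odd_part_fiber:
  assumes "finite X" and C: "disjoint C" "{} \<notin> C" "C \<subseteq> Pow X" and J: "J \<subseteq> C"
  shows "card {h \<in> Pow X. odd_part C h = J} * 2 ^ card C = 2 ^ card X"
proof -
  note add = sym_diff_additive_odd_part[OF assms(1), of C]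
  have "finite (Pow X)" using assms(1) by simp
  then have finC: "finite C" by (rule finite_subset[OF C(3)])
  have "J \<in> odd_part C ` Pow X" using odd_part_image_Pow[OF C] J by simp
  then obtain h0 where h0: "h0 \<in> Pow X" "J = odd_part C h0" by (rule imageE)
  have "card {h \<in> Pow X. odd_part C h = J} = card {h \<in> Pow X. odd_part C h = {}}"
    unfolding h0(2) by (rule card_fiber_sym_diff[OF sym_diff_closed_Pow add h0(1)])
  then show ?thesis
    using card_eq_card_kernel_times_card_image[OF \<open>finite (Pow X)\<close> sym_diff_closed_Pow add]
    by (simp add: odd_part_image_Pow[OF C] card_Pow assms(1) finC)
qed

text \<open>The formula for connected graphs, applied to all graphs: for a disconnected one it is
  not the dimension of the cycle space, and the subtraction may be truncated.\<close>

definition betti_number :: "('v, 'e) multigraph \<Rightarrow> nat" where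
  "betti_number M = card (edges M) + 1 - card (verts (fst M))"

context finite_multigraph
begin

section \<open>Disjoint cycles separating pairs of faces\<close>

text \<open>Where an edge between two different faces ends, only these two faces meet, and around
  the vertex the face changes an even number of times; so the edges between them form a cycle.
  Whether an edge bounds a union of faces depends only on the pair of faces at the edge, so every
  element of the face space is a union of members of \<open>C\<close>.\<close>

lemma separating_family:
  assumes rot: "rot \<in> RS"
    and minimal: "\<And>rot'. rot' \<in> RS \<Longrightarrow> card (faces M (rot, {})) \<le> card (faces M (rot', {}))"
  obtains C where "C \<subseteq> cycle_space M" "disjoint C" "{} \<notin> C"
    and "card (face_space M (rot, {})) \<le> 2 ^ card C"
proof -
  \<comment> \<open>The face at the corner following \<open>a\<close>. As
    \<open>(rv a, True)\<close> and \<open>(a, False)\<close> lie on one face,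
    \<open>\<kappa> a\<close> and \<open>\<kappa> (rv a)\<close> are the faces on the two sides of
    the edge.\<close>
  define \<kappa> where "\<kappa> a = {x. same_face rot (a, True) x}" for a
  have \<kappa>_eq_iff: "\<kappa> a = \<kappa> b \<longleftrightarrow> same_face rot (a, True) (b, True)" for a b
  proof
    assume "\<kappa> a = \<kappa> b"
    moreover have "(b, True) \<in> \<kappa> b" by (simp add: \<kappa>_def)
    ultimately have "(b, True) \<in> \<kappa> a" by simp
    then show "same_face rot (a, True) (b, True)" by (simp add: \<kappa>_def)
  next
    assume h: "same_face rot (a, True) (b, True)"
    show "\<kappa> a = \<kappa> b"
      unfolding \<kappa>_def using same_face_trans[OF h] same_face_trans[OF same_face_sym[OF h]] by blast
  qed
  have rot_A: "rot a \<in> A" if "a \<in> A" for a using rotation_system_arcs(1)[OF bidir rot] that by simp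
  have \<kappa>_rot: "\<kappa> (rv (rot a)) = \<kappa> a" if "a \<in> A" for a
  proof -
    have "same_face rot (a, True) (rv (rot a), True)" using that rot_A[OF that] by (rule same_face_next)
    then show ?thesis unfolding \<kappa>_eq_iff by (rule same_face_sym)
  qed
  have two: "\<kappa> c = \<kappa> a \<or> \<kappa> c = \<kappa> b"
    if abc: "a \<in> out v" "b \<in> out v" "c \<in> out v" and ab: "\<kappa> a \<noteq> \<kappa> b" for a b c v
  proof (rule ccontr)
    assume n: "\<not> (\<kappa> c = \<kappa> a \<or> \<kappa> c = \<kappa> b)"
    have "\<exists>rot'\<in>RS. card (faces M (rot', {})) < card (faces M (rot, {}))"
    proof (rule three_faces_not_minimal[OF rot])
      show "{a, b, c} \<subseteq> out v" using abc by blast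
      show "distinct [a, b, c]" using n ab by auto
      fix d d' assume "d \<in> {a, b, c}" "d' \<in> {a, b, c}" "same_face rot (d, True) (d', True)"
      then show "d = d'" using n ab by (auto simp: \<kappa>_eq_iff[symmetric])
    qed
    then show False using minimal by (metis not_le)
  qed
  define p where "p a = {\<kappa> a, \<kappa> (rv a)}" for a
  have p_rv: "p (rv a) = p a" for a by (simp add: p_def insert_commute)
  define N where "N = {a \<in> A. \<kappa> a \<noteq> \<kappa> (rv a)}"
  define cls where "cls a = ue ` {b \<in> A. p b = p a}" for a
  define C where "C = cls ` N"
  have in_cls: "ue b \<in> cls a \<longleftrightarrow> p b = p a" if "b \<in> A" for a b
  proof
    assume "ue b \<in> cls a"
    then obtain d where "p d = p a" "ue d = ue b" by (auto simp: cls_def)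
    then show "p b = p a" using p_rv by (auto simp: ue_eq_iff)
  qed (use that in \<open>simp add: cls_def\<close>)
  have cls_E: "cls a \<subseteq> E" for a by (auto simp: cls_def)
  have disj: "disjoint C"
  proof (rule disjointI)
    fix c d assume "c \<in> C" "d \<in> C" "c \<noteq> d"
    then obtain a b where ab: "c = cls a" "d = cls b" by (auto simp: C_def)
    show "c \<inter> d = {}"
    proof (rule ccontr)
      assume "c \<inter> d \<noteq> {}"
      then obtain e where e: "e \<in> cls a" "e \<in> cls b" unfolding ab by blast
      then have "e \<in> E" using cls_E by blast
      then obtain x where x: "x \<in> A" "e = ue x" by (rule E_cases)
      then have "p a = p b" using e in_cls[OF x(1)] by simp
      then show False using \<open>c \<noteq> d\<close> ab by (simp add: cls_def)
    qed
  qed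
  have ne: "{} \<notin> C"
    using in_cls by (auto simp: C_def N_def)
  have cyc: "C \<subseteq> cycle_space M"
  proof
    fix c assume "c \<in> C"
    then obtain a where a: "a \<in> N" "c = cls a" by (auto simp: C_def)
    have "even (card {b \<in> out v. ue b \<in> c})" for v
    proof (cases "{b \<in> out v. ue b \<in> c} = {}")
      case False
      then obtain b0 where b0: "b0 \<in> out v" "p b0 = p a" using in_cls a(2) by auto
      have "\<kappa> b0 \<noteq> \<kappa> (rv b0)"
      proof
        assume "\<kappa> b0 = \<kappa> (rv b0)"
        then have "p a = {\<kappa> b0}" using b0(2) by (simp add: p_def)
        then have "\<kappa> a = \<kappa> (rv a)" by (simp add: p_def doubleton_eq_iff)
        then show False using a(1) by (simp add: N_def)
      qed
      \<comment> \<open>The face on the other side of \<open>b\<close> is that of the preceding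
        corner at the same vertex.\<close>
      have pre: "\<exists>x\<in>out v. \<kappa> (rv b) = \<kappa> x" if "b \<in> out v" for b
      proof -
        have b: "b \<in> rot ` {y \<in> out v. True}"
          using rotation_image_out[OF rot, of v "\<lambda>_. True"] that by simp
        then obtain x where "x \<in> out v" "b = rot x" by auto
        then show ?thesis using \<kappa>_rot[of x] by auto
      qed
      obtain x0 where x0: "x0 \<in> out v" "\<kappa> (rv b0) = \<kappa> x0" using pre[OF b0(1)] by blast
      have b0x0: "\<kappa> b0 \<noteq> \<kappa> x0" using \<open>\<kappa> b0 \<noteq> \<kappa> (rv b0)\<close> x0(2) by simp
      have range: "\<kappa> b = \<kappa> b0 \<or> \<kappa> b = \<kappa> x0" if "b \<in> out v" for b
        by (rule two[OF b0(1) x0(1) that b0x0])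
      have range_rv: "\<kappa> (rv b) = \<kappa> b0 \<or> \<kappa> (rv b) = \<kappa> x0" if "b \<in> out v" for b
        using pre[OF that] range by metis
      have pa: "p a = {\<kappa> b0, \<kappa> x0}" using b0(2) x0(2) by (simp add: p_def)
      have "ue b \<in> c \<longleftrightarrow> (\<kappa> b = \<kappa> b0) \<noteq> (\<kappa> (rv b) = \<kappa> b0)" if b: "b \<in> out v" for b
      proof -
        have "ue b \<in> c \<longleftrightarrow> {\<kappa> b, \<kappa> (rv b)} = {\<kappa> b0, \<kappa> x0}"
          using in_cls[of b a] b a(2) pa by (simp add: p_def)
        then show ?thesis using range[OF b] range_rv[OF b] b0x0 by (auto simp: doubleton_eq_iff)
      qed
      then have eq: "{b \<in> out v. ue b \<in> c} =
          {b \<in> out v. (\<kappa> b = \<kappa> b0) \<noteq> (\<kappa> (rv b) = \<kappa> b0)}" by blast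
      \<comment> \<open>The rotation matches the edge-ends followed by the face of \<open>b0\<close>
        with those preceded by it, so the edge-ends where exactly one of the two holds are even in
        number.\<close>
      have "{b \<in> out v. \<kappa> (rv b) = \<kappa> b0} = rot ` {b \<in> out v. \<kappa> (rv (rot b)) = \<kappa> b0}"
        by (rule rotation_image_out[OF rot, symmetric])
      also have "{b \<in> out v. \<kappa> (rv (rot b)) = \<kappa> b0} = {b \<in> out v. \<kappa> b = \<kappa> b0}"
        using \<kappa>_rot by auto
      finally have "card {b \<in> out v. \<kappa> (rv b) = \<kappa> b0} = card {b \<in> out v. \<kappa> b = \<kappa> b0}"
        using inj_on_subset[OF permutes_inj[OF rotation_permutes[OF rot]] subset_UNIV]
        by (simp add: card_image)
      then show ?thesis
        using even_card_sym_diff_collect[OF finite_out_arcs, of v "\<lambda>b. \<kappa> b = \<kappa> b0" "\<lambda>b. \<kappa> (rv b) = \<kappa> b0"]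
        unfolding eq by simp
    qed (simp only: card.empty even_zero)
    then show "c \<in> cycle_space M"
      using cls_E[of a] a(2) by (simp add: cycle_space_def edge_boundary_def)
  qed
  have finC: "finite C" by (rule finite_subset[OF cyc finite_cycle_space])
  have "face_space M (rot, {}) \<subseteq> Sup ` Pow C"
  proof
    fix f assume "f \<in> face_space M (rot, {})"
    then obtain g where g: "g \<in> face_unions M (rot, {})" "f = face_boundary M g"
      by (auto simp: face_space_def)
    define q where "q a \<longleftrightarrow> (a, True) \<in> g" for a
    have q_\<kappa>: "q a = q b" if "\<kappa> a = \<kappa> b" for a b
      using face_unions_same_face[OF g(1)] that unfolding q_def \<kappa>_eq_iff by blast
    have f_iff: "ue a \<in> f \<longleftrightarrow> q a \<noteq> q (rv a)" if a: "a \<in> A" for a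
      using face_boundary_iff[OF g(1) a] face_unionsD(3)[OF g(1) a, of True] g(2)
      by (simp add: q_def)
    have f_p: "ue a \<in> f \<longleftrightarrow> ue b \<in> f" if ab: "a \<in> A" "b \<in> A" "p a = p b" for a b
    proof -
      have "\<kappa> a = \<kappa> b \<and> \<kappa> (rv a) = \<kappa> (rv b) \<or> \<kappa> a = \<kappa> (rv b) \<and> \<kappa> (rv a) = \<kappa> b"
        using ab(3) by (simp add: p_def doubleton_eq_iff)
      then show ?thesis
        unfolding f_iff[OF ab(1)] f_iff[OF ab(2)] using q_\<kappa> by metis
    qed
    have "f = \<Union>{c \<in> C. c \<inter> f \<noteq> {}}"
    proof (intro equalityI subsetI)
      fix e assume e: "e \<in> f"
      have "e \<in> E" using face_boundary_subset e g(2) by blast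
      then obtain a where a: "a \<in> A" "e = ue a" by (rule E_cases)
      then have "\<kappa> a \<noteq> \<kappa> (rv a)" using e f_iff[OF a(1)] q_\<kappa> by blast
      then have "cls a \<in> C" using a(1) by (simp add: C_def N_def)
      moreover have "e \<in> cls a" using in_cls[OF a(1)] a(2) by simp
      ultimately show "e \<in> \<Union>{c \<in> C. c \<inter> f \<noteq> {}}" using e by blast
    next
      fix e assume "e \<in> \<Union>{c \<in> C. c \<inter> f \<noteq> {}}"
      then obtain c e' where c: "c \<in> C" "e \<in> c" "e' \<in> c" "e' \<in> f" by blast
      then obtain a where a: "c = cls a" by (auto simp: C_def)
      have "e \<in> E" "e' \<in> E" using cls_E c(2,3) a by blast+
      then obtain b b' where b: "b \<in> A" "e = ue b" "b' \<in> A" "e' = ue b'" by (metis E_cases)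
      then have "p b = p b'" using in_cls c(2,3) a by simp
      then show "e \<in> f" using f_p[OF b(1,3)] b(2,4) c(4) by simp
    qed
    then show "f \<in> Sup ` Pow C" by blast
  qed
  then have "card (face_space M (rot, {})) \<le> card (Sup ` Pow C)"
    using finC by (intro card_mono) simp_all
  also have "\<dots> = 2 ^ card C" by (rule card_Union_Pow_disjoint[OF disj ne finC])
  finally show ?thesis using that cyc disj ne by blast
qed

abbreviation "betti \<equiv> betti_number M"

lemma card_cycle_space_betti:
  assumes conn: "Digraph_Component.connected (fst M)"
  shows "card (cycle_space M) = 2 ^ betti" "betti + card V = card E + 1"
proof -
  note eq = card_cycle_space[OF conn]
  have V: "card V > 0" using connected_nonempty[OF conn] by (simp add: card_gt_0_iff)
  have "card (cycle_space M) \<noteq> 0"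
    using sym_diff_closedD(1)[OF sym_diff_closed_cycle_space] finite_cycle_space
    by (auto simp: card_eq_0_iff)
  then have "(2::nat) ^ (card V - 1) \<le> 2 ^ card E" unfolding eq by simp
  then have le: "card V - 1 \<le> card E" by (rule power_le_imp_le_exp[rotated]) simp
  then show b: "betti + card V = card E + 1" using V by (simp add: betti_number_def)
  have "card E = betti + (card V - 1)" using b V by simp
  then have "card (cycle_space M) * 2 ^ (card V - 1) = 2 ^ betti * 2 ^ (card V - 1)"
    using eq by (simp add: power_add)
  then show "card (cycle_space M) = 2 ^ betti" by simp
qed

lemma faces_nonempty:
  assumes "A \<noteq> {}" "rot \<in> RS"
  shows "card (faces M (rot, T)) > 0"
proof -
  have "card (face_unions M (rot, T)) \<ge> card {{}, A \<times> (UNIV :: bool set)}"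
    using rotation_system_arcs(1)[OF bidir assms(2)] finite_face_unions
    by (intro card_mono) (auto simp: face_unions_iff)
  moreover have "A \<times> (UNIV :: bool set) \<noteq> {}" using assms(1) by simp
  then have "card {{}, A \<times> (UNIV :: bool set)} = 2" by (metis card_2_iff)
  ultimately have "2 \<le> (2::nat) ^ card (faces M (rot, T))"
    unfolding card_face_unions[OF assms(2)] by simp
  then show ?thesis by (cases "card (faces M (rot, T))") simp_all
qed

lemma card_face_space_power:
  assumes "Digraph_Component.connected (fst M)" "rot \<in> RS" "A \<noteq> {}"
  shows "card (face_space M (rot, T)) = 2 ^ (card (faces M (rot, T)) - 1)"
proof -
  obtain k where k: "card (faces M (rot, T)) = Suc k"
    using faces_nonempty[OF assms(3,2)] by (metis Suc_pred)
  then show ?thesis using card_face_space[OF assms, of T] by simp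
qed

section \<open>The number of faces for given twists\<close>

text \<open>Both inequalities say that the dimension \<open>F\<close> of the twisted radical and the
  number \<open>m0\<close> of members of \<open>C\<close> met evenly by \<open>T\<close> differ by
  at most \<open>2 * k\<close>. Each of the two errors \<open>k\<close> is a codimension in the
  cycle space: one of the span of \<open>C\<close>, one of the untwisted radical.\<close>

lemma faces_estimate:
  assumes conn: "Digraph_Component.connected (fst M)" and rot: "rot \<in> RS" and T: "T \<subseteq> E"
    and A: "A \<noteq> {}" and C: "C \<subseteq> cycle_space M" "disjoint C" "{} \<notin> C"
    and k: "betti \<le> card C + k" "betti + 1 \<le> card (faces M (rot, {})) + k"
  shows "card (faces M (rot, T)) + card (odd_part C T) \<le> card C + 2 * k + 1"
    and "card C + 1 \<le> card (faces M (rot, T)) + card (odd_part C T) + 2 * k"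
proof -
  define C0 where "C0 = {c \<in> C. even (card (T \<inter> c))}"
  define m where "m = card C"
  define m0 where "m0 = card C0"
  define F where "F = card (faces M (rot, T)) - 1"
  define F0 where "F0 = card (faces M (rot, {})) - 1"
  let ?Z = "cycle_space M" and ?R = "face_space M (rot, T)" and ?Rz = "face_space M (rot, {})"
  let ?S = "Sup ` Pow C" and ?Se = "Sup ` Pow C0"
  have Z: "card ?Z = 2 ^ betti" and VE: "betti + card V = card E + 1"
    using card_cycle_space_betti[OF conn] .
  have R: "card ?R = 2 ^ F" and R0: "card ?Rz = 2 ^ F0"
    unfolding F_def F0_def by (rule card_face_space_power[OF conn rot A])+
  have Rsub: "?R \<subseteq> ?Z" "?Rz \<subseteq> ?Z" by (rule face_space_subset_cycle_space[OF rot])+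
  have finC: "finite C" by (rule finite_subset[OF C(1) finite_cycle_space])
  have fin: "finite ?R" "finite ?Rz" by (rule finite_subset[OF Rsub(1) finite_cycle_space],
      rule finite_subset[OF Rsub(2) finite_cycle_space])
  have C_E: "C \<subseteq> Pow E" using C(1) by (auto simp: cycle_space_def)
  have C0: "C0 \<subseteq> C" by (auto simp: C0_def)
  have disj0: "disjoint C0" by (rule pairwise_subset[OF C(2) C0])
  have ne0: "{} \<notin> C0" using C(3) C0 by blast
  have finC0: "finite C0" by (rule finite_subset[OF C0 finC])
  have S: "card ?S = 2 ^ m" and S0: "card ?Se = 2 ^ m0"
    unfolding m_def m0_def by (rule card_Union_Pow_disjoint[OF C(2,3) finC],
        rule card_Union_Pow_disjoint[OF disj0 ne0 finC0])
  have cS: "sym_diff_closed ?S" and cS0: "sym_diff_closed ?Se"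
    by (rule sym_diff_closed_Union_Pow[OF C(2)], rule sym_diff_closed_Union_Pow[OF disj0])
  have SZ: "?S \<subseteq> ?Z"
  proof
    fix s assume "s \<in> ?S"
    then obtain J where J: "J \<subseteq> C" "s = \<Union>J" by blast
    have "finite J" by (rule finite_subset[OF J(1) finC])
    then have "\<Union>J \<in> ?Z" using J(1)
    proof induction
      case (insert c J)
      have "c \<inter> \<Union>J = {}" using insert.prems insert.hyps(2) disjointD[OF C(2), of c] by blast
      then have "\<Union>(insert c J) = sym_diff c (\<Union>J)" by blast
      then show ?case
        using sym_diff_closedD(2)[OF sym_diff_closed_cycle_space, of c "\<Union>J"] insert C(1) by auto
    qed (simp add: sym_diff_closedD(1)[OF sym_diff_closed_cycle_space])
    then show "s \<in> ?Z" using J(2) by simp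
  qed
  have S0S: "?Se \<subseteq> ?S" using C0 by blast
  have odd: "card (odd_part C T) + m0 = m"
  proof -
    have "odd_part C T \<union> C0 = C" "odd_part C T \<inter> C0 = {}"
      by (auto simp: odd_part_def C0_def)
    then show ?thesis
      using card_Un_disjoint[of "odd_part C T" C0] finC finC0
      by (simp add: m_def m0_def odd_part_def)
  qed
  have T_additive: "sym_diff_additive ((\<inter>) T) X" for X
    unfolding sym_diff_additive_def by auto
  have F_pos: "card (faces M (rot, T)) = F + 1" "card (faces M (rot, {})) = F0 + 1"
    using faces_nonempty[OF A rot] by (simp_all add: F_def F0_def Suc_pred')
  note cZ = sym_diff_closed_cycle_space and finZ = finite_cycle_space
    and cR = sym_diff_closed_face_space
  have upper: "F + F0 + m \<le> m0 + 2 * betti"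
  proof -
    have 1: "card ?R * card ?Rz \<le> card (?R \<inter> ?Rz) * card ?Z"
      by (rule card_times_card_le_card_Int_times_card[OF finZ cZ cR Rsub(1) cR Rsub(2)])
    have cRR: "sym_diff_closed (?R \<inter> ?Rz)" by (rule sym_diff_closed_Int[OF cR cR])
    have "card (?R \<inter> ?Rz) * card ?S \<le> card (?R \<inter> ?Rz \<inter> ?S) * card ?Z"
      by (rule card_times_card_le_card_Int_times_card[OF finZ cZ cRR le_infI1[OF Rsub(1)] cS SZ])
    \<comment> \<open>The cut \<open>T \<inter> c\<close> meets each cycle \<open>d\<close> in
      \<open>J\<close> evenly, and on \<open>d\<close> it coincides with \<open>T\<close>; so only
      members met evenly by \<open>T\<close> can occur in \<open>c\<close>.\<close>
    moreover have "?R \<inter> ?Rz \<inter> ?S \<subseteq> ?Se"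
    proof
      fix c assume c: "c \<in> ?R \<inter> ?Rz \<inter> ?S"
      then obtain J where J: "J \<subseteq> C" "c = \<Union>J" by blast
      have "T \<inter> c \<in> cut_space M" using twisted_part_in_cut_space[OF rot, of c T] c by blast
      then obtain U where U: "U \<subseteq> V" "T \<inter> c = cut_edges M U" by (auto simp: cut_space_def)
      have "d \<in> C0" if d: "d \<in> J" for d
      proof -
        have "even (card (cut_edges M U \<inter> d))"
          using even_card_cut_Int_cycle[OF U(1)] d J(1) C(1) by blast
        moreover have "cut_edges M U \<inter> d = T \<inter> d" using d J(2) U(2) by blast
        ultimately show ?thesis using d J(1) by (auto simp: C0_def)
      qed
      then show "c \<in> ?Se" using J(2) by blast
    qed
    then have "card (?R \<inter> ?Rz \<inter> ?S) \<le> 2 ^ m0"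
      unfolding S0[symmetric] using finC0 by (intro card_mono) simp_all
    ultimately have 2: "card (?R \<inter> ?Rz) * card ?S \<le> 2 ^ m0 * card ?Z"
      using mult_le_mono1 order_trans by blast
    have "card ?R * card ?Rz * card ?S \<le> card (?R \<inter> ?Rz) * card ?Z * card ?S"
      using 1 by (rule mult_le_mono1)
    also have "\<dots> = card (?R \<inter> ?Rz) * card ?S * card ?Z" by simp
    also have "\<dots> \<le> 2 ^ m0 * card ?Z * card ?Z" using 2 by (rule mult_le_mono1)
    finally have "(2::nat) ^ (F + F0 + m) \<le> 2 ^ (m0 + betti + betti)"
      unfolding R R0 S Z power_add .
    then have "F + F0 + m \<le> m0 + betti + betti" by (rule power_le_imp_le_exp[rotated]) simp
    then show ?thesis by simp
  qed
  \<comment> \<open>For a sum \<open>c\<close> of members met evenly by \<open>T\<close>, the set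
    \<open>T \<inter> c\<close> is orthogonal to all of \<open>C\<close>, that is, lies in
    \<open>P\<close>. Since \<open>P\<close> has dimension \<open>card E - m\<close> and the cuts in
    it at least \<open>card V - 1\<close>, they have codimension at most \<open>betti - m\<close>.
    Hence a subspace \<open>A2\<close> of at most that codimension in \<open>A1\<close> is sent to
    cuts, and so lies in the twisted radical.\<close>
  have lower: "m0 + F0 + m \<le> F + 2 * betti"
  proof -
    define A1 where "A1 = ?Se \<inter> ?Rz"
    define A2 where "A2 = {c \<in> A1. T \<inter> c \<in> cut_space M}"
    define P where "P = {h \<in> Pow E. odd_part C h = {}}"
    have finA1: "finite A1" unfolding A1_def using fin(2) by simp
    have 1: "card ?Se * card ?Rz \<le> card A1 * card ?Z"
      unfolding A1_def
      by (rule card_times_card_le_card_Int_times_card[OF finZ cZ cS0 subset_trans[OF S0S SZ] cR Rsub(2)])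
    have cP: "sym_diff_closed P"
      unfolding sym_diff_closed_def
    proof (intro conjI ballI)
      show "{} \<in> P" by (simp add: P_def odd_part_def)
      fix g h assume gh: "g \<in> P" "h \<in> P"
      then have "g \<in> Pow E" "h \<in> Pow E" "odd_part C g = {}" "odd_part C h = {}" by (simp_all add: P_def)
      then have "odd_part C (sym_diff g h) = {}" "sym_diff g h \<subseteq> E"
        using sym_diff_additiveD[OF sym_diff_additive_odd_part[OF finite_E], of g h C] by auto
      then show "sym_diff g h \<in> P" by (simp add: P_def)
    qed
    have cut_P: "cut_space M \<subseteq> P"
    proof
      fix h assume "h \<in> cut_space M"
      then obtain U where U: "U \<subseteq> V" "h = cut_edges M U" by (auto simp: cut_space_def)
      have "even (card (h \<inter> c))" if "c \<in> C" for c
        using even_card_cut_Int_cycle[OF U(1)] that C(1) U(2) by blast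
      then show "h \<in> P" using cut_edges_subset U(2) by (simp add: P_def odd_part_def)
    qed
    have TA1: "(\<inter>) T ` A1 \<subseteq> P"
    proof
      fix h assume "h \<in> (\<inter>) T ` A1"
      then obtain J where J: "J \<subseteq> C0" "h = T \<inter> \<Union>J" by (auto simp: A1_def)
      have "even (card (h \<inter> c))" if c: "c \<in> C" for c
      proof (cases "c \<in> J")
        case True
        then have "h \<inter> c = T \<inter> c" using J(2) by blast
        then show ?thesis using True J(1) by (auto simp: C0_def)
      next
        case False
        then have "d \<inter> c = {}" if "d \<in> J" for d
          using disjointD[OF C(2), of d c] that J(1) C0 c by blast
        then have "h \<inter> c = {}" using J(2) by blast
        then show ?thesis by simp
      qed
      then show "h \<in> P" using J(2) T by (auto simp: P_def odd_part_def)
    qed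
    have finP: "finite P" unfolding P_def using finite_E by simp
    have cA1: "sym_diff_closed A1" unfolding A1_def by (rule sym_diff_closed_Int[OF cS0 cR])
    have 2: "card A1 * card (cut_space M) \<le> card A2 * card P"
      unfolding A2_def
      by (rule card_times_card_le_card_preimage_times_card[OF finP finA1 cA1 T_additive TA1
            sym_diff_closed_cut_space cut_P cP])
    have 3: "card P * 2 ^ m = 2 ^ card E"
      unfolding P_def m_def by (rule card_odd_part_fiber[OF finite_E C(2,3) C_E]) simp
    have "A2 \<subseteq> ?R"
      using in_face_space_if_twisted_part_in_cut_space[OF rot] by (auto simp: A2_def A1_def)
    then have 4: "card A2 \<le> 2 ^ F" unfolding R[symmetric] by (rule card_mono[OF fin(1)])
    have "(2::nat) ^ (m0 + F0 + m + card V) = 2 ^ m0 * 2 ^ F0 * 2 ^ m * 2 ^ card V"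
      by (simp add: power_add)
    also have "\<dots> \<le> card A1 * 2 ^ betti * 2 ^ m * (2 * card (cut_space M))"
      using mult_le_mono[OF mult_le_mono1[OF 1[unfolded S0 R0 Z]] card_cut_space_ge[OF conn]] .
    also have "\<dots> = card A1 * card (cut_space M) * (2 ^ betti * 2 ^ m * 2)" by simp
    also have "\<dots> \<le> card A2 * card P * (2 ^ betti * 2 ^ m * 2)" using 2 by (rule mult_le_mono1)
    also have "\<dots> = card A2 * (card P * 2 ^ m) * (2 ^ betti * 2)" by simp
    also have "\<dots> \<le> 2 ^ F * 2 ^ card E * (2 ^ betti * 2)"
      unfolding 3 by (rule mult_le_mono1[OF mult_le_mono1[OF 4]])
    also have "\<dots> = 2 ^ (F + card E + (betti + 1))" by (simp add: power_add)
    finally have "m0 + F0 + m + card V \<le> F + card E + (betti + 1)"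
      by (rule power_le_imp_le_exp[rotated]) simp
    then show ?thesis using VE by simp
  qed
  show "card (faces M (rot, T)) + card (odd_part C T) \<le> card C + 2 * k + 1"
    using upper odd k F_pos unfolding m_def[symmetric] by linarith
  show "card C + 1 \<le> card (faces M (rot, T)) + card (odd_part C T) + 2 * k"
    using lower odd k F_pos unfolding m_def[symmetric] by linarith
qed

end

subsection \<open>Perturbed coin sums\<close>

lemma norm_iexp_diff_le: "norm (iexp x - iexp y) \<le> \<bar>x - y\<bar>"
proof -
  have "iexp x - iexp y = iexp y * (iexp (x - y) - 1)"
    by (simp add: algebra_simps exp_add[symmetric])
  then have "norm (iexp x - iexp y) = norm (iexp (x - y) - 1)"
    by (simp add: norm_mult)
  also have "\<dots> \<le> \<bar>x - y\<bar>" using iexp_approx1[of "x - y" 0] by simp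
  finally show ?thesis .
qed

lemma sum_Pow_insert:
  fixes h :: "'a set \<Rightarrow> 'b::comm_monoid_add"
  assumes "finite C" "x \<notin> C"
  shows "(\<Sum>J\<in>Pow (insert x C). h J) = (\<Sum>J\<in>Pow C. h J) + (\<Sum>J\<in>Pow C. h (insert x J))"
proof -
  have "inj_on (insert x) (Pow C)" using assms(2) by (auto simp: inj_on_def)
  moreover have "Pow C \<inter> insert x ` Pow C = {}" using assms(2) by auto
  ultimately show ?thesis
    using assms(1) by (simp add: Pow_insert sum.union_disjoint sum.reindex)
qed

text \<open>A sum of \<open>card C\<close> signs, positive for the members of \<open>J\<close> and
  negative for the others; for uniform \<open>J\<close> it has mean 0 and variance
  \<open>card C\<close>.\<close>

definition coin_sum :: "'a set \<Rightarrow> 'a set \<Rightarrow> real" where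
  "coin_sum C J = 2 * real (card J) - real (card C)"

lemma sum_coin_sum_insert:
  fixes h :: "real \<Rightarrow> 'b::comm_monoid_add"
  assumes "finite C" "x \<notin> C"
  shows "(\<Sum>J\<in>Pow (insert x C). h (coin_sum (insert x C) J)) =
    (\<Sum>J\<in>Pow C. h (coin_sum C J - 1)) + (\<Sum>J\<in>Pow C. h (coin_sum C J + 1))"
proof -
  have 1: "coin_sum (insert x C) J = coin_sum C J - 1" for J
    using assms by (simp add: coin_sum_def)
  have 2: "coin_sum (insert x C) (insert x J) = coin_sum C J + 1" if "J \<in> Pow C" for J
  proof -
    have "finite J" "x \<notin> J" using that assms finite_subset[of J C] by auto
    then show ?thesis using assms by (simp add: coin_sum_def)
  qed
  have "(\<Sum>J\<in>Pow C. h (coin_sum (insert x C) (insert x J))) = (\<Sum>J\<in>Pow C. h (coin_sum C J + 1))"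
    by (rule sum.cong) (simp_all add: 2)
  then show ?thesis
    unfolding sum_Pow_insert[OF assms] by (simp add: 1)
qed

lemma sum_coin_sum: "finite C \<Longrightarrow> (\<Sum>J\<in>Pow C. coin_sum C J) = 0"
proof (induction rule: finite_induct)
  case (insert x C)
  then show ?case using sum_coin_sum_insert[OF insert.hyps, of "\<lambda>y. y"]
    by (simp add: sum.distrib sum_subtractf)
qed (simp add: coin_sum_def)

lemma sum_coin_sum_square:
  "finite C \<Longrightarrow> (\<Sum>J\<in>Pow C. (coin_sum C J)\<^sup>2) = real (card C) * 2 ^ card C"
proof (induction rule: finite_induct)
  case (insert x C)
  have "(\<Sum>J\<in>Pow (insert x C). (coin_sum (insert x C) J)\<^sup>2) =
      (\<Sum>J\<in>Pow C. (coin_sum C J - 1)\<^sup>2 + (coin_sum C J + 1)\<^sup>2)"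
    using sum_coin_sum_insert[OF insert.hyps, of "\<lambda>y. y\<^sup>2"] by (simp add: sum.distrib)
  also have "\<dots> = (\<Sum>J\<in>Pow C. 2 * (coin_sum C J)\<^sup>2 + 2)"
    by (rule sum.cong) (simp_all add: power2_eq_square algebra_simps)
  also have "\<dots> = 2 * (real (card C) * 2 ^ card C) + 2 * 2 ^ card C"
    using insert.IH insert.hyps by (simp add: sum.distrib sum_distrib_left[symmetric] card_Pow)
  finally show ?case using insert.hyps by (simp add: algebra_simps)
qed (simp add: coin_sum_def)

text \<open>Independence of the signs in elementary form: each contributes the factor
  \<open>iexp s + iexp (- s)\<close>, which is twice the cosine.\<close>

lemma sum_coin_sum_iexp:
  "finite C \<Longrightarrow> (\<Sum>J\<in>Pow C. iexp (s * coin_sum C J)) = (2 * complex_of_real (cos s)) ^ card C"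
proof (induction rule: finite_induct)
  case (insert x C)
  have two_cos: "iexp (s * (y - 1)) + iexp (s * (y + 1)) = 2 * complex_of_real (cos s) * iexp (s * y)" for y
  proof -
    have "iexp (s * (y - 1)) = iexp (s * y) * iexp (- s)" "iexp (s * (y + 1)) = iexp (s * y) * iexp s"
      by (simp_all add: exp_add[symmetric] algebra_simps)
    moreover have "iexp (- s) + iexp s = 2 * complex_of_real (cos s)"
      by (simp add: complex_eq_iff Re_exp Im_exp)
    ultimately show ?thesis by (metis (no_types, lifting) distrib_left mult.commute)
  qed
  have "(\<Sum>J\<in>Pow (insert x C). iexp (s * coin_sum (insert x C) J)) =
      (\<Sum>J\<in>Pow C. iexp (s * (coin_sum C J - 1)) + iexp (s * (coin_sum C J + 1)))"
    using sum_coin_sum_insert[OF insert.hyps, of "\<lambda>y. iexp (s * y)"] by (simp only: sum.distrib)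
  also have "\<dots> = 2 * complex_of_real (cos s) * (\<Sum>J\<in>Pow C. iexp (s * coin_sum C J))"
    unfolding two_cos sum_distrib_left ..
  finally show ?case using insert.IH insert.hyps by simp
qed (simp add: coin_sum_def)

lemma cos_power_tendsto:
  "(\<lambda>n::nat. cos (t / sqrt (real n)) ^ n) \<longlonglongrightarrow> exp (- (t\<^sup>2) / 2)"
proof -
  have "(\<lambda>n::nat. cos (t / sqrt (real n)) ^ n) \<longlonglongrightarrow> exp (- (t * t / 2))" by real_asymp
  then show ?thesis by (simp add: power2_eq_square)
qed

text \<open>Here \<open>s\<close> is the standard deviation of the binomial distribution and
  \<open>W\<close> below its standardisation. After centring, \<open>X\<close> is
  \<open>s * W\<close> plus an error of at most \<open>2 * K\<close>, which is negligible against
  \<open>s\<close> once \<open>card C\<close> is large.\<close>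

lemma standardised_coin_sum_char:
  fixes Q :: "'a pmf" and f :: "'a \<Rightarrow> 'c set" and X :: "'a \<Rightarrow> real"
  assumes fin: "finite (set_pmf Q)" and C: "finite C" "card C > 0"
    and f: "map_pmf f Q = pmf_of_set (Pow C)"
    and K: "\<And>x. x \<in> set_pmf Q \<Longrightarrow> \<bar>X x - (b + real (card (f x)))\<bar> \<le> K"
  defines "s \<equiv> sqrt (real (card C)) / 2" and "v \<equiv> measure_pmf.variance Q X"
  shows "\<bar>v - s\<^sup>2\<bar> \<le> 4 * K * s + 4 * K\<^sup>2"
    and "v > 0 \<Longrightarrow> norm ((CLINT x|Q. iexp (t * ((X x - measure_pmf.expectation Q X) / sqrt v))) -
        complex_of_real (cos (t / sqrt (real (card C))) ^ card C))
      \<le> \<bar>t\<bar> * (\<bar>s / sqrt v - 1\<bar> + 2 * K / sqrt v)"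
proof -
  define m where "m = card C"
  have m: "m > 0" using C(2) by (simp add: m_def)
  have s: "s > 0" "s = sqrt (real m) / 2" "sqrt (real m) > 0" using m by (simp_all add: s_def m_def)
  define W where "W x = coin_sum C (f x) / sqrt (real m)" for x
  have int: "integrable (measure_pmf Q) g" for g :: "'a \<Rightarrow> real"
    by (rule integrable_measure_pmf_finite[OF fin])
  have intc: "integrable (measure_pmf Q) g" for g :: "'a \<Rightarrow> complex"
    by (rule integrable_measure_pmf_finite[OF fin])
  have finP: "finite (Pow C)" "Pow C \<noteq> {}" using C(1) by auto
  have E_f: "measure_pmf.expectation Q (\<lambda>x. h (f x)) = (\<Sum>J\<in>Pow C. h J) / 2 ^ m" for h :: "'c set \<Rightarrow> real"
  proof -
    have "measure_pmf.expectation Q (\<lambda>x. h (f x)) = measure_pmf.expectation (map_pmf f Q) h" by simp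
    also have "\<dots> = (\<Sum>J\<in>Pow C. h J) / 2 ^ m"
      unfolding f integral_pmf_of_set[OF finP(2,1)] by (simp add: card_Pow C(1) m_def)
    finally show ?thesis .
  qed
  have E_fc: "(CLINT x|Q. h (f x)) = (\<Sum>J\<in>Pow C. h J) / 2 ^ m" for h :: "'c set \<Rightarrow> complex"
  proof -
    have "(CLINT x|Q. h (f x)) = (CLINT J|map_pmf f Q. h J)" by simp
    also have "\<dots> = (\<Sum>J\<in>Pow C. pmf (pmf_of_set (Pow C)) J *\<^sub>R h J)"
      unfolding f by (rule integral_measure_pmf[OF finP(1)]) (simp add: set_pmf_of_set[OF finP(2,1)])
    also have "\<dots> = (\<Sum>J\<in>Pow C. h J / 2 ^ m)"
      using finP C(1) by (intro sum.cong) (simp_all add: card_Pow m_def scaleR_conv_of_real)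
    finally show ?thesis by (simp add: sum_divide_distrib)
  qed
  have E_W: "measure_pmf.expectation Q W = 0"
    using E_f[of "\<lambda>J. coin_sum C J / sqrt (real m)"] sum_coin_sum[OF C(1)]
    by (simp add: W_def[abs_def] sum_divide_distrib[symmetric])
  have E_W2: "measure_pmf.expectation Q (\<lambda>x. (W x)\<^sup>2) = 1"
    using E_f[of "\<lambda>J. (coin_sum C J / sqrt (real m))\<^sup>2"] sum_coin_sum_square[OF C(1)] m
    by (simp add: W_def[abs_def] power_divide sum_divide_distrib[symmetric] m_def)
  have E_iexp: "(CLINT x|Q. iexp (t * W x)) = complex_of_real (cos (t / sqrt (real m)) ^ m)"
  proof -
    have "(CLINT x|Q. iexp (t * W x)) = (\<Sum>J\<in>Pow C. iexp (t / sqrt (real m) * coin_sum C J)) / 2 ^ m"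
      using E_fc[of "\<lambda>J. iexp (t / sqrt (real m) * coin_sum C J)"] by (simp add: W_def)
    then show ?thesis
      unfolding sum_coin_sum_iexp[OF C(1)] m_def[symmetric] by (simp add: power_mult_distrib)
  qed
  have E_absW: "measure_pmf.expectation Q (\<lambda>x. \<bar>W x\<bar>) \<le> 1"
  proof -
    have "\<bar>w\<bar> \<le> (1 + w\<^sup>2) / 2" for w :: real
      using zero_le_power2[of "\<bar>w\<bar> - 1"] by (simp add: power2_diff)
    then have "measure_pmf.expectation Q (\<lambda>x. \<bar>W x\<bar>) \<le> measure_pmf.expectation Q (\<lambda>x. (1 + (W x)\<^sup>2) / 2)"
      by (intro integral_mono int)
    also have "\<dots> = 1" using E_W2 int by simp
    finally show ?thesis .
  qed
  define r where "r x = X x - (b + real (card (f x)))" for x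
  have r: "\<bar>r x\<bar> \<le> K" if "x \<in> set_pmf Q" for x using K[OF that] by (simp add: r_def)
  obtain x0 where "x0 \<in> set_pmf Q" using set_pmf_not_empty[of Q] by fast
  then have K0: "K \<ge> 0" using r[of x0] by linarith
  have "real m = sqrt (real m) * sqrt (real m)" by simp
  then have X: "X x = (b + real m / 2) + s * W x + r x" for x
    using s(3) by (simp add: r_def W_def coin_sum_def s(2) m_def[symmetric] field_simps)
  define \<mu> where "\<mu> = measure_pmf.expectation Q X"
  define \<rho> where "\<rho> = measure_pmf.expectation Q r"
  have \<mu>: "\<mu> = (b + real m / 2) + \<rho>"
    unfolding \<mu>_def \<rho>_def X using E_W int by simp
  have \<rho>: "\<bar>\<rho>\<bar> \<le> K"
  proof -
    have "\<bar>\<rho>\<bar> \<le> measure_pmf.expectation Q (\<lambda>x. \<bar>r x\<bar>)"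
      unfolding \<rho>_def by (rule integral_abs_bound)
    also have "\<dots> \<le> measure_pmf.expectation Q (\<lambda>x. K)"
      by (intro integral_mono_AE int AE_pmfI r)
    finally show ?thesis by simp
  qed
  define u where "u x = r x - \<rho>" for x
  have u: "\<bar>u x\<bar> \<le> 2 * K" if "x \<in> set_pmf Q" for x
    using r[OF that] \<rho> by (simp add: u_def)
  have Xu: "X x - \<mu> = s * W x + u x" for x by (simp add: X \<mu> u_def)
  have v: "v = s\<^sup>2 + measure_pmf.expectation Q (\<lambda>x. 2 * s * (W x * u x) + (u x)\<^sup>2)"
  proof -
    have "v = measure_pmf.expectation Q (\<lambda>x. s\<^sup>2 * (W x)\<^sup>2 + (2 * s * (W x * u x) + (u x)\<^sup>2))"
      unfolding v_def \<mu>_def[symmetric] Xu by (simp add: power2_sum algebra_simps)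
    also have "\<dots> = s\<^sup>2 * measure_pmf.expectation Q (\<lambda>x. (W x)\<^sup>2) +
        measure_pmf.expectation Q (\<lambda>x. 2 * s * (W x * u x) + (u x)\<^sup>2)"
      using int by simp
    finally show ?thesis by (simp add: E_W2)
  qed
  \<comment> \<open>The constants come from \<open>\<bar>u x\<bar> \<le> 2 * K\<close>: the cross
    term yields \<open>4 * K * s\<close>, because the mean of \<open>\<bar>W\<bar>\<close> is at
    most 1, and the square yields \<open>4 * K\<^sup>2\<close>.\<close>
  have "\<bar>v - s\<^sup>2\<bar> \<le> measure_pmf.expectation Q (\<lambda>x. \<bar>2 * s * (W x * u x) + (u x)\<^sup>2\<bar>)"
    unfolding v using integral_abs_bound[of "measure_pmf Q" "\<lambda>x. 2 * s * (W x * u x) + (u x)\<^sup>2"] by simp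
  also have "\<dots> \<le> measure_pmf.expectation Q (\<lambda>x. 4 * K * s * \<bar>W x\<bar> + 4 * K\<^sup>2)"
  proof (intro integral_mono_AE int AE_pmfI)
    fix x assume x: "x \<in> set_pmf Q"
    have "\<bar>2 * s * (W x * u x) + (u x)\<^sup>2\<bar> \<le> 2 * s * (\<bar>W x\<bar> * \<bar>u x\<bar>) + \<bar>u x\<bar>\<^sup>2"
      using s(1) abs_triangle_ineq[of "2 * s * (W x * u x)" "(u x)\<^sup>2"] by (simp add: abs_mult)
    also have "\<dots> \<le> 2 * s * (\<bar>W x\<bar> * (2 * K)) + (2 * K)\<^sup>2"
      using u[OF x] s(1) by (intro add_mono mult_left_mono power_mono) auto
    finally show "\<bar>2 * s * (W x * u x) + (u x)\<^sup>2\<bar> \<le> 4 * K * s * \<bar>W x\<bar> + 4 * K\<^sup>2"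
      by (simp add: power_mult_distrib mult_ac)
  qed
  also have "\<dots> = 4 * K * s * measure_pmf.expectation Q (\<lambda>x. \<bar>W x\<bar>) + 4 * K\<^sup>2"
    using int by simp
  also have "\<dots> \<le> 4 * K * s * 1 + 4 * K\<^sup>2"
    using E_absW K0 s(1) by (intro add_mono mult_left_mono) auto
  finally show "\<bar>v - s\<^sup>2\<bar> \<le> 4 * K * s + 4 * K\<^sup>2" by simp
  assume v0: "v > 0"
  then have sv: "sqrt v > 0" by simp
  let ?Y = "\<lambda>x. (X x - \<mu>) / sqrt v"
  have "norm ((CLINT x|Q. iexp (t * ?Y x)) - (CLINT x|Q. iexp (t * W x))) =
      norm (CLINT x|Q. iexp (t * ?Y x) - iexp (t * W x))"
    by (subst Bochner_Integration.integral_diff[OF intc intc]) simp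
  also have "\<dots> \<le> measure_pmf.expectation Q (\<lambda>x. norm (iexp (t * ?Y x) - iexp (t * W x)))"
    by (rule integral_norm_bound)
  also have "\<dots> \<le> measure_pmf.expectation Q (\<lambda>x. \<bar>t\<bar> * (\<bar>s / sqrt v - 1\<bar> * \<bar>W x\<bar> + 2 * K / sqrt v))"
  proof (intro integral_mono_AE int AE_pmfI)
    fix x assume x: "x \<in> set_pmf Q"
    have "?Y x - W x = (s / sqrt v - 1) * W x + u x / sqrt v"
      unfolding Xu using sv by (simp add: field_simps)
    then have "\<bar>?Y x - W x\<bar> \<le> \<bar>s / sqrt v - 1\<bar> * \<bar>W x\<bar> + \<bar>u x\<bar> / sqrt v"
      using abs_triangle_ineq[of "(s / sqrt v - 1) * W x" "u x / sqrt v"] sv by (simp add: abs_mult)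
    also have "\<dots> \<le> \<bar>s / sqrt v - 1\<bar> * \<bar>W x\<bar> + 2 * K / sqrt v"
      using u[OF x] sv by (intro add_left_mono divide_right_mono) auto
    finally have *: "\<bar>?Y x - W x\<bar> \<le> \<bar>s / sqrt v - 1\<bar> * \<bar>W x\<bar> + 2 * K / sqrt v" .
    have "norm (iexp (t * ?Y x) - iexp (t * W x)) \<le> \<bar>t * ?Y x - t * W x\<bar>" by (rule norm_iexp_diff_le)
    also have "\<dots> = \<bar>t\<bar> * \<bar>?Y x - W x\<bar>" unfolding abs_mult[symmetric] by (simp only: right_diff_distrib)
    also have "\<dots> \<le> \<bar>t\<bar> * (\<bar>s / sqrt v - 1\<bar> * \<bar>W x\<bar> + 2 * K / sqrt v)" using * by (rule mult_left_mono) simp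
    finally show "norm (iexp (t * ?Y x) - iexp (t * W x)) \<le>
        \<bar>t\<bar> * (\<bar>s / sqrt v - 1\<bar> * \<bar>W x\<bar> + 2 * K / sqrt v)" .
  qed
  also have "\<dots> = \<bar>t\<bar> * (\<bar>s / sqrt v - 1\<bar> * measure_pmf.expectation Q (\<lambda>x. \<bar>W x\<bar>) + 2 * K / sqrt v)"
    using int by simp
  also have "\<dots> \<le> \<bar>t\<bar> * (\<bar>s / sqrt v - 1\<bar> * 1 + 2 * K / sqrt v)"
    using E_absW by (intro mult_left_mono add_right_mono) auto
  finally show "norm ((CLINT x|Q. iexp (t * ((X x - measure_pmf.expectation Q X) / sqrt v))) -
        complex_of_real (cos (t / sqrt (real (card C))) ^ card C))
      \<le> \<bar>t\<bar> * (\<bar>s / sqrt v - 1\<bar> + 2 * K / sqrt v)"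
    unfolding E_iexp \<mu>_def m_def by simp
qed

text \<open>The coins are functions on \<open>Q n\<close>, while \<open>X n\<close> is defined on
  its image \<open>P n\<close>; in the application these are the signed rotation systems and their
  classes. The variance differs from \<open>s\<^sup>2\<close> by order \<open>s\<close> only, so
  standardising with the true mean and variance has the same limit as standardising the
  coins.\<close>

lemma asymptotically_normal_coin_sums:
  fixes P :: "nat \<Rightarrow> 'b pmf" and Q :: "nat \<Rightarrow> 'a pmf" and g :: "nat \<Rightarrow> 'a \<Rightarrow> 'b"
    and f :: "nat \<Rightarrow> 'a \<Rightarrow> 'c set" and C :: "nat \<Rightarrow> 'c set" and X :: "nat \<Rightarrow> 'b \<Rightarrow> real"
  assumes C: "filterlim (\<lambda>n. card (C n)) at_top sequentially"
    and ev: "\<forall>\<^sub>F n in sequentially. finite (set_pmf (Q n)) \<and> P n = map_pmf (g n) (Q n) \<and>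
      map_pmf (f n) (Q n) = pmf_of_set (Pow (C n)) \<and>
      (\<forall>x\<in>set_pmf (Q n). \<bar>X n (g n x) - (b n + real (card (f n x)))\<bar> \<le> K)"
  shows "asymptotically_normal (\<lambda>n. measure_pmf (P n)) X"
  unfolding asymptotically_normal_def
proof (rule levy_continuity)
  let ?D = "\<lambda>n. distr (measure_pmf (P n)) borel (\<lambda>\<omega>. (X n \<omega> - measure_pmf.expectation (P n) (X n)) /
      sqrt (measure_pmf.variance (P n) (X n)))"
  show "real_distribution (?D n)" for n
    using prob_space.real_distribution_distr[OF prob_space_measure_pmf] by simp
  show "real_distribution std_normal_distribution" by (rule real_dist_normal_dist)
  fix t
  define m where "m n = card (C n)" for n
  define s where "s n = sqrt (real (m n)) / 2" for n
  define v where "v n = measure_pmf.variance (Q n) (\<lambda>x. X n (g n x))" for n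
  have m_lim: "filterlim (\<lambda>n. real (m n)) at_top sequentially"
    unfolding m_def using C by (rule filterlim_compose[OF filterlim_real_sequentially])
  have s_lim: "filterlim s at_top sequentially"
  proof -
    have "filterlim (\<lambda>x::real. sqrt x / 2) at_top at_top" by real_asymp
    from filterlim_compose[OF this m_lim] show ?thesis by (simp add: s_def[abs_def])
  qed
  have m_pos: "\<forall>\<^sub>F n in sequentially. m n > 0"
  proof -
    have "\<forall>\<^sub>F n in sequentially. real (m n) > 0"
      using m_lim unfolding filterlim_at_top_dense by blast
    then show ?thesis by simp
  qed
  have good: "\<forall>\<^sub>F n in sequentially. \<bar>v n - (s n)\<^sup>2\<bar> \<le> 4 * K * s n + 4 * K\<^sup>2 \<and>
      (v n > 0 \<longrightarrow> norm (char (?D n) t - complex_of_real (cos (t / sqrt (real (m n))) ^ m n))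
        \<le> \<bar>t\<bar> * (\<bar>s n / sqrt (v n) - 1\<bar> + 2 * K / sqrt (v n)))"
    using ev m_pos
  proof eventually_elim
    case (elim n)
    then have P: "P n = map_pmf (g n) (Q n)" and fin: "finite (set_pmf (Q n))" by auto
    \<comment> \<open>Infinite sets have cardinality 0, so finiteness comes with positivity.\<close>
    have C: "finite (C n)" "card (C n) > 0" using elim(2) by (auto simp: m_def card_gt_0_iff)
    note lem = standardised_coin_sum_char[OF fin C, of "f n" "\<lambda>x. X n (g n x)" "b n" K]
    have "char (?D n) t = (CLINT x|Q n. iexp (t * ((X n (g n x) -
        measure_pmf.expectation (Q n) (\<lambda>x. X n (g n x))) / sqrt (v n))))"
      unfolding char_def P v_def by (subst integral_distr) (simp_all add: P)
    then show ?case using lem elim unfolding v_def s_def m_def by simp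
  qed
  have lims: "(\<lambda>n. \<bar>s n / sqrt (v n) - 1\<bar>) \<longlonglongrightarrow> 0" "(\<lambda>n. 2 * K / sqrt (v n)) \<longlonglongrightarrow> 0"
    and v_pos: "\<forall>\<^sub>F n in sequentially. v n > 0"
  proof -
    have s_pos: "\<forall>\<^sub>F n in sequentially. s n > 0"
      using s_lim unfolding filterlim_at_top_dense by blast
    have K_lim: "(\<lambda>n. (4 * K * s n + 4 * K\<^sup>2) / (s n)\<^sup>2) \<longlonglongrightarrow> 0"
    proof -
      have "((\<lambda>x::real. (4 * K * x + 4 * K\<^sup>2) / x\<^sup>2) \<longlongrightarrow> 0) at_top" by real_asymp
      from filterlim_compose[OF this s_lim] show ?thesis .
    qed
    have "(\<lambda>n. v n / (s n)\<^sup>2 - 1) \<longlonglongrightarrow> 0"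
    proof (rule Lim_null_comparison[OF _ K_lim])
      show "\<forall>\<^sub>F n in sequentially. norm (v n / (s n)\<^sup>2 - 1) \<le> (4 * K * s n + 4 * K\<^sup>2) / (s n)\<^sup>2"
        using good s_pos
      proof eventually_elim
        case (elim n)
        have "v n / (s n)\<^sup>2 - 1 = (v n - (s n)\<^sup>2) / (s n)\<^sup>2"
          using elim(2) by (simp add: diff_divide_distrib)
        then have "norm (v n / (s n)\<^sup>2 - 1) = \<bar>v n - (s n)\<^sup>2\<bar> / (s n)\<^sup>2" by simp
        also have "\<dots> \<le> (4 * K * s n + 4 * K\<^sup>2) / (s n)\<^sup>2"
          using elim(1) by (intro divide_right_mono) auto
        finally show ?case .
      qed
    qed
    then have ratio: "(\<lambda>n. v n / (s n)\<^sup>2) \<longlonglongrightarrow> 1" by (rule LIM_zero_cancel)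
    then have "\<forall>\<^sub>F n in sequentially. v n / (s n)\<^sup>2 > 0" by (rule order_tendstoD) simp
    then show v_pos: "\<forall>\<^sub>F n in sequentially. v n > 0"
      using s_pos by eventually_elim (simp add: zero_less_divide_iff)
    have "(\<lambda>n. 1 / sqrt (v n / (s n)\<^sup>2)) \<longlonglongrightarrow> 1 / sqrt 1"
      by (intro tendsto_intros ratio) simp
    moreover have "\<forall>\<^sub>F n in sequentially. 1 / sqrt (v n / (s n)\<^sup>2) = s n / sqrt (v n)"
      using s_pos by eventually_elim (simp add: real_sqrt_divide)
    ultimately have sv: "(\<lambda>n. s n / sqrt (v n)) \<longlonglongrightarrow> 1"
      by (simp add: tendsto_cong)
    then have "(\<lambda>n. \<bar>s n / sqrt (v n) - 1\<bar>) \<longlonglongrightarrow> \<bar>1 - 1\<bar>" by (intro tendsto_intros)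
    then show "(\<lambda>n. \<bar>s n / sqrt (v n) - 1\<bar>) \<longlonglongrightarrow> 0" by simp
    have "(\<lambda>n. 2 * K / s n) \<longlonglongrightarrow> 0"
      by (rule tendsto_divide_0[OF tendsto_const]) (rule filterlim_at_top_imp_at_infinity[OF s_lim])
    from tendsto_mult[OF this sv] have "(\<lambda>n. 2 * K / s n * (s n / sqrt (v n))) \<longlonglongrightarrow> 0" by simp
    moreover have "\<forall>\<^sub>F n in sequentially. 2 * K / s n * (s n / sqrt (v n)) = 2 * K / sqrt (v n)"
      using s_pos by eventually_elim simp
    ultimately show "(\<lambda>n. 2 * K / sqrt (v n)) \<longlonglongrightarrow> 0"
      by (rule Lim_transform_eventually)
  qed
  have bound: "(\<lambda>n. \<bar>t\<bar> * (\<bar>s n / sqrt (v n) - 1\<bar> + 2 * K / sqrt (v n))) \<longlonglongrightarrow> 0"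
    using tendsto_mult[OF tendsto_const[of "\<bar>t\<bar>"] tendsto_add[OF lims]] by simp
  have diff: "(\<lambda>n. char (?D n) t - complex_of_real (cos (t / sqrt (real (m n))) ^ m n)) \<longlonglongrightarrow> 0"
    by (rule Lim_null_comparison[OF _ bound]) (use good v_pos in eventually_elim, simp)
  have lim: "(\<lambda>n. complex_of_real (cos (t / sqrt (real (m n))) ^ m n)) \<longlonglongrightarrow>
      complex_of_real (exp (- (t\<^sup>2) / 2))"
    by (rule tendsto_of_real[OF filterlim_compose[OF cos_power_tendsto C[folded m_def]]])
  have "(\<lambda>n. char (?D n) t) \<longlonglongrightarrow> complex_of_real (exp (- (t\<^sup>2) / 2))"
    using tendsto_add[OF diff lim] by simp
  then show "(\<lambda>n. char (?D n) t) \<longlonglongrightarrow> char std_normal_distribution t"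
    by (simp add: char_std_normal_distribution)
qed

subsection \<open>Growth of the Betti number\<close>

text \<open>
  The intermediate graphs of a homeomorphism are not assumed to be finite, and \<^const>\<open>card\<close> is \<open>0\<close> on
  infinite sets.
\<close>

definition homeomorphism_invariant :: "('v, 'e) multigraph \<Rightarrow> bool \<times> int option" where
  "homeomorphism_invariant M = (verts (fst M) = {},
     if finite (verts (fst M)) \<and> finite (arcs (fst M))
     then Some (int (card (arcs (fst M))) - 2 * int (card (verts (fst M)))) else None)"

lemma homeomorphism_invariant_iso:
  assumes "multigraph_iso M N"
  shows "homeomorphism_invariant M = homeomorphism_invariant N"
proof -
  obtain f where f: "pre_digraph.digraph_isomorphism (fst M) f" "fst N = app_iso f (fst M)"
    using assms by (auto simp: multigraph_iso_def)
  have inj: "inj_on (iso_verts f) (verts (fst M))" "inj_on (iso_arcs f) (arcs (fst M))"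
    using f(1) by (auto simp: pre_digraph.digraph_isomorphism_def)
  show ?thesis
    unfolding homeomorphism_invariant_def f(2)
    by (simp add: card_image[OF inj(1)] card_image[OF inj(2)] finite_image_iff[OF inj(1)]
        finite_image_iff[OF inj(2)])
qed

text \<open>Subdividing replaces two arcs by four and adds one vertex, which balances in the
  difference.\<close>

lemma homeomorphism_invariant_subdivision_step:
  assumes "subdivision_step (fst M) (snd M) (fst N) (snd N) (u, v, w) (uv, uw, vw)"
  shows "homeomorphism_invariant M = homeomorphism_invariant N"
proof -
  interpret subdiv_step "fst M" "snd M" "fst N" "snd N" u v w uv uw vw
    using assms(1) by unfold_locales
  let ?new = "{uw, snd N uw, vw, snd N vw}" and ?old = "{uv, snd M uv}"
  \<comment> \<open>Both graphs share their tail and head functions, and each new arc has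
    \<open>w\<close> as an end, which is not a vertex of the old graph.\<close>
  have new: "?new \<inter> arcs (fst M) = {}"
  proof -
    have H: "uw \<in> arcs (fst N)" "vw \<in> arcs (fst N)" using in_arcs_H by auto
    have w: "head (fst M) uw = w" "head (fst M) vw = w"
      using subdiv_ends by (simp_all add: head_eq[symmetric])
    have w': "tail (fst M) (snd N uw) = w" "tail (fst M) (snd N vw) = w"
      using H.tail_arev[OF H(1)] H.tail_arev[OF H(2)] subdiv_ends by (simp_all add: tail_eq[symmetric])
    have "a \<notin> arcs (fst M)" if a: "a \<in> ?new" for a
    proof
      assume "a \<in> arcs (fst M)"
      then have "head (fst M) a \<in> verts (fst M)" "tail (fst M) a \<in> verts (fst M)" by simp_all
      then show False using a w w' not_in_verts_G by auto
    qed
    then show ?thesis by blast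
  qed
  have arcs: "arcs (fst N) = (arcs (fst M) - ?old) \<union> ?new"
  proof -
    have "?old \<inter> ?new = {}" using new in_arcs_G by blast
    then show ?thesis using arcs_H by blast
  qed
  have fin: "finite (verts (fst N)) \<longleftrightarrow> finite (verts (fst M))"
    "finite (arcs (fst N)) \<longleftrightarrow> finite (arcs (fst M))"
    using verts_H arcs by simp_all
  have cards: "int (card (arcs (fst N))) - 2 * int (card (verts (fst N))) =
      int (card (arcs (fst M))) - 2 * int (card (verts (fst M)))"
    if f: "finite (verts (fst M))" "finite (arcs (fst M))"
  proof -
    have "distinct [uw, snd N uw, vw, snd N vw]" using assms(1) by (simp add: subdivision_step_def)
    then have "card ?new = 4" by auto
    moreover have "snd M uv \<noteq> uv" using G.arev_neq[of uv] in_arcs_G by simp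
    then have old: "card ?old = 2" by simp
    have "card ?old \<le> card (arcs (fst M))" using in_arcs_G f(2) by (intro card_mono) auto
    moreover have "card (arcs (fst M) - ?old) = card (arcs (fst M)) - 2"
      using card_Diff_subset[of ?old "arcs (fst M)"] in_arcs_G old by simp
    moreover have "card (arcs (fst N)) = card (arcs (fst M) - ?old) + card ?new"
      unfolding arcs using f(2) new by (intro card_Un_disjoint) auto
    moreover have "card (verts (fst N)) = card (verts (fst M)) + 1"
      using verts_H not_in_verts_G f(1) by simp
    ultimately show ?thesis using old by linarith
  qed
  have "uv \<in> arcs (fst M)" using in_arcs_G by simp
  then have "tail (fst M) uv \<in> verts (fst M)" by (rule G.tail_in_verts)
  then have "verts (fst M) \<noteq> {}" by blast
  then show ?thesis
    using fin cards verts_H by (simp add: homeomorphism_invariant_def)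
qed

lemma homeomorphism_invariant_subdivision:
  "subdivision M N \<Longrightarrow> homeomorphism_invariant M = homeomorphism_invariant N"
proof (induction rule: subdivision.induct)
  case (divide I H u v w uv uw vw)
  then show ?case using homeomorphism_invariant_subdivision_step[OF divide.hyps(2)] by simp
qed simp

lemma homeomorphism_invariant_homeomorphic:
  assumes "homeomorphic_graphs M N"
  shows "homeomorphism_invariant M = homeomorphism_invariant N"
  using assms unfolding homeomorphic_graphs_def
proof (induction rule: equivclp_induct)
  case (step Y Z)
  have inv: "homeomorphism_invariant K = homeomorphism_invariant L"
    if "multigraph_iso K L \<or> subdivision K L" for K L :: "('a, 'b) multigraph"
    using that homeomorphism_invariant_iso homeomorphism_invariant_subdivision by blast
  from step(2) have "homeomorphism_invariant Y = homeomorphism_invariant Z"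
  proof
    assume "multigraph_iso Z Y \<or> subdivision Z Y"
    from inv[OF this] show ?thesis by (rule sym)
  qed (rule inv)
  then show ?case using step.IH by simp
qed simp

context finite_multigraph
begin

section \<open>The Betti number of a proper subgraph\<close>

lemma undirected_edge_submultigraph:
  "submultigraph H M \<Longrightarrow> a \<in> arcs (fst H) \<Longrightarrow> undirected_edge H a = ue a"
  by (simp add: undirected_edge_def submultigraph_def)

lemma ue_in_edges_submultigraph:
  assumes H: "submultigraph H M" and "ue a \<in> edges H"
  shows "a \<in> arcs (fst H)"
proof -
  have b: "bidirected_digraph (fst H) (snd H)" and eq: "\<forall>a\<in>arcs (fst H). snd H a = rv a"
    using H by (simp_all add: submultigraph_def)
  obtain x where x: "x \<in> arcs (fst H)" "undirected_edge H x = ue a"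
    using assms(2) by (auto simp: edges_def)
  then have "a = x \<or> a = rv x"
    using undirected_edge_submultigraph[OF H x(1)] ue_eq_iff[of x a] by simp
  moreover have "rv x \<in> arcs (fst H)"
    using bidirected_digraph.arev_in_arcs[OF b x(1)] eq x(1) by simp
  ultimately show ?thesis using x(1) by blast
qed

lemma cycle_space_submultigraph:
  assumes H: "submultigraph H M"
  shows "cycle_space H \<subseteq> cycle_space M"
proof
  fix c assume c: "c \<in> cycle_space H"
  then have cH: "c \<subseteq> edges H" by (simp add: cycle_space_def)
  have sub: "verts (fst H) \<subseteq> V" "arcs (fst H) \<subseteq> A" "wf_digraph (fst H)" "tail (fst H) = ta"
    using H by (simp_all add: submultigraph_def subgraph_def compatible_def)
  have in_H: "a \<in> arcs (fst H)" if "ue a \<in> c" for a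
    using ue_in_edges_submultigraph[OF H] that cH by blast
  have "edges H \<subseteq> E"
  proof
    fix e assume "e \<in> edges H"
    then obtain x where "x \<in> arcs (fst H)" "e = undirected_edge H x" by (auto simp: edges_def)
    then show "e \<in> E" using undirected_edge_submultigraph[OF H, of x] sub(2) by auto
  qed
  moreover have "even (card {a \<in> out v. ue a \<in> c})" for v
  proof -
    have eq: "{a \<in> out v. ue a \<in> c} = {a \<in> out_arcs (fst H) v. undirected_edge H a \<in> c}"
    proof (intro set_eqI iffI)
      fix a assume "a \<in> {a \<in> out v. ue a \<in> c}"
      then have "a \<in> arcs (fst H)" "ta a = v" "ue a \<in> c" using in_H by auto
      then show "a \<in> {a \<in> out_arcs (fst H) v. undirected_edge H a \<in> c}"
        using undirected_edge_submultigraph[OF H, of a] sub(4) by simp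
    next
      fix a assume "a \<in> {a \<in> out_arcs (fst H) v. undirected_edge H a \<in> c}"
      then have "a \<in> arcs (fst H)" "ta a = v" "undirected_edge H a \<in> c" using sub(4) by auto
      then show "a \<in> {a \<in> out v. ue a \<in> c}"
        using undirected_edge_submultigraph[OF H, of a] sub(2) by auto
    qed
    show ?thesis
    proof (cases "v \<in> verts (fst H)")
      case True
      then show ?thesis using c unfolding eq cycle_space_def edge_boundary_def by blast
    next
      case False
      then have "{a \<in> out_arcs (fst H) v. undirected_edge H a \<in> c} = {}"
        using wf_digraph.tail_in_verts[OF sub(3)] by auto
      then show ?thesis unfolding eq by (simp only: card.empty even_zero)
    qed
  qed
  ultimately show "c \<in> cycle_space M"
    using cH by (auto simp: cycle_space_def edge_boundary_def)
qed

text \<open>After deletion of the edge its ends are still joined by a path, which the edge closes to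
  a cycle.\<close>

lemma arc_in_cycle:
  assumes "two_edge_connected M" "a \<in> A"
  shows "\<exists>z\<in>cycle_space M. ue a \<in> z"
proof -
  have conn: "Digraph_Component.connected ((fst M)\<lparr>arcs := A - ue a\<rparr>)"
    using assms by (simp add: two_edge_connected_def)
  obtain c where c: "c \<subseteq> ue ` (A - ue a)" "edge_boundary M c = sym_diff {ta a} {he a}"
    using path_edge_set[OF conn Diff_subset, of "ta a" "he a"] assms(2) by auto
  have "ue a \<notin> c"
  proof
    assume "ue a \<in> c"
    then obtain b where "b \<in> A" "b \<notin> ue a" "ue b = ue a" using c(1) by blast
    then show False by (auto simp: undirected_edge_def)
  qed
  then have in_z: "ue a \<in> sym_diff c {ue a}" by blast
  have "c \<subseteq> E" using c(1) by (auto simp: edges_def)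
  then have z_E: "sym_diff c {ue a} \<subseteq> E" using assms(2) by auto
  have "edge_boundary M (sym_diff c {ue a}) = {}"
    by (simp add: edge_boundary_sym_diff edge_boundary_single[OF assms(2)] c(2))
  then have "sym_diff c {ue a} \<in> cycle_space M"
    unfolding cycle_space_def using z_E by (intro CollectI conjI PowI)
  then show ?thesis using in_z by (rule rev_bexI)
qed

text \<open>By connectedness a proper nonempty subgraph misses an edge, and a cycle of
  \<open>M\<close> through this edge is missing from the cycle space of \<open>H\<close>. As
  \<open>H\<close> may be disconnected, its cycle space is only bounded from below by its Betti
  number.\<close>

lemma betti_number_submultigraph_less:
  assumes conn: "Digraph_Component.connected (fst M)" and two: "two_edge_connected M"
    and H: "submultigraph H M" "H \<noteq> M" "verts (fst H) \<noteq> {}"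
  shows "betti_number H < betti_number M"
proof -
  have sub: "verts (fst H) \<subseteq> V" "arcs (fst H) \<subseteq> A" "wf_digraph (fst H)" "compatible (fst M) (fst H)"
    and bH: "bidirected_digraph (fst H) (snd H)" and rev: "\<forall>a\<in>arcs (fst H). snd H a = rv a"
    using H(1) by (simp_all add: submultigraph_def subgraph_def)
  have finH: "fin_digraph (fst H)"
    using wf_digraph.fin_digraphI[OF sub(3)] finite_subset[OF sub(1)] finite_subset[OF sub(2)] by simp
  interpret H: finite_multigraph H by (rule finite_multigraph.intro[OF finH bH])
  have "\<exists>a. a \<in> A \<and> a \<notin> arcs (fst H)"
  proof (rule ccontr)
    assume "\<nexists>a. a \<in> A \<and> a \<notin> arcs (fst H)"
    then have arcs: "arcs (fst H) = A" using sub(2) by blast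
    obtain u where u: "u \<in> verts (fst H)" using H(3) by blast
    have "w \<in> verts (fst H)" if "w \<in> V" for w
    proof -
      have "u \<in> verts (fst H) \<longleftrightarrow> w \<in> verts (fst H)"
      proof (rule connected_closed[OF conn _ that])
        show "u \<in> V" using u sub(1) by blast
        fix a assume "a \<in> A"
        then have "tail (fst H) a \<in> verts (fst H)" "head (fst H) a \<in> verts (fst H)"
          using arcs H.tail_in_verts H.head_in_verts by auto
        then show "ta a \<in> verts (fst H) \<longleftrightarrow> he a \<in> verts (fst H)"
          using sub(4) by (simp add: compatible_def)
      qed
      then show ?thesis using u by blast
    qed
    then have verts: "verts (fst H) = V" using sub(1) by blast
    have "fst H = fst M"
      using verts arcs sub(4) by (intro pre_digraph.equality) (simp_all add: compatible_def)
    \<comment> \<open>Outside the arcs both involutions are the identity, so they agree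
      everywhere.\<close>
    moreover have "snd H = snd M"
    proof
      fix a
      show "snd H a = snd M a"
        using rev arev_eq[of a] H.arev_eq[of a] arcs by (cases "a \<in> A") auto
    qed
    ultimately show False using H(2) by (simp add: prod_eq_iff)
  qed
  then obtain a where a: "a \<in> A" "a \<notin> arcs (fst H)" by blast
  obtain z where z: "z \<in> cycle_space M" "ue a \<in> z" using arc_in_cycle[OF two a(1)] by blast
  have "z \<notin> cycle_space H"
    using ue_in_edges_submultigraph[OF H(1), of a] a(2) z(2) by (auto simp: cycle_space_def)
  then have "cycle_space H \<subset> cycle_space M" using cycle_space_submultigraph[OF H(1)] z(1) by blast
  then have less: "card (cycle_space H) < card (cycle_space M)"
    by (rule psubset_card_mono[OF finite_cycle_space])
  have VH: "card (verts (fst H)) > 0" using H(3) by (simp add: card_gt_0_iff)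
  have "2 ^ card (edges H) < card (cycle_space M) * 2 ^ (card (verts (fst H)) - 1)"
    by (rule le_less_trans[OF H.card_cycle_space_ge[OF H(3)] mult_less_mono1[OF less]]) simp
  then have "(2::nat) ^ card (edges H) < 2 ^ (betti_number M + (card (verts (fst H)) - 1))"
    using card_cycle_space_betti(1)[OF conn] by (simp add: power_add)
  then have "card (edges H) < betti_number M + (card (verts (fst H)) - 1)"
    by (rule power_less_imp_less_exp[rotated]) simp
  \<comment> \<open>Covers the case in which the subtraction in \<open>betti_number H\<close> is
    truncated to 0.\<close>
  moreover have "betti_number M > 0"
  proof (rule ccontr)
    assume "\<not> betti_number M > 0"
    then have "card (cycle_space H) = 0"
      using less card_cycle_space_betti(1)[OF conn] by simp
    then show False
      using sym_diff_closedD(1)[OF H.sym_diff_closed_cycle_space] H.finite_cycle_space by auto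
  qed
  ultimately show ?thesis using VH unfolding betti_number_def[of H] by linarith
qed

end

lemma finite_multigraph_if_connected_multigraph:
  "connected_multigraph M \<Longrightarrow> finite_multigraph M"
  by (simp add: connected_multigraph_def finite_multigraph_def)

text \<open>Each graph shares its Betti number with a homeomorphic subgraph of the next graph. This
  subgraph is proper, since different members of the sequence are not homeomorphic.\<close>

lemma betti_number_strictly_monotone:
  fixes G :: "nat \<Rightarrow> ('v::infinite, 'e::infinite) multigraph"
  assumes conn: "\<And>n. connected_multigraph (G n)" and mono: "strictly_monotone G"
    and two: "\<And>n. two_edge_connected (G n)"
  shows "n \<le> betti_number (G n)"
proof (induction n)
  case (Suc n)
  obtain H where H: "submultigraph H (G (Suc n))" "homeomorphic_graphs (G n) H"
    using mono unfolding strictly_monotone_def by blast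
  interpret G: finite_multigraph "G n" by (rule finite_multigraph_if_connected_multigraph[OF conn])
  interpret GS: finite_multigraph "G (Suc n)" by (rule finite_multigraph_if_connected_multigraph[OF conn])
  have "\<not> homeomorphic_graphs (G n) (G (Suc n))"
    using mono unfolding strictly_monotone_def by (metis n_not_Suc_n)
  then have ne: "H \<noteq> G (Suc n)" using H(2) by blast
  have connd: "Digraph_Component.connected (fst (G n))" "Digraph_Component.connected (fst (G (Suc n)))"
    using conn by (simp_all add: connected_multigraph_def)
  note inv = homeomorphism_invariant_homeomorphic[OF H(2)]
  have sub: "verts (fst H) \<subseteq> verts (fst (G (Suc n)))" "arcs (fst H) \<subseteq> arcs (fst (G (Suc n)))"
    "wf_digraph (fst H)" and bH: "bidirected_digraph (fst H) (snd H)"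
    using H(1) by (simp_all add: submultigraph_def subgraph_def)
  have finH: "finite (verts (fst H))" "finite (arcs (fst H))"
    using finite_subset[OF sub(1)] finite_subset[OF sub(2)] by simp_all
  interpret H: finite_multigraph H
    by (rule finite_multigraph.intro[OF wf_digraph.fin_digraphI[OF sub(3) finH] bH])
  \<comment> \<open>This uses the first component of the invariant: in the second one, an empty
    graph looks like a graph of Betti number 1.\<close>
  have "verts (fst (G n)) \<noteq> {}" by (rule connected_nonempty[OF connd(1)])
  then have VH: "verts (fst H) \<noteq> {}" using inv by (simp add: homeomorphism_invariant_def)
  have "int (card (arcs (fst (G n)))) - 2 * int (card (verts (fst (G n)))) =
      int (card (arcs (fst H))) - 2 * int (card (verts (fst H)))"
    using inv finH by (simp add: homeomorphism_invariant_def)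
  then have "betti_number (G n) = betti_number H"
    unfolding betti_number_def G.card_arcs H.card_arcs by linarith
  also have "\<dots> < betti_number (G (Suc n))"
    by (rule GS.betti_number_submultigraph_less[OF connd(2) two H(1) ne VH])
  finally show ?case using Suc.IH by simp
qed simp

subsection \<open>The Euler-genus of a random general embedding\<close>

lemma map_pmf_of_set_constant_fibers:
  assumes "finite S" "S \<noteq> {}" and k: "\<And>y. y \<in> f ` S \<Longrightarrow> card {x \<in> S. f x = y} = k"
  shows "map_pmf f (pmf_of_set S) = pmf_of_set (f ` S)"
proof (rule pmf_eqI)
  fix y
  have "card S = (\<Sum>y\<in>f ` S. card {x \<in> S. f x = y})"
    unfolding card_eq_sum by (rule sum.image_gen[OF assms(1)])
  also have "\<dots> = (\<Sum>y\<in>f ` S. k)" by (rule sum.cong[OF refl k])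
  finally have S: "card S = card (f ` S) * k" by simp
  have "card S \<noteq> 0" using assms(1,2) by simp
  then have k0: "k \<noteq> 0" "card (f ` S) \<noteq> 0" using S by auto
  have "pmf (map_pmf f (pmf_of_set S)) y = real (card (S \<inter> f -` {y})) / real (card S)"
    unfolding pmf_map by (rule measure_pmf_of_set[OF assms(2,1)])
  also have "S \<inter> f -` {y} = {x \<in> S. f x = y}" by auto
  also have "real (card {x \<in> S. f x = y}) / real (card S) = pmf (pmf_of_set (f ` S)) y"
  proof (cases "y \<in> f ` S")
    case True
    then show ?thesis using k[OF True] k0 S assms(1,2) by (simp add: indicator_def)
  next
    case False
    then have "{x \<in> S. f x = y} = {}" by auto
    then show ?thesis using False assms(1,2) by (simp add: indicator_def)
  qed
  finally show "pmf (map_pmf f (pmf_of_set S)) y = pmf (pmf_of_set (f ` S)) y" .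
qed

context finite_multigraph
begin

abbreviation "SRS \<equiv> signed_rotation_systems M"

lemma finite_SRS: "finite SRS"
  unfolding signed_rotation_systems_def using finite_RS finite_E by simp

lemma SRS_nonempty: "SRS \<noteq> {}"
  unfolding signed_rotation_systems_def using RS_nonempty by auto

section \<open>Classes of signed rotation systems\<close>

lemma vertex_of_degree_at_least_3:
  assumes "betti \<ge> 2"
  shows "\<exists>v\<in>V. card (out v) \<ge> 3"
proof (rule ccontr)
  assume "\<not> (\<exists>v\<in>V. card (out v) \<ge> 3)"
  then have le: "card (out v) \<le> 2" if "v \<in> V" for v
  proof -
    have "\<not> card (out v) \<ge> 3" using \<open>\<not> (\<exists>v\<in>V. card (out v) \<ge> 3)\<close> that by blast
    then show ?thesis by linarith
  qed
  have "{a \<in> A. ta a \<in> V \<and> True} = A" by auto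
  then have "card A = (\<Sum>v\<in>V. card (out v))"
    using sum_card_out[OF order_refl, of "\<lambda>_. True"] by (simp add: out_arcs_def)
  also have "\<dots> \<le> (\<Sum>v\<in>V. 2)" by (rule sum_mono[OF le])
  finally have "card E \<le> card V" unfolding card_arcs by simp
  then show False using assms by (simp add: betti_number_def)
qed

text \<open>An empty cut leaves only \<open>S = {}\<close> or \<open>S = V\<close>. Reversing
  everywhere inverts the rotation, and a cyclic permutation that equals its inverse moves at most
  two points, against a vertex of degree at least 3.\<close>

lemma reverse_at_eq_self:
  assumes conn: "Digraph_Component.connected (fst M)" and "betti \<ge> 2"
    and \<sigma>: "\<sigma> \<in> SRS" and S: "S \<subseteq> V" "reverse_at M S \<sigma> = \<sigma>"
  shows "S = {}"
proof -
  obtain rot T where rT: "\<sigma> = (rot, T)" "rot \<in> RS" using \<sigma> by (auto simp: signed_rotation_systems_def)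
  have "sym_diff T (cut_edges M S) = sym_diff T {}" using S(2) by (simp add: reverse_at_def rT(1))
  then have "cut_edges M S = {}" by (simp only: sym_diff_left_cancel)
  then consider "S = {}" | "S = V" using cut_edges_eq_empty[OF conn S(1)] by blast
  then show ?thesis
  proof cases
    case 2
    obtain v where v: "v \<in> V" "card (out v) \<ge> 3" using vertex_of_degree_at_least_3[OF assms(2)] by blast
    then have "out v \<noteq> {}" by auto
    then obtain a where a: "a \<in> out v" by blast
    have inv: "rot b = inv rot b" if "b \<in> A" for b
    proof -
      have "(\<lambda>a. if a \<in> A \<and> ta a \<in> S then inv rot a else rot a) = rot"
        using S(2) by (simp add: reverse_at_def rT(1))
      from fun_cong[OF this, of b] show ?thesis using that 2 by simp
    qed
    have rr: "rot (rot b) = b" if "b \<in> A" for b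
      using inv[OF that] rotation_system_arcs(5)[OF bidir rT(2), of b] by simp
    have "cyclic_on rot (out v)" using rT(2) v(1) \<open>out v \<noteq> {}\<close> unfolding rotation_systems_def by blast
    then have orb: "out v = orbit rot a" using a by (simp add: cyclic_on_alldef)
    have "x \<in> {a, rot a}" if "x \<in> orbit rot a" for x
      using that
    proof induction
      case (step y)
      then show ?case using rr[of a] a by auto
    qed simp
    then have "out v \<subseteq> {a, rot a}" unfolding orb by blast
    then have "card (out v) \<le> card {a, rot a}" by (rule card_mono[rotated]) simp
    also have "\<dots> \<le> 2" by (simp add: card_insert_if)
    finally show ?thesis using v(2) by simp
  qed
qed

lemma card_reversal_class:
  assumes conn: "Digraph_Component.connected (fst M)" and "betti \<ge> 2" and \<sigma>: "\<sigma> \<in> SRS"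
  shows "card (reversal_rel M `` {\<sigma>}) = 2 ^ card V"
proof -
  have "reversal_rel M `` {\<sigma>} = (\<lambda>S. reverse_at M S \<sigma>) ` Pow V"
  proof (intro set_eqI iffI)
    fix \<tau> assume "\<tau> \<in> (\<lambda>S. reverse_at M S \<sigma>) ` Pow V"
    then have "(\<sigma>, \<tau>) \<in> reversal_rel M" unfolding reversal_rel_def using \<sigma> by blast
    then show "\<tau> \<in> reversal_rel M `` {\<sigma>}" by simp
  qed (auto simp: reversal_rel_def)
  moreover have "inj_on (\<lambda>S. reverse_at M S \<sigma>) (Pow V)"
  proof (rule inj_onI)
    fix S S' assume S: "S \<in> Pow V" "S' \<in> Pow V" "reverse_at M S \<sigma> = reverse_at M S' \<sigma>"
    have "reverse_at M (sym_diff S S') \<sigma> = reverse_at M S' (reverse_at M S' \<sigma>)"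
      using reverse_at_reverse_at[OF bidir \<sigma>, of S' S] S(3) by simp
    also have "\<dots> = reverse_at M {} \<sigma>" using reverse_at_reverse_at[OF bidir \<sigma>, of S' S'] by simp
    also have "\<dots> = \<sigma>" by (auto simp: reverse_at_def cut_edges_def split: prod.split)
    finally have "reverse_at M (sym_diff S S') \<sigma> = \<sigma>" .
    moreover have "sym_diff S S' \<subseteq> V" using S(1,2) by auto
    ultimately have "sym_diff S S' = {}" using reverse_at_eq_self[OF conn assms(2) \<sigma>] by blast
    then show "S = S'" by auto
  qed
  ultimately show ?thesis by (simp add: card_image card_Pow)
qed

text \<open>The reversals act freely, so every class has \<open>2 ^ card V\<close> elements and the
  uniform distribution passes to the quotient.\<close>

lemma pmf_of_general_embeddings:
  assumes conn: "Digraph_Component.connected (fst M)" and "betti \<ge> 2"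
  shows "pmf_of_set (general_embeddings M) = map_pmf (\<lambda>\<sigma>. reversal_rel M `` {\<sigma>}) (pmf_of_set SRS)"
proof -
  note eq = equiv_reversal_rel[OF fin bidir]
  have img: "general_embeddings M = (\<lambda>\<sigma>. reversal_rel M `` {\<sigma>}) ` SRS"
    by (auto simp: general_embeddings_def quotient_def)
  have "map_pmf (\<lambda>\<sigma>. reversal_rel M `` {\<sigma>}) (pmf_of_set SRS) =
      pmf_of_set ((\<lambda>\<sigma>. reversal_rel M `` {\<sigma>}) ` SRS)"
  proof (rule map_pmf_of_set_constant_fibers[OF finite_SRS SRS_nonempty])
    fix y assume "y \<in> (\<lambda>\<sigma>. reversal_rel M `` {\<sigma>}) ` SRS"
    then obtain \<sigma> where \<sigma>: "\<sigma> \<in> SRS" "y = reversal_rel M `` {\<sigma>}" by blast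
    have "{x \<in> SRS. reversal_rel M `` {x} = y} = reversal_rel M `` {\<sigma>}"
    proof (intro set_eqI iffI)
      fix x assume "x \<in> {x \<in> SRS. reversal_rel M `` {x} = y}"
      then have "x \<in> SRS" "reversal_rel M `` {\<sigma>} = reversal_rel M `` {x}" using \<sigma>(2) by auto
      then show "x \<in> reversal_rel M `` {\<sigma>}" using eq_equiv_class_iff[OF eq \<sigma>(1)] by simp
    next
      fix x assume "x \<in> reversal_rel M `` {\<sigma>}"
      then have x: "(\<sigma>, x) \<in> reversal_rel M" by simp
      then have "x \<in> SRS" using eq equiv_type by blast
      then show "x \<in> {x \<in> SRS. reversal_rel M `` {x} = y}"
        using equiv_class_eq[OF eq x] \<sigma>(2) by simp
    qed
    then show "card {x \<in> SRS. reversal_rel M `` {x} = y} = 2 ^ card V"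
      using card_reversal_class[OF conn assms(2) \<sigma>(1)] by simp
  qed
  then show ?thesis using img by simp
qed

text \<open>The fibres over the twisted sets are equally large, and each is multiplied by the same
  number of rotations.\<close>

lemma odd_part_uniform:
  assumes C: "disjoint C" "{} \<notin> C" "C \<subseteq> Pow E"
  shows "map_pmf (\<lambda>\<sigma>. odd_part C (snd \<sigma>)) (pmf_of_set SRS) = pmf_of_set (Pow C)"
proof -
  define k where "k = card {h \<in> Pow E. odd_part C h = {}}"
  have img: "(\<lambda>\<sigma>. odd_part C (snd \<sigma>)) ` SRS = Pow C"
  proof -
    have "snd ` SRS = Pow E"
      unfolding signed_rotation_systems_def using RS_nonempty by simp
    then show ?thesis
      using odd_part_image_Pow[OF C] by (metis image_image)
  qed
  have "map_pmf (\<lambda>\<sigma>. odd_part C (snd \<sigma>)) (pmf_of_set SRS) =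
      pmf_of_set ((\<lambda>\<sigma>. odd_part C (snd \<sigma>)) ` SRS)"
  proof (rule map_pmf_of_set_constant_fibers[OF finite_SRS SRS_nonempty])
    fix J assume "J \<in> (\<lambda>\<sigma>. odd_part C (snd \<sigma>)) ` SRS"
    then have J: "J \<subseteq> C" using img by blast
    have "card {h \<in> Pow E. odd_part C h = J} * 2 ^ card C = k * 2 ^ card C"
      unfolding k_def using card_odd_part_fiber[OF finite_E C J] card_odd_part_fiber[OF finite_E C, of "{}"] by simp
    then have "card {h \<in> Pow E. odd_part C h = J} = k" by simp
    moreover have "{\<sigma> \<in> SRS. odd_part C (snd \<sigma>) = J} = RS \<times> {h \<in> Pow E. odd_part C h = J}"
      by (auto simp: signed_rotation_systems_def)
    ultimately show "card {\<sigma> \<in> SRS. odd_part C (snd \<sigma>) = J} = card RS * k"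
      by (simp add: card_cartesian_product)
  qed
  then show ?thesis using img by simp
qed

text \<open>A connected graph with an arc has no vertex without edge-ends, so the correction term in
  \<open>num_faces\<close> vanishes.\<close>

lemma euler_genus_eq:
  assumes conn: "Digraph_Component.connected (fst M)" and A: "A \<noteq> {}"
  shows "euler_genus M \<sigma> = int betti + 1 - int (card (faces M \<sigma>))"
proof -
  obtain a where a: "a \<in> A" using A by blast
  have "out v \<noteq> {}" if "v \<in> V" for v
  proof -
    have "out (ta a) \<noteq> {} \<longleftrightarrow> out v \<noteq> {}"
    proof (rule connected_closed[OF conn _ that])
      fix b assume b: "b \<in> A"
      then have "b \<in> out (ta b)" "rv b \<in> out (he b)" by simp_all
      then show "out (ta b) \<noteq> {} \<longleftrightarrow> out (he b) \<noteq> {}" by blast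
    qed (use a in simp)
    moreover have "a \<in> out (ta a)" using a by simp
    ultimately show ?thesis by blast
  qed
  then have "{v \<in> V. out v = {}} = {}" by blast
  then have "num_faces M \<sigma> = card (faces M \<sigma>)" unfolding num_faces_def by (simp only: card.empty add_0_right)
  then show ?thesis using card_cycle_space_betti(2)[OF conn] unfolding euler_genus_def by linarith
qed

text \<open>The family \<open>C\<close> stems from one rotation with the fewest faces, but serves
  for all: every other rotation has at least as many untwisted faces, hence an untwisted radical of
  codimension at most \<open>k\<close>.\<close>

lemma euler_genus_decomposition:
  assumes conn: "Digraph_Component.connected (fst M)" and b2: "betti \<ge> 2"
    and K: "2 * max_genus M \<le> real k"
  obtains C where "betti \<le> card C + k"
    and "map_pmf (\<lambda>\<sigma>. odd_part C (snd \<sigma>)) (pmf_of_set SRS) = pmf_of_set (Pow C)"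
    and "\<And>\<sigma>. \<sigma> \<in> SRS \<Longrightarrow>
      \<bar>real_of_int (euler_genus M \<sigma>) - ((real betti - real (card C)) + real (card (odd_part C (snd \<sigma>))))\<bar>
        \<le> 2 * real k"
proof -
  have A: "A \<noteq> {}"
  proof
    assume "A = {}"
    then have "E = {}" by (simp add: edges_def)
    moreover have "card V > 0" using connected_nonempty[OF conn] by (simp add: card_gt_0_iff)
    ultimately show False using b2 by (simp add: betti_number_def)
  qed
  obtain rot where rot: "rot \<in> RS"
    and minimal: "\<And>rot'. rot' \<in> RS \<Longrightarrow> card (faces M (rot, {})) \<le> card (faces M (rot', {}))"
  proof -
    obtain rot0 where "rot0 \<in> RS" using RS_nonempty by blast
    from ex_has_least_nat[of "\<lambda>rot. rot \<in> RS", OF this, of "\<lambda>rot. card (faces M (rot, {}))"]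
    show thesis using that by blast
  qed
  have "genus M rot \<le> max_genus M"
    unfolding max_genus_def using finite_RS rot by (intro Max_ge) auto
  then have F: "betti + 1 \<le> card (faces M (rot, {})) + k"
    using K unfolding genus_def euler_genus_eq[OF conn A] by simp
  obtain C where C: "C \<subseteq> cycle_space M" "disjoint C" "{} \<notin> C"
    and cardC: "card (face_space M (rot, {})) \<le> 2 ^ card C"
    using separating_family[OF rot minimal] by blast
  have "(2::nat) ^ (card (faces M (rot, {})) - 1) \<le> 2 ^ card C"
    using cardC unfolding card_face_space_power[OF conn rot A] .
  then have "card (faces M (rot, {})) - 1 \<le> card C" by (rule power_le_imp_le_exp[rotated]) simp
  then have bC: "betti \<le> card C + k" using F by linarith
  have C_E: "C \<subseteq> Pow E" using C(1) by (auto simp: cycle_space_def)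
  show thesis
  proof
    show "betti \<le> card C + k" by (rule bC)
    show "map_pmf (\<lambda>\<sigma>. odd_part C (snd \<sigma>)) (pmf_of_set SRS) = pmf_of_set (Pow C)"
      by (rule odd_part_uniform[OF C(2,3) C_E])
  next
    fix \<sigma> assume "\<sigma> \<in> SRS"
    then obtain rot' T where \<sigma>: "\<sigma> = (rot', T)" "rot' \<in> RS" "T \<subseteq> E"
      by (auto simp: signed_rotation_systems_def)
    have minF: "betti + 1 \<le> card (faces M (rot', {})) + k" using F minimal[OF \<sigma>(2)] by linarith
    note est = faces_estimate[OF conn \<sigma>(2,3) A C bC minF]
    show "\<bar>real_of_int (euler_genus M \<sigma>) - ((real betti - real (card C)) + real (card (odd_part C (snd \<sigma>))))\<bar>
        \<le> 2 * real k"
      using est unfolding euler_genus_eq[OF conn A] \<sigma>(1) by (simp add: abs_le_iff)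
  qed
qed

end

theorem theorem4p10:
  fixes G :: "nat \<Rightarrow> ('v::infinite, 'e::infinite) multigraph"
  assumes "\<And>n. connected_multigraph (G n)"
    and "strictly_monotone G"
    and "\<And>n. two_edge_connected (G n)"
    and "bdd_above (range (\<lambda>n. max_genus (G n)))"
  shows "asymptotically_normal
           (\<lambda>n. measure_pmf (pmf_of_set (general_embeddings (G n))))
           (\<lambda>n C. real_of_int (embedding_euler_genus (G n) C))"
proof -
  obtain B where B: "max_genus (G n) \<le> B" for n
    using assms(4) unfolding bdd_above_def by blast
  \<comment> \<open>The largest orientable Euler-genus is twice the maximum genus; rounded up, it
    bounds codimensions.\<close>
  define k where "k = nat \<lceil>2 * B\<rceil>"
  have k: "2 * max_genus (G n) \<le> real k" for n
    using B[of n] unfolding k_def by linarith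
  have betti: "n \<le> betti_number (G n)" for n
    by (rule betti_number_strictly_monotone[OF assms(1-3)])
  have fg: "finite_multigraph (G n)" for n
    by (rule finite_multigraph_if_connected_multigraph[OF assms(1)])
  have conn: "Digraph_Component.connected (fst (G n))" for n
    using assms(1) by (simp add: connected_multigraph_def)
  \<comment> \<open>From index 2 on the Betti number is at least 2, as freeness of the reversals
    requires; the limit ignores the two earlier graphs.\<close>
  have "\<forall>n. \<exists>C. n \<ge> 2 \<longrightarrow> betti_number (G n) \<le> card C + k \<and>
      map_pmf (\<lambda>\<sigma>. odd_part C (snd \<sigma>)) (pmf_of_set (signed_rotation_systems (G n))) = pmf_of_set (Pow C) \<and>
      (\<forall>\<sigma>\<in>signed_rotation_systems (G n). \<bar>real_of_int (euler_genus (G n) \<sigma>) -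
        ((real (betti_number (G n)) - real (card C)) + real (card (odd_part C (snd \<sigma>))))\<bar> \<le> 2 * real k)"
  proof
    fix n
    interpret finite_multigraph "G n" by (rule fg)
    show "\<exists>C. n \<ge> 2 \<longrightarrow> betti_number (G n) \<le> card C + k \<and>
      map_pmf (\<lambda>\<sigma>. odd_part C (snd \<sigma>)) (pmf_of_set (signed_rotation_systems (G n))) = pmf_of_set (Pow C) \<and>
      (\<forall>\<sigma>\<in>signed_rotation_systems (G n). \<bar>real_of_int (euler_genus (G n) \<sigma>) -
        ((real (betti_number (G n)) - real (card C)) + real (card (odd_part C (snd \<sigma>))))\<bar> \<le> 2 * real k)"
    proof (cases "n \<ge> 2")
      case True
      then have "betti_number (G n) \<ge> 2" using betti[of n] by simp
      from euler_genus_decomposition[OF conn this k] show ?thesis by metis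
    qed simp
  qed
  from choice[OF this] obtain C where C: "\<And>n. n \<ge> 2 \<Longrightarrow> betti_number (G n) \<le> card (C n) + k"
    "\<And>n. n \<ge> 2 \<Longrightarrow> map_pmf (\<lambda>\<sigma>. odd_part (C n) (snd \<sigma>)) (pmf_of_set (signed_rotation_systems (G n))) =
      pmf_of_set (Pow (C n))"
    "\<And>n \<sigma>. n \<ge> 2 \<Longrightarrow> \<sigma> \<in> signed_rotation_systems (G n) \<Longrightarrow> \<bar>real_of_int (euler_genus (G n) \<sigma>) -
        ((real (betti_number (G n)) - real (card (C n))) + real (card (odd_part (C n) (snd \<sigma>))))\<bar> \<le> 2 * real k"
    by blast
  show ?thesis
  proof (rule asymptotically_normal_coin_sums)
    show "filterlim (\<lambda>n. card (C n)) at_top sequentially"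
      unfolding filterlim_at_top
    proof
      fix Z
      show "\<forall>\<^sub>F n in sequentially. Z \<le> card (C n)"
        \<comment> \<open>The Betti number is at least \<open>n\<close>, the family
          \<open>C n\<close> falls short of it by at most \<open>k\<close>, and this is known only
          from index 2 on.\<close>
        using eventually_ge_at_top[of "Z + k + 2"]
      proof eventually_elim
        case (elim n)
        then show ?case using C(1)[of n] betti[of n] by linarith
      qed
    qed
    show "\<forall>\<^sub>F n in sequentially. finite (set_pmf (pmf_of_set (signed_rotation_systems (G n)))) \<and>
      pmf_of_set (general_embeddings (G n)) =
        map_pmf (\<lambda>\<sigma>. reversal_rel (G n) `` {\<sigma>}) (pmf_of_set (signed_rotation_systems (G n))) \<and>
      map_pmf (\<lambda>\<sigma>. odd_part (C n) (snd \<sigma>)) (pmf_of_set (signed_rotation_systems (G n))) =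
        pmf_of_set (Pow (C n)) \<and>
      (\<forall>\<sigma>\<in>set_pmf (pmf_of_set (signed_rotation_systems (G n))).
        \<bar>real_of_int (embedding_euler_genus (G n) (reversal_rel (G n) `` {\<sigma>})) -
          ((real (betti_number (G n)) - real (card (C n))) + real (card (odd_part (C n) (snd \<sigma>))))\<bar>
        \<le> 2 * real k)"
      using eventually_ge_at_top[of 2]
    proof eventually_elim
      case (elim n)
      interpret finite_multigraph "G n" by (rule fg)
      have b: "betti_number (G n) \<ge> 2" using betti[of n] elim by simp
      have set: "set_pmf (pmf_of_set (signed_rotation_systems (G n))) = signed_rotation_systems (G n)"
        by (rule set_pmf_of_set[OF SRS_nonempty finite_SRS])
      have "embedding_euler_genus (G n) (reversal_rel (G n) `` {\<sigma>}) = euler_genus (G n) \<sigma>"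
        if \<sigma>: "\<sigma> \<in> signed_rotation_systems (G n)" for \<sigma>
      proof (rule embedding_euler_genus_eq[OF fin bidir])
        show "reversal_rel (G n) `` {\<sigma>} \<in> general_embeddings (G n)"
          unfolding general_embeddings_def by (rule quotientI[OF \<sigma>])
        show "\<sigma> \<in> reversal_rel (G n) `` {\<sigma>}"
          by (rule equiv_class_self[OF equiv_reversal_rel[OF fin bidir] \<sigma>])
      qed
      then show ?case
        unfolding set using finite_SRS pmf_of_general_embeddings[OF conn b] C(2,3)[OF elim] by simp
    qed
  qed
qed

end
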